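(* Let $t>0$. For every $s\ge 0$, the heat kernel transform $T_t: W_H^{s,2}(\mathbb{R}^n)\to\mathcal{H}_H^{s,2}(\mathbb{C}^n,U_t)$, $f\mapsto T_tf(z)$, is an isomorphism (a bounded linear bijection with bounded inverse).
   Context: $H=-\Delta+|x|^2$ is the Hermite operator on $\mathbb{R}^n$, with spectral decomposition $H=\sum_{k=0}^\infty(2k+n)P_k$, where $P_k$ is the orthogonal projection of $L^2(\mathbb{R}^n)$ onto the eigenspace with eigenvalue $2k+n$ (spanned by the normalised Hermite functions $\Phi_\alpha$, $|\alpha|=k$). $T_t=e^{-tH}$ is the Hermite semigroup, $T_tf=\sum_k e^{-(2k+n)t}P_kf$; for $f\in L^2(\mathbb{R}^n)$ and $t>0$ the function $T_tf$ extends to an entire function $T_tf(z)$ on $\mathbb{C}^n$. For $z=x+iy\in\mathbb{C}^n$, $U_t(z)=2^n(\sinh 4t)^{-n/2}e^{-(\coth 2t)|y|^2+(\tanh 2t)|x|^2}$, and $\mathcal{H}L^2(\mathbb{C}^n,U_t)$ is the space of entire functions $F$ on $\mathbb{C}^n$ with $\int_{\mathbb{C}^n}|F(z)|^2U_t(z)\,dz<\infty$ ($dz$ Lebesgue measure). For $s\ge0$, $W_H^{s,2}(\mathbb{R}^n)$ is the Hermite-Sobolev space of order $s$: the domain of $H^{s/2}$ in $L^2(\mathbb{R}^n)$, with norm squared $\|H^{s/2}f\|_2^2=\sum_k(2k+n)^s\|P_kf\|_2^2$. For $\gamma>0$, $U_{t,\gamma}(z)=\frac{1}{\Gamma(2\gamma)}\int_0^t(t-r)^{2\gamma-1}U_r(z)\,dr$.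 The complexified Hermite operator is $H_{\mathbb C}=\sum_{j=1}^n\big(-\frac{\partial^2}{\partial z_j^2}+z_j^2\big)$, acting on entire functions. For $s\ge0$ let $m$ be the integer with $m-1\le s/2<m$. Then $\mathcal{H}_H^{s,2}(\mathbb{C}^n,U_t)$ is the subspace of those $F\in\mathcal{H}L^2(\mathbb{C}^n,U_t)$ for which $\int_{\mathbb{C}^n}|H_{\mathbb C}^mF(z)|^2U_{t,m-s/2}(z)\,dz<\infty$, with norm squared $$\int_{\mathbb{C}^n}|F(z)|^2U_t(z)\,dz+\int_{\mathbb{C}^n}|H_{\mathbb C}^mF(z)|^2U_{t,m-s/2}(z)\,dz.$$ *)

theory Defs
  imports "HOL-Analysis.Analysis"
begin

section \<open>Square integrable functions on real Euclidean space\<close>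

text \<open>Elements of L2 are represented by Borel functions. Two representatives describe the same
  element iff they agree almost everywhere; this identification is made explicit wherever it
  matters.\<close>

definition L2 :: "(real^'n \<Rightarrow> complex) set" where
  "L2 = {f. f \<in> borel_measurable lborel \<and> integrable lborel (\<lambda>x. (cmod (f x))\<^sup>2)}"

definition L2_inner :: "(real^'n \<Rightarrow> complex) \<Rightarrow> (real^'n \<Rightarrow> complex) \<Rightarrow> complex" where
  "L2_inner f g = (LINT x|lborel. f x * cnj (g x))"

definition L2_norm :: "(real^'n \<Rightarrow> complex) \<Rightarrow> real" where
  "L2_norm f = sqrt (LINT x|lborel. (cmod (f x))\<^sup>2)"

section \<open>Hermite functions and spectral projections\<close>

text \<open>The normalised Hermite function of order k on the line, by Rodrigues' formula.\<close>

definition hermite_fun :: "nat \<Rightarrow> real \<Rightarrow> real" where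
  "hermite_fun k x =
     (-1) ^ k / sqrt (2 ^ k * fact k * sqrt pi)
       * exp (x\<^sup>2 / 2) * (deriv ^^ k) (\<lambda>u. exp (- u\<^sup>2)) x"

definition hermite_Phi :: "('n::finite \<Rightarrow> nat) \<Rightarrow> real^'n \<Rightarrow> complex" where
  "hermite_Phi \<alpha> x = complex_of_real (\<Prod>j\<in>UNIV. hermite_fun (\<alpha> j) (x $ j))"

definition hermite_eigenspace :: "nat \<Rightarrow> (real^'n \<Rightarrow> complex) set" where
  "hermite_eigenspace k =
     {g. \<exists>c. g = (\<lambda>x. \<Sum>\<alpha> | (\<Sum>j\<in>UNIV. \<alpha> j) = k. c \<alpha> * hermite_Phi \<alpha> x)}"

text \<open>The orthogonal projection; the eigenspace consists of continuous functions, so the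
  representative chosen is unique as a function and not only almost everywhere.\<close>

definition hermite_proj :: "nat \<Rightarrow> (real^'n \<Rightarrow> complex) \<Rightarrow> real^'n \<Rightarrow> complex" where
  "hermite_proj k f = (THE g. g \<in> hermite_eigenspace k \<and>
     (\<forall>h\<in>hermite_eigenspace k. L2_inner (\<lambda>x. f x - g x) h = 0))"

section \<open>Hermite-Sobolev spaces\<close>

definition hermite_sobolev :: "real \<Rightarrow> (real^'n \<Rightarrow> complex) set" where
  "hermite_sobolev s = {f \<in> L2.
     summable (\<lambda>k. real (2 * k + CARD('n)) powr s * (L2_norm (hermite_proj k f))\<^sup>2)}"

definition hermite_sobolev_norm :: "real \<Rightarrow> (real^'n \<Rightarrow> complex) \<Rightarrow> real" where
  "hermite_sobolev_norm s f =
     sqrt (\<Sum>k. real (2 * k + CARD('n)) powr s * (L2_norm (hermite_proj k f))\<^sup>2)"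

section \<open>Entire functions of several variables and the Hermite semigroup\<close>

definition entire :: "(complex^'n \<Rightarrow> complex) \<Rightarrow> bool" where
  "entire F \<longleftrightarrow>
     (\<forall>z. \<exists>D. (F has_derivative D) (at z) \<and> (\<forall>c v. D (c *s v) = c * D v))"

definition complex_vec :: "real^'n \<Rightarrow> complex^'n" where
  "complex_vec x = (\<chi> j. complex_of_real (x $ j))"

text \<open>The function g represents the L2 sum defining the Hermite semigroup at time t applied
  to f.\<close>

definition is_hermite_semigroup ::
    "real \<Rightarrow> (real^'n \<Rightarrow> complex) \<Rightarrow> (real^'n \<Rightarrow> complex) \<Rightarrow> bool" where
  "is_hermite_semigroup t f g \<longleftrightarrow> g \<in> L2 \<and>
     (\<lambda>N. L2_norm (\<lambda>x. g x -
        (\<Sum>k<N. complex_of_real (exp (- (real (2 * k + CARD('n)) * t))) * hermite_proj k f x)))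
       \<longlonglongrightarrow> 0"

text \<open>The entire function whose restriction to real vectors is (almost everywhere) the Hermite
  semigroup applied to f.\<close>

definition heat_transform ::
    "real \<Rightarrow> (real^'n \<Rightarrow> complex) \<Rightarrow> complex^'n \<Rightarrow> complex" where
  "heat_transform t f =
     (THE F. entire F \<and> is_hermite_semigroup t f (\<lambda>x. F (complex_vec x)))"

section \<open>Holomorphic Hermite-Sobolev spaces\<close>

definition re_vec :: "complex^'n \<Rightarrow> real^'n" where
  "re_vec z = (\<chi> j. Re (z $ j))"

definition im_vec :: "complex^'n \<Rightarrow> real^'n" where
  "im_vec z = (\<chi> j. Im (z $ j))"

definition weight_U :: "real \<Rightarrow> complex^'n \<Rightarrow> real" where
  "weight_U t z = 2 ^ CARD('n) * sinh (4 * t) powr (- (real CARD('n) / 2))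
     * exp (- (cosh (2 * t) / sinh (2 * t)) * (norm (im_vec z))\<^sup>2
            + tanh (2 * t) * (norm (re_vec z))\<^sup>2)"

text \<open>Extended-valued: the integral may diverge at r = 0 on the null set of real vectors z.\<close>

definition weight_U_frac :: "real \<Rightarrow> real \<Rightarrow> complex^'n \<Rightarrow> ennreal" where
  "weight_U_frac t \<gamma> z = ennreal (1 / Gamma (2 * \<gamma>)) *
     (\<integral>\<^sup>+r\<in>{0<..<t}. ennreal ((t - r) powr (2 * \<gamma> - 1) * weight_U r z) \<partial>lborel)"

definition weighted_norm2 ::
    "(complex^'n \<Rightarrow> ennreal) \<Rightarrow> (complex^'n \<Rightarrow> complex) \<Rightarrow> ennreal" where
  "weighted_norm2 w F = (\<integral>\<^sup>+z. ennreal ((cmod (F z))\<^sup>2) * w z \<partial>lborel)"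

definition HL2 :: "real \<Rightarrow> (complex^'n \<Rightarrow> complex) set" where
  "HL2 t = {F. entire F \<and> weighted_norm2 (\<lambda>z. ennreal (weight_U t z)) F < \<infinity>}"

definition cpartial :: "'n \<Rightarrow> (complex^'n \<Rightarrow> complex) \<Rightarrow> complex^'n \<Rightarrow> complex" where
  "cpartial j F z = deriv (\<lambda>w. F (\<chi> i. if i = j then w else z $ i)) (z $ j)"

definition hermite_op_C :: "(complex^'n \<Rightarrow> complex) \<Rightarrow> complex^'n \<Rightarrow> complex" where
  "hermite_op_C F z =
     (\<Sum>j\<in>UNIV. - cpartial j (cpartial j F) z + (z $ j)\<^sup>2 * F z)"

definition sob_order :: "real \<Rightarrow> nat" where
  "sob_order s = nat (\<lfloor>s / 2\<rfloor> + 1)"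

lemma sob_order_unique:
  assumes "0 \<le> s"
  shows "of_int m - 1 \<le> s / 2 \<and> s / 2 < of_int m \<longleftrightarrow> m = int (sob_order s)"
  using assms unfolding sob_order_def by (auto simp: floor_eq_iff) linarith+

definition hol_sobolev_top :: "real \<Rightarrow> real \<Rightarrow> (complex^'n \<Rightarrow> complex) \<Rightarrow> ennreal" where
  "hol_sobolev_top s t F =
     weighted_norm2 (weight_U_frac t (real (sob_order s) - s / 2))
       ((hermite_op_C ^^ sob_order s) F)"

definition hol_sobolev :: "real \<Rightarrow> real \<Rightarrow> (complex^'n \<Rightarrow> complex) set" where
  "hol_sobolev s t = {F \<in> HL2 t. hol_sobolev_top s t F < \<infinity>}"

definition hol_sobolev_norm :: "real \<Rightarrow> real \<Rightarrow> (complex^'n \<Rightarrow> complex) \<Rightarrow> real" where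
  "hol_sobolev_norm s t F = sqrt (enn2real
     (weighted_norm2 (\<lambda>z. ennreal (weight_U t z)) F + hol_sobolev_top s t F))"

end

theory Submission
  imports Defs "HOL-Complex_Analysis.Complex_Analysis" "HOL-Probability.Probability"
begin

text \<open>Write \<open>\<lambda>\<^sub>k = 2 * k + n\<close>. The Hermite functions \<open>\<Phi>\<^sub>\<alpha>\<close> extend to entire functions on complex space
(\<open>PhiC\<close> below), and the theorem rests on the fact that they are orthogonal twice over: they are
orthonormal on real space, and with respect to the weight at time \<open>r\<close> on complex space they are
still orthogonal, the square of the norm of \<open>\<Phi>\<^sub>\<alpha>\<close> with \<open>\<bar>\<alpha>\<bar> = k\<close> being
\<open>(2 * \<pi>) powr (n / 2) * exp (2 * \<lambda>\<^sub>k * r)\<close> (\<open>orth_family_real\<close>, \<open>orth_family_plane\<close>). The heat kernel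
transform multiplies the Hermite coefficients by \<open>exp (- \<lambda>\<^sub>k * t)\<close>, which cancels the exponential
exactly. So up to a constant factor it maps the square integrable functions isometrically onto the
sums of those Hermite series that converge in the weighted space (\<open>heat_transform_eq\<close>,
\<open>synth_isometry\<close>, \<open>rapid_is_heat_coef\<close>).

Every entire function \<open>F\<close> in the weighted space is such a series (\<open>entire_sqi_expansion\<close>). The reason
is Mehler's formula: the sum of \<open>\<rho> ^ \<bar>\<alpha>\<bar> * \<Phi>\<^sub>\<alpha> z * cnj (\<Phi>\<^sub>\<alpha> w)\<close> has a closed form, and for
\<open>\<rho> = exp (- 4 * t)\<close> the product of its conjugate with the weight is a rotation invariant Gaussian centred
at \<open>w\<close> times a function holomorphic in \<open>z\<close>. The mean value property therefore shows that pairing \<open>F\<close>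
with the kernel gives a multiple of \<open>F w\<close> (\<open>mehlerN_reproducing\<close>), while expanding the kernel gives
the Hermite series of \<open>F\<close> at \<open>w\<close>. On real space the same closed form yields all sufficiently narrow Gaussians, and this
proves that the Hermite functions are complete there (\<open>hermite_complete\<close>).

For the order \<open>s\<close> put \<open>\<gamma> = m - s / 2\<close>. The complexified Hermite operator multiplies the coefficients by
\<open>\<lambda>\<^sub>k\<close>, and by Tonelli's theorem the norm with the fractional weight of order
\<open>\<gamma>\<close> is a fractional integral of the norms
at the times \<open>r < t\<close>. Hence the level \<open>k\<close> contributes to the top order term the square of the norm of
\<open>P\<^sub>k f\<close> times
\<open>\<lambda>\<^sub>k ^ (2 * m) * \<integral> r \<in> {0..t}. (t - r) powr (2 * \<gamma> - 1) * exp (- 2 * \<lambda>\<^sub>k * (t - r))\<close>, up to a constant.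
Rescaling turns the integral into \<open>(2 * \<lambda>\<^sub>k) powr (- 2 * \<gamma>)\<close> times a Gamma integral truncated at
\<open>2 * \<lambda>\<^sub>k * t\<close>. The truncated integrals lie between two positive constants because \<open>\<lambda>\<^sub>k \<ge> 1\<close>, and
\<open>2 * m - 2 * \<gamma> = s\<close>, so the top order term is comparable to the square of the Hermite--Sobolev norm
(\<open>hol_sobolev_top_bounds\<close>). Since \<open>\<lambda>\<^sub>k \<ge> 1\<close> the latter also dominates the lower order term.\<close>

section \<open>Square integrable functions on a measure space\<close>

text \<open>The same notions are used for Lebesgue measure on real space and for the Gaussian measures on complex
space, so they are developed over an arbitrary measure. As members of \<open>L2\<close> they are functions and not
classes of functions.\<close>

definition sqi :: "'a measure \<Rightarrow> ('a \<Rightarrow> complex) set" where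
  "sqi M = {f. f \<in> borel_measurable M \<and> integrable M (\<lambda>x. (cmod (f x))\<^sup>2)}"

definition ip :: "'a measure \<Rightarrow> ('a \<Rightarrow> complex) \<Rightarrow> ('a \<Rightarrow> complex) \<Rightarrow> complex" where
  "ip M f g = (LINT x|M. f x * cnj (g x))"

definition nsq :: "'a measure \<Rightarrow> ('a \<Rightarrow> complex) \<Rightarrow> real" where
  "nsq M f = (LINT x|M. (cmod (f x))\<^sup>2)"

lemma sqi_measurable[measurable_dest]: "f \<in> sqi M \<Longrightarrow> f \<in> borel_measurable M"
  by (simp add: sqi_def)

lemma sqi_integrable: "f \<in> sqi M \<Longrightarrow> integrable M (\<lambda>x. (cmod (f x))\<^sup>2)"
  by (simp add: sqi_def)

lemma mult_le_sum_squares: "(a::real) * b \<le> a\<^sup>2 + b\<^sup>2"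
proof -
  have "0 \<le> (a - b)\<^sup>2" "0 \<le> a\<^sup>2" "0 \<le> b\<^sup>2" by auto
  then show ?thesis unfolding power2_diff by linarith
qed

lemma borel_measurable_cnj[measurable (raw)]:
  "f \<in> borel_measurable M \<Longrightarrow> (\<lambda>x. cnj (f x)) \<in> borel_measurable M"
  by (rule borel_measurable_continuous_on[OF continuous_on_cnj[OF continuous_on_id]])

lemma sqi_prod_integrable:
  assumes "f \<in> sqi M" "g \<in> sqi M"
  shows "integrable M (\<lambda>x. f x * cnj (g x))"
proof (rule Bochner_Integration.integrable_bound)
  show "integrable M (\<lambda>x. (cmod (f x))\<^sup>2 + (cmod (g x))\<^sup>2)"
    using assms by (auto intro: sqi_integrable)
  show "(\<lambda>x. f x * cnj (g x)) \<in> borel_measurable M"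
    using assms by measurable
qed (auto simp: norm_mult mult_le_sum_squares)

lemma sqi_add:
  assumes "f \<in> sqi M" "g \<in> sqi M"
  shows "(\<lambda>x. f x + g x) \<in> sqi M"
proof -
  have "integrable M (\<lambda>x. (cmod (f x + g x))\<^sup>2)"
  proof (rule Bochner_Integration.integrable_bound)
    show "integrable M (\<lambda>x. 2 * (cmod (f x))\<^sup>2 + 2 * (cmod (g x))\<^sup>2)"
      using assms by (intro Bochner_Integration.integrable_add integrable_mult_right sqi_integrable)
    show "(\<lambda>x. (cmod (f x + g x))\<^sup>2) \<in> borel_measurable M"
      using assms by measurable
    have "(cmod (a + b))\<^sup>2 \<le> 2 * (cmod a)\<^sup>2 + 2 * (cmod b)\<^sup>2" for a b
    proof -
      have "(cmod (a + b))\<^sup>2 \<le> (cmod a + cmod b)\<^sup>2"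
        by (intro power_mono norm_triangle_ineq) auto
      moreover have "0 \<le> (cmod a - cmod b)\<^sup>2" by simp
      ultimately show ?thesis by (simp add: power2_diff power2_sum)
    qed
    then show "AE x in M. norm ((cmod (f x + g x))\<^sup>2)
        \<le> norm (2 * (cmod (f x))\<^sup>2 + 2 * (cmod (g x))\<^sup>2)"
      by auto
  qed
  then show ?thesis using assms by (auto simp: sqi_def)
qed

lemma sqi_cmult: "f \<in> sqi M \<Longrightarrow> (\<lambda>x. c * f x) \<in> sqi M"
  by (auto simp: sqi_def norm_mult power_mult_distrib)

lemma sqi_uminus: "f \<in> sqi M \<Longrightarrow> (\<lambda>x. - f x) \<in> sqi M"
  by (auto simp: sqi_def)

lemma sqi_diff:
  assumes "f \<in> sqi M" "g \<in> sqi M"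
  shows "(\<lambda>x. f x - g x) \<in> sqi M"
  using sqi_add[OF assms(1) sqi_uminus[OF assms(2)]] by simp

lemma sqi_zero: "(\<lambda>x. 0) \<in> sqi M"
  by (simp add: sqi_def)

lemma sqi_sum: "(\<And>i. i \<in> A \<Longrightarrow> f i \<in> sqi M) \<Longrightarrow> (\<lambda>x. \<Sum>i\<in>A. f i x) \<in> sqi M"
  by (induction A rule: infinite_finite_induct) (auto simp: sqi_zero intro: sqi_add)

lemma nsq_nonneg: "0 \<le> nsq M f"
  by (simp add: nsq_def)

lemma ip_add_left:
  "f \<in> sqi M \<Longrightarrow> g \<in> sqi M \<Longrightarrow> h \<in> sqi M \<Longrightarrow> ip M (\<lambda>x. f x + g x) h = ip M f h + ip M g h"
  by (simp add: ip_def distrib_right sqi_prod_integrable)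

lemma ip_diff_left:
  "f \<in> sqi M \<Longrightarrow> g \<in> sqi M \<Longrightarrow> h \<in> sqi M \<Longrightarrow> ip M (\<lambda>x. f x - g x) h = ip M f h - ip M g h"
  by (simp add: ip_def left_diff_distrib sqi_prod_integrable)

lemma ip_cmult_left: "ip M (\<lambda>x. c * f x) h = c * ip M f h"
  by (simp add: ip_def mult.assoc)

lemma ip_cnj: "ip M g f = cnj (ip M f g)"
  unfolding ip_def by (subst Bochner_Integration.integral_cnj[symmetric]) (simp add: mult.commute)

lemma ip_sum_left:
  assumes "\<And>i. i \<in> A \<Longrightarrow> f i \<in> sqi M" "h \<in> sqi M"
  shows "ip M (\<lambda>x. \<Sum>i\<in>A. c i * f i x) h = (\<Sum>i\<in>A. c i * ip M (f i) h)"
proof -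
  have "ip M (\<lambda>x. \<Sum>i\<in>A. c i * f i x) h = (LINT x|M. (\<Sum>i\<in>A. c i * (f i x * cnj (h x))))"
    by (simp add: ip_def sum_distrib_right mult.assoc)
  also have "\<dots> = (\<Sum>i\<in>A. LINT x|M. c i * (f i x * cnj (h x)))"
    using assms by (intro Bochner_Integration.integral_sum integrable_mult_right) (auto intro: sqi_prod_integrable)
  finally show ?thesis by (simp add: ip_def)
qed

lemma ip_self: "ip M f f = complex_of_real (nsq M f)"
  unfolding ip_def nsq_def by (simp add: complex_norm_square[symmetric] del: of_real_power)

lemma nsq_eq_0_iff:
  assumes "f \<in> sqi M"
  shows "nsq M f = 0 \<longleftrightarrow> (AE x in M. f x = 0)"
  unfolding nsq_def using sqi_integrable[OF assms]
  by (subst integral_nonneg_eq_0_iff_AE) auto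

lemma nsq_cmult: "nsq M (\<lambda>x. c * f x) = (cmod c)\<^sup>2 * nsq M f"
  by (simp add: nsq_def norm_mult power_mult_distrib)

lemma ip_diff_right:
  "f \<in> sqi M \<Longrightarrow> g \<in> sqi M \<Longrightarrow> h \<in> sqi M \<Longrightarrow> ip M h (\<lambda>x. f x - g x) = ip M h f - ip M h g"
  by (simp add: ip_cnj[of _ h] ip_diff_left)

lemma nsq_diff:
  assumes "f \<in> sqi M" "g \<in> sqi M"
  shows "nsq M (\<lambda>x. f x - g x) = nsq M f - 2 * Re (ip M f g) + nsq M g"
proof -
  have "complex_of_real (nsq M (\<lambda>x. f x - g x)) = ip M (\<lambda>x. f x - g x) (\<lambda>x. f x - g x)"
    by (simp add: ip_self)
  also have "\<dots> = ip M f f - ip M f g - (cnj (ip M f g) - ip M g g)"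
    using assms by (simp add: ip_diff_left ip_diff_right sqi_diff ip_cnj[of M g f])
  finally have "Re (complex_of_real (nsq M (\<lambda>x. f x - g x))) = Re (ip M f f - ip M f g - (cnj (ip M f g) - ip M g g))"
    by simp
  then show ?thesis by (simp add: ip_self)
qed

lemma ip_cmult_right: "ip M f (\<lambda>x. c * g x) = cnj c * ip M f g"
  by (simp add: ip_cnj[of M f] ip_cmult_left)

text \<open>The square of the distance from \<^term>\<open>f\<close> to a suitable multiple of \<^term>\<open>g\<close> is nonnegative.\<close>

lemma Cauchy_Schwarz_ip:
  assumes "f \<in> sqi M" "g \<in> sqi M"
  shows "(cmod (ip M f g))\<^sup>2 \<le> nsq M f * nsq M g"
proof (cases "nsq M g = 0")
  case True
  then have "AE x in M. g x = 0" using assms nsq_eq_0_iff by blast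
  then have "ip M f g = (LINT x|M. 0)" unfolding ip_def
    using assms by (intro integral_cong_AE) (auto intro!: borel_measurable_times borel_measurable_cnj sqi_measurable)
  then show ?thesis by (simp add: True)
next
  case False
  then have pos: "nsq M g > 0" using nsq_nonneg[of M g] by linarith
  define c where "c = ip M f g / nsq M g"
  have c: "(cmod c)\<^sup>2 = (cmod (ip M f g))\<^sup>2 / (nsq M g)\<^sup>2"
    using pos by (simp add: c_def norm_divide power_divide)
  have "0 \<le> nsq M (\<lambda>x. f x - c * g x)" by (rule nsq_nonneg)
  also have "\<dots> = nsq M f - 2 * Re (cnj c * ip M f g) + (cmod c)\<^sup>2 * nsq M g"
    using assms by (simp add: nsq_diff sqi_cmult nsq_cmult ip_cmult_right)
  also have "cnj c * ip M f g = complex_of_real ((cmod (ip M f g))\<^sup>2 / nsq M g)"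
    by (simp add: c_def complex_norm_square mult.commute del: of_real_power)
  also have "(cmod c)\<^sup>2 * nsq M g = (cmod (ip M f g))\<^sup>2 / nsq M g"
    unfolding c using pos by (simp add: power2_eq_square)
  finally have "(cmod (ip M f g))\<^sup>2 / nsq M g \<le> nsq M f" by simp
  then show ?thesis using pos by (simp add: field_simps)
qed

lemma ip_tendsto_left:
  assumes "F \<in> sqi M" "\<And>N. S N \<in> sqi M" "g \<in> sqi M"
    and "(\<lambda>N. nsq M (\<lambda>x. F x - S N x)) \<longlonglongrightarrow> 0"
  shows "(\<lambda>N. ip M (S N) g) \<longlonglongrightarrow> ip M F g"
proof -
  have "(\<lambda>N. (cmod (ip M F g - ip M (S N) g))\<^sup>2) \<longlonglongrightarrow> 0"
  proof (rule Lim_null_comparison)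
    show "\<forall>\<^sub>F N in sequentially. norm ((cmod (ip M F g - ip M (S N) g))\<^sup>2)
        \<le> nsq M (\<lambda>x. F x - S N x) * nsq M g"
    proof (rule always_eventually, rule allI)
      fix N
      show "norm ((cmod (ip M F g - ip M (S N) g))\<^sup>2) \<le> nsq M (\<lambda>x. F x - S N x) * nsq M g"
        using Cauchy_Schwarz_ip[OF sqi_diff[OF assms(1,2)] assms(3), of N] assms(1-3)
        by (simp add: ip_diff_left)
    qed
    show "(\<lambda>N. nsq M (\<lambda>x. F x - S N x) * nsq M g) \<longlonglongrightarrow> 0"
      using tendsto_mult_left_zero[OF assms(4)] by simp
  qed
  then have "(\<lambda>N. sqrt ((cmod (ip M F g - ip M (S N) g))\<^sup>2)) \<longlonglongrightarrow> sqrt 0"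
    by (rule tendsto_real_sqrt)
  then have "(\<lambda>N. cmod (ip M (S N) g - ip M F g)) \<longlonglongrightarrow> 0"
    by (simp add: norm_minus_commute)
  then show ?thesis
    by (simp add: LIM_zero_iff tendsto_norm_zero_iff)
qed

lemma ip_tendsto_right:
  assumes "F \<in> sqi M" "\<And>N. S N \<in> sqi M" "g \<in> sqi M"
    and "(\<lambda>N. nsq M (\<lambda>x. F x - S N x)) \<longlonglongrightarrow> 0"
  shows "(\<lambda>N. ip M g (S N)) \<longlonglongrightarrow> ip M g F"
  using tendsto_cnj[OF ip_tendsto_left[OF assms]] by (simp add: ip_cnj[symmetric])

text \<open>Expand the square of the distance; the mixed term converges by Cauchy--Schwarz.\<close>

lemma nsq_tendsto:
  assumes "F \<in> sqi M" "\<And>N. S N \<in> sqi M" "(\<lambda>N. nsq M (\<lambda>x. F x - S N x)) \<longlonglongrightarrow> 0"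
  shows "(\<lambda>N. nsq M (S N)) \<longlonglongrightarrow> nsq M F"
proof -
  have eq: "nsq M (S N) = nsq M (\<lambda>x. F x - S N x) - nsq M F + 2 * Re (ip M F (S N))" for N
    using nsq_diff[OF assms(1,2)] by simp
  have "(\<lambda>N. nsq M (\<lambda>x. F x - S N x) - nsq M F + 2 * Re (ip M F (S N)))
      \<longlonglongrightarrow> 0 - nsq M F + 2 * Re (ip M F F)"
    by (intro tendsto_intros assms ip_tendsto_right)
  then show ?thesis by (simp add: eq[abs_def] ip_self)
qed

lemma nsq_limit_unique:
  assumes "F \<in> sqi M" "G \<in> sqi M" "\<And>N. S N \<in> sqi M"
    and "(\<lambda>N. nsq M (\<lambda>x. F x - S N x)) \<longlonglongrightarrow> 0" "(\<lambda>N. nsq M (\<lambda>x. G x - S N x)) \<longlonglongrightarrow> 0"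
  shows "AE x in M. F x = G x"
proof -
  have D: "(\<lambda>x. F x - G x) \<in> sqi M" by (intro sqi_diff assms)
  have "(\<lambda>N. ip M (S N) (\<lambda>x. F x - G x)) \<longlonglongrightarrow> ip M F (\<lambda>x. F x - G x)"
    "(\<lambda>N. ip M (S N) (\<lambda>x. F x - G x)) \<longlonglongrightarrow> ip M G (\<lambda>x. F x - G x)"
    by (intro ip_tendsto_left assms D)+
  then have "ip M F (\<lambda>x. F x - G x) = ip M G (\<lambda>x. F x - G x)"
    using LIMSEQ_unique by blast
  then have "ip M (\<lambda>x. F x - G x) (\<lambda>x. F x - G x) = 0"
    using assms D by (simp add: ip_diff_left)
  then have "nsq M (\<lambda>x. F x - G x) = 0" by (simp add: ip_self)
  then show ?thesis using nsq_eq_0_iff[OF D] by simp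
qed

subsection \<open>Orthogonal series\<close>

locale orth_seq =
  fixes M :: "'a measure" and q :: "nat \<Rightarrow> 'a \<Rightarrow> complex"
  assumes q_sqi: "q k \<in> sqi M"
    and q_orth: "j \<noteq> k \<Longrightarrow> ip M (q j) (q k) = 0"
begin

lemma nsq_sum:
  assumes "finite A"
  shows "nsq M (\<lambda>x. \<Sum>k\<in>A. q k x) = (\<Sum>k\<in>A. nsq M (q k))"
proof -
  have "complex_of_real (nsq M (\<lambda>x. \<Sum>k\<in>A. q k x)) = ip M (\<lambda>x. \<Sum>k\<in>A. 1 * q k x) (\<lambda>x. \<Sum>k\<in>A. q k x)"
    by (simp add: ip_self)
  also have "\<dots> = (\<Sum>k\<in>A. ip M (q k) (\<lambda>x. \<Sum>k\<in>A. q k x))"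
    by (subst ip_sum_left) (auto intro: q_sqi sqi_sum)
  also have "\<dots> = (\<Sum>k\<in>A. cnj (ip M (\<lambda>x. \<Sum>k\<in>A. 1 * q k x) (q k)))"
    by (subst ip_cnj) simp
  also have "\<dots> = (\<Sum>k\<in>A. cnj (\<Sum>j\<in>A. ip M (q j) (q k)))"
    by (intro sum.cong refl arg_cong[where f=cnj], subst ip_sum_left) (auto intro: q_sqi)
  also have "\<dots> = (\<Sum>k\<in>A. cnj (\<Sum>j\<in>A. if j = k then nsq M (q k) else 0))"
    by (intro sum.cong refl arg_cong[where f=cnj]) (auto simp: q_orth ip_self intro!: sum.cong)
  also have "\<dots> = (\<Sum>k\<in>A. complex_of_real (nsq M (q k)))"
    using assms by (intro sum.cong refl) (simp add: sum.delta)
  finally show ?thesis by (metis of_real_eq_iff of_real_sum)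
qed

lemma partial_diff:
  assumes "N \<le> N'"
  shows "(\<Sum>k<N'. q k x) - (\<Sum>k<N. q k x) = (\<Sum>k\<in>{N..<N'}. q k x)"
  using sum_diff_nat_ivl[of 0 N N' "\<lambda>k. q k x"] assms by (simp add: atLeast0LessThan)

lemma nsq_partial_diff_le:
  assumes "summable (\<lambda>k. nsq M (q k))" "N \<le> N'"
  shows "nsq M (\<lambda>x. (\<Sum>k<N'. q k x) - (\<Sum>k<N. q k x)) \<le> (\<Sum>k. nsq M (q (k + N)))"
proof -
  have "nsq M (\<lambda>x. (\<Sum>k<N'. q k x) - (\<Sum>k<N. q k x)) = (\<Sum>k\<in>{N..<N'}. nsq M (q k))"
    by (simp add: partial_diff[OF assms(2)] nsq_sum)
  also have "\<dots> = (\<Sum>k<N'-N. nsq M (q (k + N)))"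
    using assms(2) by (simp add: sum.atLeastLessThan_shift_0 atLeast0LessThan add.commute)
  also have "\<dots> \<le> (\<Sum>k. nsq M (q (k + N)))"
    by (intro sum_le_suminf summable_ignore_initial_segment[OF assms(1)]) (auto simp: nsq_nonneg)
  finally show ?thesis .
qed

text \<open>By Fatou's lemma a pointwise limit of a subsequence of the partial sums is also their limit
  in mean square.\<close>

lemma nsq_convergence:
  assumes summ: "summable (\<lambda>k. nsq M (q k))"
    and F[measurable]: "F \<in> borel_measurable M"
    and \<sigma>: "strict_mono (\<sigma> :: nat \<Rightarrow> nat)"
    and lim: "AE x in M. (\<lambda>i. \<Sum>k<\<sigma> i. q k x) \<longlonglongrightarrow> F x"
  shows "F \<in> sqi M" "(\<lambda>N. nsq M (\<lambda>x. F x - (\<Sum>k<N. q k x))) \<longlonglongrightarrow> 0"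
    "(\<lambda>k. nsq M (q k)) sums nsq M F"
proof -
  have [measurable]: "q k \<in> borel_measurable M" for k using q_sqi by (rule sqi_measurable)
  have S: "(\<lambda>x. \<Sum>k<N. q k x) \<in> sqi M" for N by (intro sqi_sum q_sqi)
  define R where "R N = (\<Sum>k. nsq M (q (k + N)))" for N
  have R0: "R \<longlonglongrightarrow> 0" unfolding R_def using suminf_exist_split2[OF summ] .
  have Rnn: "0 \<le> R N" for N unfolding R_def
    by (intro suminf_nonneg) (auto simp: nsq_nonneg summable_ignore_initial_segment[OF summ])
  have nn: "(\<integral>\<^sup>+x. ennreal ((cmod (F x - (\<Sum>k<N. q k x)))\<^sup>2) \<partial>M) \<le> ennreal (R N)" for N
  proof -
    have "(\<integral>\<^sup>+x. ennreal ((cmod (F x - (\<Sum>k<N. q k x)))\<^sup>2) \<partial>M)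
      = (\<integral>\<^sup>+x. liminf (\<lambda>i. ennreal ((cmod ((\<Sum>k<\<sigma> i. q k x) - (\<Sum>k<N. q k x)))\<^sup>2)) \<partial>M)"
    proof (rule nn_integral_cong_AE)
      show "AE x in M. ennreal ((cmod (F x - (\<Sum>k<N. q k x)))\<^sup>2)
        = liminf (\<lambda>i. ennreal ((cmod ((\<Sum>k<\<sigma> i. q k x) - (\<Sum>k<N. q k x)))\<^sup>2))"
        using lim
      proof eventually_elim
        case (elim x)
        then have "(\<lambda>i. ennreal ((cmod ((\<Sum>k<\<sigma> i. q k x) - (\<Sum>k<N. q k x)))\<^sup>2))
          \<longlonglongrightarrow> ennreal ((cmod (F x - (\<Sum>k<N. q k x)))\<^sup>2)"
          by (intro tendsto_intros)
        then show ?case by (intro lim_imp_Liminf[symmetric]) auto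
      qed
    qed
    also have "\<dots> \<le> liminf (\<lambda>i. \<integral>\<^sup>+x. ennreal ((cmod ((\<Sum>k<\<sigma> i. q k x) - (\<Sum>k<N. q k x)))\<^sup>2) \<partial>M)"
      by (intro nn_integral_liminf) measurable
    also have "\<dots> \<le> liminf (\<lambda>i. ennreal (R N))"
    proof (rule Liminf_mono)
      show "\<forall>\<^sub>F i in sequentially. (\<integral>\<^sup>+x. ennreal ((cmod ((\<Sum>k<\<sigma> i. q k x) - (\<Sum>k<N. q k x)))\<^sup>2) \<partial>M) \<le> ennreal (R N)"
        unfolding eventually_sequentially
      proof (intro exI allI impI)
        fix i assume "N \<le> i"
        then have le: "N \<le> \<sigma> i" using seq_suble[OF \<sigma>] order_trans by blast
        have "(\<integral>\<^sup>+x. ennreal ((cmod ((\<Sum>k<\<sigma> i. q k x) - (\<Sum>k<N. q k x)))\<^sup>2) \<partial>M)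
          = ennreal (nsq M (\<lambda>x. (\<Sum>k<\<sigma> i. q k x) - (\<Sum>k<N. q k x)))"
          unfolding nsq_def by (intro nn_integral_eq_integral sqi_integrable sqi_diff S) auto
        also have "\<dots> \<le> ennreal (R N)"
          unfolding R_def by (intro ennreal_leI nsq_partial_diff_le summ le)
        finally show "(\<integral>\<^sup>+x. ennreal ((cmod ((\<Sum>k<\<sigma> i. q k x) - (\<Sum>k<N. q k x)))\<^sup>2) \<partial>M) \<le> ennreal (R N)" .
      qed
    qed
    also have "\<dots> = ennreal (R N)" by (simp add: Liminf_const)
    finally show ?thesis .
  qed
  have D: "(\<lambda>x. F x - (\<Sum>k<N. q k x)) \<in> sqi M" for N
  proof -
    have "integrable M (\<lambda>x. (cmod (F x - (\<Sum>k<N. q k x)))\<^sup>2)"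
      using nn[of N] by (intro integrableI_bounded) (auto simp: le_less_trans)
    then show ?thesis by (simp add: sqi_def)
  qed
  show FF: "F \<in> sqi M" using D[of 0] by simp
  have le: "nsq M (\<lambda>x. F x - (\<Sum>k<N. q k x)) \<le> R N" for N
  proof -
    have "ennreal (nsq M (\<lambda>x. F x - (\<Sum>k<N. q k x))) = (\<integral>\<^sup>+x. ennreal ((cmod (F x - (\<Sum>k<N. q k x)))\<^sup>2) \<partial>M)"
      unfolding nsq_def by (intro nn_integral_eq_integral[symmetric] sqi_integrable D) auto
    then have "ennreal (nsq M (\<lambda>x. F x - (\<Sum>k<N. q k x))) \<le> ennreal (R N)"
      by (rule ord_eq_le_trans[OF _ nn])
    then show ?thesis by (rule ennreal_le_iff[OF Rnn, THEN iffD1])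
  qed
  show lim0: "(\<lambda>N. nsq M (\<lambda>x. F x - (\<Sum>k<N. q k x))) \<longlonglongrightarrow> 0"
    by (rule Lim_null_comparison[OF _ R0]) (auto simp: nsq_nonneg le)
  show "(\<lambda>k. nsq M (q k)) sums nsq M F"
    using nsq_tendsto[OF FF S lim0] unfolding sums_def by (simp add: nsq_sum)
qed

text \<open>Completeness: the partial sums taken along a subsequence whose successive differences
  \<open>d i\<close> satisfy \<open>nsq M (d i) \<le> 4 ^ - i\<close> converge almost everywhere, because
  \<open>\<Sum>i. 2 ^ i * \<bar>d i x\<bar>\<^sup>2\<close> is then integrable, hence finite almost everywhere.\<close>

lemma Riesz_Fischer:
  assumes summ: "summable (\<lambda>k. nsq M (q k))"
  shows "\<exists>F\<in>sqi M. (\<lambda>N. nsq M (\<lambda>x. F x - (\<Sum>k<N. q k x))) \<longlonglongrightarrow> 0"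
proof -
  have [measurable]: "q k \<in> borel_measurable M" for k using q_sqi by (rule sqi_measurable)
  have S: "(\<lambda>x. \<Sum>k<N. q k x) \<in> sqi M" for N by (intro sqi_sum q_sqi)
  define R where "R N = (\<Sum>k. nsq M (q (k + N)))" for N
  have R0: "R \<longlonglongrightarrow> 0" unfolding R_def using suminf_exist_split2[OF summ] .
  have Rnn: "0 \<le> R N" for N unfolding R_def
    by (intro suminf_nonneg) (auto simp: nsq_nonneg summable_ignore_initial_segment[OF summ])
  have "\<exists>n>m. R n \<le> (1/4)^i" for m i
  proof -
    have "\<forall>\<^sub>F n in sequentially. R n < (1/4)^i" using R0 by (rule order_tendstoD) simp
    then obtain N where N: "\<forall>n\<ge>N. R n < (1/4)^i" by (auto simp: eventually_sequentially)
    then show ?thesis by (intro exI[of _ "max N (Suc m)"]) (auto simp: less_imp_le)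
  qed
  then have "\<exists>\<sigma>. \<forall>i. R (\<sigma> i) \<le> (1/4)^i \<and> \<sigma> i < \<sigma> (Suc i)"
    by (intro dependent_nat_choice) (blast intro: less_imp_le)+
  then obtain \<sigma> where \<sigma>: "\<And>i. R (\<sigma> i) \<le> (1/4)^i" "\<And>i. \<sigma> i < \<sigma> (Suc i)" by auto
  have mono: "strict_mono \<sigma>" using \<sigma>(2) by (simp add: strict_mono_Suc_iff)
  define d where "d i x = (\<Sum>k<\<sigma> (Suc i). q k x) - (\<Sum>k<\<sigma> i. q k x)" for i x
  have dm[measurable]: "d i \<in> borel_measurable M" for i unfolding d_def by measurable
  have d_sqi: "d i \<in> sqi M" for i unfolding d_def by (intro sqi_diff S)
  have d_le: "nsq M (d i) \<le> (1/4)^i" for i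
    unfolding d_def using nsq_partial_diff_le[OF summ, of "\<sigma> i" "\<sigma> (Suc i)"] \<sigma>[of i] by (simp add: R_def)
  have "(\<integral>\<^sup>+x. (\<Sum>i. ennreal (2^i * (cmod (d i x))\<^sup>2)) \<partial>M) = (\<Sum>i. \<integral>\<^sup>+x. ennreal (2^i * (cmod (d i x))\<^sup>2) \<partial>M)"
    by (intro nn_integral_suminf) measurable
  also have "\<dots> \<le> (\<Sum>i. ennreal ((1/2)^i))"
  proof (rule suminf_le)
    fix i
    have "(\<integral>\<^sup>+x. ennreal (2^i * (cmod (d i x))\<^sup>2) \<partial>M) = ennreal (2^i * nsq M (d i))"
      unfolding nsq_def using sqi_integrable[OF d_sqi] by (subst nn_integral_eq_integral) auto
    also have "\<dots> \<le> ennreal (2^i * (1/4)^i)" by (intro ennreal_leI mult_left_mono d_le) auto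
    also have "(2::real)^i * (1/4)^i = (1/2)^i" by (simp flip: power_mult_distrib)
    finally show "(\<integral>\<^sup>+x. ennreal (2^i * (cmod (d i x))\<^sup>2) \<partial>M) \<le> ennreal ((1/2)^i)" .
  qed auto
  also have "\<dots> < \<infinity>" by (subst suminf_ennreal2) (auto intro: summable_geometric)
  finally have "AE x in M. (\<Sum>i. ennreal (2^i * (cmod (d i x))\<^sup>2)) \<noteq> \<infinity>"
    by (intro nn_integral_PInf_AE) auto
  then have conv: "AE x in M. convergent (\<lambda>i. \<Sum>k<\<sigma> i. q k x)"
  proof eventually_elim
    case (elim x)
    then have s1: "summable (\<lambda>i. 2^i * (cmod (d i x))\<^sup>2)"
      by (intro summable_suminf_not_top) (auto simp: top_ennreal_def infinity_ennreal_def)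
    have "summable (\<lambda>i. d i x)"
    proof (rule summable_comparison_test)
      show "summable (\<lambda>i. 2^i * (cmod (d i x))\<^sup>2 + (1/2)^i)"
        by (intro summable_add s1 summable_geometric) auto
      have "norm (d i x) \<le> 2^i * (cmod (d i x))\<^sup>2 + (1/2)^i" for i
      proof -
        \<comment> \<open>\<open>\<bar>d\<bar> \<le> 2 ^ i * \<bar>d\<bar>\<^sup>2 + 2 ^ - i\<close>, the weights \<open>e\<close> and \<open>1 / e\<close> balancing the two terms\<close>
        define e where "e = sqrt (2^i)"
        have e: "e > 0" "e\<^sup>2 = 2^i" by (auto simp: e_def)
        have "(e * cmod (d i x)) * (1/e) \<le> (e * cmod (d i x))\<^sup>2 + (1/e)\<^sup>2"
          by (rule mult_le_sum_squares)
        then show ?thesis using e by (simp add: power_mult_distrib power_divide power_one_over)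
      qed
      then show "\<exists>N. \<forall>n\<ge>N. norm (d n x) \<le> 2^n * (cmod (d n x))\<^sup>2 + (1/2)^n" by blast
    qed
    then have "convergent (\<lambda>n. \<Sum>i<n. d i x)" by (simp add: summable_iff_convergent)
    moreover have "(\<Sum>i<n. d i x) = (\<Sum>k<\<sigma> n. q k x) - (\<Sum>k<\<sigma> 0. q k x)" for n
      by (induction n) (auto simp: d_def)
    ultimately have "convergent (\<lambda>n. ((\<Sum>k<\<sigma> n. q k x) - (\<Sum>k<\<sigma> 0. q k x)) + (\<Sum>k<\<sigma> 0. q k x))"
      by (intro convergent_add convergent_const) simp
    then show ?case by simp
  qed
  define F where "F x = lim (\<lambda>i. \<Sum>k<\<sigma> i. q k x)" for x
  have Fm: "F \<in> borel_measurable M" unfolding F_def by measurable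
  have "AE x in M. (\<lambda>i. \<Sum>k<\<sigma> i. q k x) \<longlonglongrightarrow> F x"
    using conv by eventually_elim (simp add: F_def convergent_LIMSEQ_iff)
  from nsq_convergence(1,2)[OF summ Fm mono this] show ?thesis by blast
qed

end

subsection \<open>Orthogonal families and Bessel's inequality\<close>

locale orth_family =
  fixes M :: "'a measure" and \<phi> :: "'i \<Rightarrow> 'a \<Rightarrow> complex" and w :: "'i \<Rightarrow> real"
  assumes phi_sqi: "\<phi> i \<in> sqi M"
    and phi_orth: "ip M (\<phi> i) (\<phi> j) = (if i = j then complex_of_real (w i) else 0)"
    and w_pos: "0 < w i"
begin

lemma comb_sqi: "(\<lambda>x. \<Sum>i\<in>A. c i * \<phi> i x) \<in> sqi M"
  by (intro sqi_sum sqi_cmult phi_sqi)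

lemma ip_comb_phi:
  assumes "finite A"
  shows "ip M (\<lambda>x. \<Sum>i\<in>A. c i * \<phi> i x) (\<phi> j) = (if j \<in> A then c j * w j else 0)"
proof -
  have "ip M (\<lambda>x. \<Sum>i\<in>A. c i * \<phi> i x) (\<phi> j) = (\<Sum>i\<in>A. c i * ip M (\<phi> i) (\<phi> j))"
    by (intro ip_sum_left phi_sqi)
  also have "\<dots> = (\<Sum>i\<in>A. if i = j then c j * w j else 0)"
    by (intro sum.cong) (auto simp: phi_orth)
  finally show ?thesis using assms by (simp add: sum.delta)
qed

lemma ip_comb_right:
  assumes "f \<in> sqi M"
  shows "ip M f (\<lambda>x. \<Sum>i\<in>A. c i * \<phi> i x) = (\<Sum>i\<in>A. cnj (c i) * ip M f (\<phi> i))"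
  by (subst ip_cnj, subst ip_sum_left) (auto intro: phi_sqi assms simp: ip_cnj[of M f])

lemma ip_comb_comb:
  assumes "finite A" "finite B"
  shows "ip M (\<lambda>x. \<Sum>i\<in>A. c i * \<phi> i x) (\<lambda>x. \<Sum>i\<in>B. d i * \<phi> i x) = (\<Sum>i\<in>A \<inter> B. c i * cnj (d i) * w i)"
proof -
  have "ip M (\<lambda>x. \<Sum>i\<in>A. c i * \<phi> i x) (\<lambda>x. \<Sum>i\<in>B. d i * \<phi> i x)
     = (\<Sum>i\<in>B. cnj (d i) * (if i \<in> A then c i * w i else 0))"
    by (simp add: ip_comb_right comb_sqi ip_comb_phi assms)
  also have "\<dots> = (\<Sum>i\<in>B. if i \<in> A then c i * cnj (d i) * w i else 0)"
    by (intro sum.cong) auto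
  also have "\<dots> = (\<Sum>i\<in>B \<inter> A. c i * cnj (d i) * w i)"
    using assms by (simp add: sum.inter_restrict)
  finally show ?thesis by (simp add: Int_commute)
qed

lemma nsq_comb:
  assumes "finite A"
  shows "nsq M (\<lambda>x. \<Sum>i\<in>A. c i * \<phi> i x) = (\<Sum>i\<in>A. (cmod (c i))\<^sup>2 * w i)"
proof -
  have "complex_of_real (nsq M (\<lambda>x. \<Sum>i\<in>A. c i * \<phi> i x)) = (\<Sum>i\<in>A. c i * cnj (c i) * w i)"
    using ip_comb_comb[OF assms assms, of c c] by (simp add: ip_self)
  also have "\<dots> = complex_of_real (\<Sum>i\<in>A. (cmod (c i))\<^sup>2 * w i)"
    by (simp add: complex_norm_square del: of_real_power)
  finally show ?thesis using of_real_eq_iff by blast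
qed

lemma Bessel:
  assumes f: "f \<in> sqi M" and A: "finite A"
  shows "(\<Sum>i\<in>A. (cmod (ip M f (\<phi> i)))\<^sup>2 / w i) \<le> nsq M f"
proof -
  define c where "c i = ip M f (\<phi> i) / w i" for i
  have "0 \<le> nsq M (\<lambda>x. f x - (\<Sum>i\<in>A. c i * \<phi> i x))" by (rule nsq_nonneg)
  also have "\<dots> = nsq M f - 2 * Re (\<Sum>i\<in>A. cnj (c i) * ip M f (\<phi> i)) + (\<Sum>i\<in>A. (cmod (c i))\<^sup>2 * w i)"
    using f A by (simp add: nsq_diff comb_sqi nsq_comb ip_comb_right)
  also have "(\<Sum>i\<in>A. cnj (c i) * ip M f (\<phi> i)) = complex_of_real (\<Sum>i\<in>A. (cmod (ip M f (\<phi> i)))\<^sup>2 / w i)"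
    unfolding of_real_sum
    by (intro sum.cong refl) (simp add: c_def complex_norm_square mult.commute del: of_real_power)
  also have "(\<Sum>i\<in>A. (cmod (c i))\<^sup>2 * w i) = (\<Sum>i\<in>A. (cmod (ip M f (\<phi> i)))\<^sup>2 / w i)"
  proof (intro sum.cong refl)
    fix i show "(cmod (c i))\<^sup>2 * w i = (cmod (ip M f (\<phi> i)))\<^sup>2 / w i"
      using w_pos[of i] by (simp add: c_def norm_divide power_divide power2_eq_square)
  qed
  finally show ?thesis by simp
qed

lemma orth_seq_blocks:
  assumes "\<And>k. finite (A k)" "\<And>j k. j \<noteq> k \<Longrightarrow> A j \<inter> A k = {}"
  shows "orth_seq M (\<lambda>k x. \<Sum>i\<in>A k. c i * \<phi> i x)"
  by standard (auto simp: comb_sqi ip_comb_comb assms)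

end

section \<open>Lebesgue measure on products and Gaussian integrals\<close>

lemma borel_measurable_vec_lambda_PiM[measurable]:
  "(\<lambda>f. \<chi> i. f i) \<in> borel_measurable (Pi\<^sub>M (UNIV :: 'n::finite set) (\<lambda>_. lborel :: 'a::euclidean_space measure))"
proof (rule borel_measurable_euclidean_space[THEN iffD2], rule ballI)
  fix b :: "'a^'n" assume "b \<in> Basis"
  then obtain i u where b: "b = axis i u" by (auto simp: Basis_vec_def)
  have "(\<lambda>f. f i \<bullet> u) \<in> borel_measurable (Pi\<^sub>M (UNIV :: 'n set) (\<lambda>_. lborel :: 'a measure))"
    by measurable
  then show "(\<lambda>f. (\<chi> i. f i) \<bullet> b) \<in> borel_measurable (Pi\<^sub>M (UNIV :: 'n set) (\<lambda>_. lborel :: 'a measure))"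
    by (simp add: b inner_axis)
qed

text \<open>Lebesgue measure on the cartesian power is the product measure; this lets Fubini's theorem factor
integrals of products of functions of single coordinates.\<close>

lemma lborel_vec:
  "(lborel :: ('a::euclidean_space ^ 'n::finite) measure)
     = distr (Pi\<^sub>M UNIV (\<lambda>_. lborel)) borel (\<lambda>f. \<chi> i. f i)"
proof (rule lborel_eqI)
  interpret product_sigma_finite "\<lambda>_::'n. lborel :: 'a measure" ..
  fix l u :: "'a^'n"
  assume le: "\<And>b. b \<in> Basis \<Longrightarrow> l \<bullet> b \<le> u \<bullet> b"
  have le': "l $ i \<bullet> b \<le> u $ i \<bullet> b" if "b \<in> Basis" for i b
    using le[of "axis i b"] that by (auto simp: Basis_vec_def inner_axis)
  have box: "(\<lambda>f. \<chi> i. f i) -` box l u \<inter> space (Pi\<^sub>M UNIV (\<lambda>_. lborel))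
      = Pi\<^sub>E UNIV (\<lambda>i. box (l $ i) (u $ i))"
    by (auto simp: mem_box Basis_vec_def inner_axis space_PiM PiE_UNIV_domain Pi_iff)
  have inj: "inj_on (\<lambda>(i::'n, b::'a). axis i b) (UNIV \<times> Basis)"
    by (auto simp: inj_on_def axis_eq_axis)
  have Basis_eq: "(Basis :: ('a^'n) set) = (\<lambda>(i, b). axis i b) ` (UNIV \<times> Basis)"
    by (auto simp: Basis_vec_def)
  have "emeasure (distr (Pi\<^sub>M UNIV (\<lambda>_. lborel)) borel (\<lambda>f. \<chi> i. f i)) (box l u)
      = emeasure (Pi\<^sub>M UNIV (\<lambda>_. lborel)) (Pi\<^sub>E UNIV (\<lambda>i. box (l $ i) (u $ i)))"
    by (subst emeasure_distr) (auto simp: box)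
  also have "\<dots> = (\<Prod>i\<in>UNIV. emeasure lborel (box (l $ i) (u $ i)))"
    by (subst emeasure_PiM) auto
  also have "\<dots> = (\<Prod>i\<in>UNIV. ennreal (\<Prod>b\<in>Basis. (u $ i - l $ i) \<bullet> b))"
    by (intro prod.cong refl emeasure_lborel_box) (auto intro: le')
  also have "\<dots> = ennreal (\<Prod>i\<in>UNIV. \<Prod>b\<in>Basis. (u $ i - l $ i) \<bullet> b)"
    by (intro prod_ennreal prod_nonneg) (auto simp: inner_diff_left le')
  also have "(\<Prod>i\<in>UNIV. \<Prod>b\<in>Basis. (u $ i - l $ i) \<bullet> b) = (\<Prod>b\<in>Basis. (u - l) \<bullet> b)"
    unfolding Basis_eq by (subst prod.reindex[OF inj]) (simp add: prod.cartesian_product case_prod_beta inner_axis)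
  finally show "emeasure (distr (Pi\<^sub>M UNIV (\<lambda>_. lborel)) borel (\<lambda>f. \<chi> i. f i)) (box l u)
      = ennreal (\<Prod>b\<in>Basis. (u - l) \<bullet> b)" .
qed simp

lemma
  fixes f :: "'n::finite \<Rightarrow> 'a::euclidean_space \<Rightarrow> 'b::{real_normed_field,banach,second_countable_topology}"
  assumes "\<And>i. integrable lborel (f i)"
  shows integrable_vec_prod: "integrable lborel (\<lambda>x::'a^'n. \<Prod>i\<in>UNIV. f i (x $ i))"
    and integral_vec_prod: "(LINT x|lborel. (\<Prod>i\<in>UNIV. f i ((x::'a^'n) $ i))) = (\<Prod>i\<in>UNIV. (LINT x|lborel. f i x))"
proof -
  interpret product_sigma_finite "\<lambda>_::'n. lborel :: 'a measure" ..
  have [measurable]: "f i \<in> borel_measurable lborel" for i using assms by auto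
  have nthm[measurable]: "(\<lambda>x::'a^'n. x $ i) \<in> borel_measurable borel" for i
    by (intro borel_measurable_continuous_onI continuous_intros)
  have fm: "(\<lambda>x::'a^'n. \<Prod>i\<in>UNIV. f i (x $ i)) \<in> borel_measurable borel" by measurable
  show "integrable lborel (\<lambda>x::'a^'n. \<Prod>i\<in>UNIV. f i (x $ i))"
    unfolding lborel_vec by (subst integrable_distr_eq) (use assms fm in \<open>auto intro: product_integrable_prod\<close>)
  show "(LINT x|lborel. (\<Prod>i\<in>UNIV. f i ((x::'a^'n) $ i))) = (\<Prod>i\<in>UNIV. (LINT x|lborel. f i x))"
    unfolding lborel_vec by (subst integral_distr) (use assms fm in \<open>auto intro: product_integral_prod\<close>)
qed

lemma borel_measurable_Complex[measurable]:
  "(\<lambda>(x, y). Complex x y) \<in> borel_measurable (lborel \<Otimes>\<^sub>M lborel)"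
proof -
  have "(\<lambda>p::real\<times>real. Complex (fst p) (snd p)) \<in> borel_measurable borel"
    by (intro borel_measurable_continuous_onI continuous_intros)
  then show ?thesis by (simp add: lborel_prod case_prod_beta')
qed

lemma lborel_complex: "(lborel :: complex measure) = distr (lborel \<Otimes>\<^sub>M lborel) borel (\<lambda>(x, y). Complex x y)"
proof (rule lborel_eqI)
  fix l u :: complex
  assume le: "\<And>b. b \<in> Basis \<Longrightarrow> l \<bullet> b \<le> u \<bullet> b"
  have le': "Re l \<le> Re u" "Im l \<le> Im u" using le[of 1] le[of \<i>] by (auto simp: Basis_complex_def)
  have box: "(\<lambda>(x, y). Complex x y) -` box l u \<inter> space (lborel \<Otimes>\<^sub>M lborel)
      = {Re l<..<Re u} \<times> {Im l<..<Im u}"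
    by (auto simp: mem_box Basis_complex_def space_pair_measure)
  have "emeasure (distr (lborel \<Otimes>\<^sub>M lborel) borel (\<lambda>(x, y). Complex x y)) (box l u)
      = emeasure (lborel \<Otimes>\<^sub>M lborel) ({Re l<..<Re u} \<times> {Im l<..<Im u})"
    by (subst emeasure_distr) (auto simp: box)
  also have "\<dots> = ennreal (Re u - Re l) * ennreal (Im u - Im l)"
    by (simp add: lborel.emeasure_pair_measure_Times le')
  also have "\<dots> = ennreal (\<Prod>b\<in>Basis. (u - l) \<bullet> b)"
    using le' by (simp add: Basis_complex_def ennreal_mult)
  finally show "emeasure (distr (lborel \<Otimes>\<^sub>M lborel) borel (\<lambda>(x, y). Complex x y)) (box l u)
      = ennreal (\<Prod>b\<in>Basis. (u - l) \<bullet> b)" .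
qed simp

lemma integrable_complex_iff:
  fixes f :: "complex \<Rightarrow> 'b::{banach,second_countable_topology}"
  assumes [measurable]: "f \<in> borel_measurable borel"
  shows "integrable lborel f \<longleftrightarrow> integrable (lborel \<Otimes>\<^sub>M lborel) (\<lambda>(x, y). f (Complex x y))"
  by (subst lborel_complex, subst integrable_distr_eq) (auto simp: case_prod_beta')

lemma integral_complex_eq:
  fixes f :: "complex \<Rightarrow> 'b::{banach,second_countable_topology}"
  assumes [measurable]: "f \<in> borel_measurable borel"
  shows "(LINT z|lborel. f z) = (LINT p|(lborel \<Otimes>\<^sub>M lborel). (case p of (x, y) \<Rightarrow> f (Complex x y)))"
  by (subst lborel_complex, subst integral_distr) (auto simp: case_prod_beta')

lemma integrable_complex_prod:
  fixes f g :: "real \<Rightarrow> real"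
  assumes f: "integrable lborel f" and g: "integrable lborel g"
  shows "integrable lborel (\<lambda>z. f (Re z) * g (Im z))"
proof -
  have [measurable]: "f \<in> borel_measurable borel" "g \<in> borel_measurable borel" using assms by auto
  have "integrable (lborel \<Otimes>\<^sub>M lborel) (\<lambda>(x, y). f x * g y)"
  proof (rule lborel_pair.Fubini_integrable)
    show "integrable lborel (\<lambda>x. LINT y|lborel. norm (case (x, y) of (x, y) \<Rightarrow> f x * g y))"
      using f g by (simp add: abs_mult)
  qed (use g in auto)
  then show ?thesis by (subst integrable_complex_iff) auto
qed

lemma integral_complex_prod:
  fixes f g :: "real \<Rightarrow> real"
  assumes f: "integrable lborel f" and g: "integrable lborel g"
  shows "(LINT z|lborel. f (Re z) * g (Im z)) = (LINT x|lborel. f x) * (LINT y|lborel. g y)"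
proof -
  have [measurable]: "f \<in> borel_measurable borel" "g \<in> borel_measurable borel" using assms by auto
  have int: "integrable (lborel \<Otimes>\<^sub>M lborel) (\<lambda>(x, y). f x * g y)"
    using integrable_complex_prod[OF f g] by (subst (asm) integrable_complex_iff) auto
  have "(LINT z|lborel. f (Re z) * g (Im z)) = (LINT p|(lborel \<Otimes>\<^sub>M lborel). (case p of (x, y) \<Rightarrow> f x * g y))"
    by (subst integral_complex_eq) auto
  also have "\<dots> = (LINT x|lborel. (LINT y|lborel. f x * g y))"
    using lborel_pair.integral_fst[OF int] by simp
  finally show ?thesis by simp
qed

lemma gauss_real:
  assumes a: "a > (0::real)"
  shows integrable_gauss: "integrable lborel (\<lambda>x. exp (- (a * x\<^sup>2)))"
    and integral_gauss: "(LINT x|lborel. exp (- (a * x\<^sup>2))) = sqrt (pi / a)"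
proof -
  define s where "s = 1 / sqrt (2 * a)"
  have s: "s > 0" "s\<^sup>2 = 1 / (2 * a)" using a by (auto simp: s_def power_divide)
  have eq: "exp (- (a * x\<^sup>2)) = sqrt (pi / a) * normal_density 0 s x" for x
    using a s by (simp add: normal_density_def)
  show "integrable lborel (\<lambda>x. exp (- (a * x\<^sup>2)))" unfolding eq using s by simp
  show "(LINT x|lborel. exp (- (a * x\<^sup>2))) = sqrt (pi / a)" unfolding eq using s by simp
qed

text \<open>After completing the square in the real part of \<^term>\<open>b\<close> what is left is the characteristic
  function of the normal distribution.\<close>

lemma integral_gauss_complex:
  fixes b :: complex
  assumes a: "a > (0::real)"
  shows "(LINT x|lborel. exp (- (of_real a * of_real x ^ 2) + b * of_real x)) = of_real (sqrt (pi / a)) * exp (b\<^sup>2 / (4 * of_real a))"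
proof -
  define p where "p = Re b"
  define q where "q = Im b"
  define c where "c = 1 / sqrt (2 * a)"
  have c: "c > 0" "c\<^sup>2 = 1 / (2 * a)" using a by (auto simp: c_def power_divide)
  have c': "complex_of_real a * complex_of_real c ^ 2 = 1 / 2"
  proof -
    have "a * c\<^sup>2 = 1 / 2" using a by (simp add: c)
    then have "complex_of_real (a * c\<^sup>2) = complex_of_real (1 / 2)" by (rule arg_cong)
    then show ?thesis by simp
  qed
  have b: "b = of_real p + \<i> * of_real q" by (simp add: p_def q_def complex_eq_iff)
  have "(LINT x|lborel. exp (- (of_real a * of_real x ^ 2) + b * of_real x))
    = c *\<^sub>R (LINT x|lborel. exp (- (of_real a * of_real (p/(2*a) + c * x) ^ 2) + b * of_real (p/(2*a) + c * x)))"
    using c by (subst lborel_integral_real_affine[where t="p/(2*a)" and c=c]) auto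
  also have "(\<lambda>x. exp (- (of_real a * of_real (p/(2*a) + c * x) ^ 2) + b * of_real (p/(2*a) + c * x)))
      = (\<lambda>x::real. exp (of_real (p\<^sup>2/(4*a)) + \<i> * of_real (p * q/(2*a))) * (of_real (exp (-x\<^sup>2/2)) * iexp (q * c * x)))"
  proof
    fix x :: real
    have "- (complex_of_real a * of_real (p/(2*a) + c * x) ^ 2) + b * of_real (p/(2*a) + c * x)
        = - ((of_real p)\<^sup>2 / (4 * of_real a) + of_real p * of_real c * of_real x + (of_real a * of_real c ^2) * of_real x ^ 2)
           + (of_real p + \<i> * of_real q) * (of_real p/(2* of_real a) + of_real c * of_real x)"
      using a by (simp add: b field_simps power2_eq_square)
    also have "\<dots> = of_real (p\<^sup>2/(4*a)) + \<i> * of_real (p * q/(2*a)) + (- (of_real x ^ 2 / 2) + \<i> * of_real (q * c * x))"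
      unfolding c' using a by (simp add: field_simps power2_eq_square)
    finally have eq: "- (complex_of_real a * of_real (p/(2*a) + c * x) ^ 2) + b * of_real (p/(2*a) + c * x)
      = of_real (p\<^sup>2/(4*a)) + \<i> * of_real (p * q/(2*a)) + (- (of_real x ^2 / 2) + \<i> * of_real (q * c * x))" .
    show "exp (- (of_real a * of_real (p/(2*a) + c * x) ^ 2) + b * of_real (p/(2*a) + c * x))
      = exp (of_real (p\<^sup>2/(4*a)) + \<i> * of_real (p * q/(2*a))) * (of_real (exp (-x\<^sup>2/2)) * iexp (q * c * x))"
      unfolding eq exp_add by (simp add: exp_of_real[symmetric])
  qed
  also have "(LINT x|lborel. exp (of_real (p\<^sup>2/(4*a)) + \<i> * of_real (p * q/(2*a))) * (of_real (exp (-x\<^sup>2/2)) * iexp (q * c * x)))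
     = exp (of_real (p\<^sup>2/(4*a)) + \<i> * of_real (p * q/(2*a))) * (of_real (sqrt (2 * pi)) * of_real (exp (- (q * c)\<^sup>2 / 2)))"
  proof -
    have "char std_normal_distribution (q * c)
      = (LINT x|lborel. of_real (1 / sqrt (2 * pi)) * (of_real (exp (-x\<^sup>2/2)) * iexp (q * c * x)))"
      unfolding char_def
      by (subst integral_density) (auto simp: normal_density_def scaleR_conv_of_real mult_ac)
    then have "of_real (1 / sqrt (2 * pi)) * (LINT x|lborel. of_real (exp (-x\<^sup>2/2)) * iexp (q * c * x)) = of_real (exp (- (q * c)\<^sup>2 / 2))"
      by (simp add: char_std_normal_distribution)
    then have "(LINT x|lborel. of_real (exp (-x\<^sup>2/2)) * iexp (q * c * x))
        = of_real (sqrt (2 * pi)) * of_real (exp (- (q * c)\<^sup>2 / 2))"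
      by (simp add: field_simps)
    then show ?thesis by (simp only: integral_mult_right_zero)
  qed
  also have "c *\<^sub>R (exp (of_real (p\<^sup>2/(4*a)) + \<i> * of_real (p * q/(2*a))) * (of_real (sqrt (2 * pi)) * of_real (exp (- (q * c)\<^sup>2 / 2))))
     = of_real (c * sqrt (2 * pi)) * exp (of_real (p\<^sup>2/(4*a)) + \<i> * of_real (p * q/(2*a)) + of_real (- (q * c)\<^sup>2 / 2))"
    unfolding exp_add exp_of_real by (simp only: scaleR_conv_of_real of_real_mult mult_ac)
  also have "c * sqrt (2 * pi) = sqrt (pi / a)"
    by (simp add: c_def real_sqrt_divide real_sqrt_mult)
  also have "of_real (p\<^sup>2/(4*a)) + \<i> * of_real (p * q/(2*a)) + complex_of_real (- (q * c)\<^sup>2 / 2) = b\<^sup>2 / (4 * of_real a)"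
  proof -
    have qc: "(q * c)\<^sup>2 = q\<^sup>2 / (2 * a)" by (simp add: power_mult_distrib c)
    show ?thesis unfolding qc using a by (simp add: b power2_eq_square field_simps)
  qed
  finally show ?thesis .
qed

text \<open>Completing the square: half of the quadratic term absorbs the linear one.\<close>

lemma exp_lin_le_exp_quad:
  assumes "(\<delta>::real) > 0"
  shows "exp (b * \<bar>x\<bar> - \<delta> * x\<^sup>2) \<le> exp (b\<^sup>2 / (2 * \<delta>)) * exp (- (\<delta> / 2 * x\<^sup>2))"
proof -
  have "0 \<le> (\<delta> * \<bar>x\<bar> - b)\<^sup>2" by simp
  then have "0 \<le> \<delta>\<^sup>2 * x\<^sup>2 - 2 * \<delta> * b * \<bar>x\<bar> + b\<^sup>2" by (simp add: power2_diff power_mult_distrib algebra_simps)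
  then have "2 * \<delta> * b * \<bar>x\<bar> \<le> \<delta>\<^sup>2 * x\<^sup>2 + b\<^sup>2" by linarith
  then have "(2 * \<delta> * b * \<bar>x\<bar>) / (2 * \<delta>) \<le> (\<delta>\<^sup>2 * x\<^sup>2 + b\<^sup>2) / (2 * \<delta>)" using assms by (intro divide_right_mono) auto
  then have "b * \<bar>x\<bar> \<le> \<delta> / 2 * x\<^sup>2 + b\<^sup>2 / (2 * \<delta>)" using assms by (simp add: field_simps power2_eq_square)
  then show ?thesis by (simp flip: exp_add)
qed

lemma integrable_exp_gauss:
  assumes "(\<delta>::real) > 0"
  shows "integrable lborel (\<lambda>x::real. exp (b * \<bar>x\<bar> - \<delta> * x\<^sup>2))"
proof (rule Bochner_Integration.integrable_bound)
  show "integrable lborel (\<lambda>x::real. exp (b\<^sup>2 / (2 * \<delta>)) * exp (- (\<delta> / 2 * x\<^sup>2)))"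
    using assms by (intro integrable_mult_right integrable_gauss) auto
qed (use exp_lin_le_exp_quad[OF assms] in auto)

text \<open>The integrand is the derivative of \<open>p x * exp (- a * x\<^sup>2)\<close>, which vanishes at both ends. The growth bounds
serve to make it integrable.\<close>

lemma gauss_by_parts:
  fixes p p' :: "real \<Rightarrow> complex"
  assumes a: "a > 0"
    and der: "\<And>x. (p has_vector_derivative p' x) (at x)" and cont: "\<And>x. isCont p' x"
    and bp: "\<And>x. cmod (p x) \<le> C * exp (b * \<bar>x\<bar>)" and bp': "\<And>x. cmod (p' x) \<le> C * exp (b * \<bar>x\<bar>)"
  shows "(LINT x|lborel. (p' x - 2 * of_real a * of_real x * p x) * of_real (exp (- (a * x\<^sup>2)))) = 0"
proof -
  have contp: "isCont p x" for x
    using der has_vector_derivative_continuous by blast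
  have C: "C \<ge> 0" using order_trans[OF norm_ge_zero bp[of 0]] by simp
  define F where "F x = p x * of_real (exp (- (a * x\<^sup>2)))" for x
  define f where "f x = (p' x - 2 * of_real a * of_real x * p x) * of_real (exp (- (a * x\<^sup>2)))" for x
  have dexp: "((\<lambda>x. complex_of_real (exp (- (a * x\<^sup>2)))) has_vector_derivative
      of_real (exp (- (a * x\<^sup>2)) * (- (a * (2 * x))))) (at x)" for x
    by (intro has_vector_derivative_of_real) (auto intro!: derivative_eq_intros simp: has_real_derivative_iff_has_vector_derivative[symmetric])
  have dF: "(F has_vector_derivative f x) (at x)" for x
    unfolding F_def f_def
    by (rule has_vector_derivative_eq_rhs, rule has_vector_derivative_mult[OF der dexp]) (simp add: algebra_simps)
  have cf: "isCont f x" for x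
    unfolding f_def by (intro continuous_intros cont contp)
  have fm: "f \<in> borel_measurable borel"
    using cf by (intro borel_measurable_continuous_onI continuous_at_imp_continuous_on) auto
  have bF: "cmod (F x) \<le> C * exp (b\<^sup>2 / (2 * a)) * exp (- (a / 2 * x\<^sup>2))" for x
  proof -
    have "cmod (F x) \<le> C * exp (b * \<bar>x\<bar>) * exp (- (a * x\<^sup>2))"
      unfolding F_def by (simp add: norm_mult bp)
    also have "\<dots> = C * exp (b * \<bar>x\<bar> - a * x\<^sup>2)" by (simp add: exp_diff exp_minus field_simps)
    also have "\<dots> \<le> C * (exp (b\<^sup>2 / (2 * a)) * exp (- (a / 2 * x\<^sup>2)))"
      by (intro mult_left_mono exp_lin_le_exp_quad a C)
    finally show ?thesis by (simp add: mult.assoc)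
  qed
  have l1: "((\<lambda>x::real. C * exp (b\<^sup>2 / (2 * a)) * exp (- (a / 2 * x\<^sup>2))) \<longlongrightarrow> 0) at_top"
    "((\<lambda>x::real. C * exp (b\<^sup>2 / (2 * a)) * exp (- (a / 2 * x\<^sup>2))) \<longlongrightarrow> 0) at_bot"
    using a by real_asymp+
  have lim: "(F \<longlongrightarrow> 0) at_top" "(F \<longlongrightarrow> 0) at_bot"
    by (rule Lim_null_comparison[OF _ l1(1)] Lim_null_comparison[OF _ l1(2)], use bF in auto)+
  have intf: "integrable lborel f"
  proof (rule Bochner_Integration.integrable_bound)
    show "integrable lborel (\<lambda>x. (C + 2 * a * C) * exp ((b + 1) * \<bar>x\<bar> - a * x\<^sup>2))"
      using a by (intro integrable_mult_right integrable_exp_gauss)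
    show "AE x in lborel. norm (f x) \<le> norm ((C + 2 * a * C) * exp ((b + 1) * \<bar>x\<bar> - a * x\<^sup>2))"
    proof (rule AE_I2)
      fix x :: real
      \<comment> \<open>the factor \<open>x\<close> of the derivative of the Gaussian costs one more exponential \<open>exp \<bar>x\<bar>\<close>\<close>
      have e1: "1 \<le> exp \<bar>x\<bar>" "\<bar>x\<bar> \<le> exp \<bar>x\<bar>" using exp_ge_add_one_self[of "\<bar>x\<bar>"] by linarith+
      have "cmod (p' x - 2 * of_real a * of_real x * p x) \<le> cmod (p' x) + 2 * a * \<bar>x\<bar> * cmod (p x)"
        using a by (intro order_trans[OF norm_triangle_ineq4]) (simp add: norm_mult)
      also have "\<dots> \<le> (C * exp (b * \<bar>x\<bar>)) * exp \<bar>x\<bar> + 2 * a * exp \<bar>x\<bar> * (C * exp (b * \<bar>x\<bar>))"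
      proof (rule add_mono)
        have "C * exp (b * \<bar>x\<bar>) * 1 \<le> C * exp (b * \<bar>x\<bar>) * exp \<bar>x\<bar>" using C e1(1) by (intro mult_left_mono) auto
        then show "cmod (p' x) \<le> C * exp (b * \<bar>x\<bar>) * exp \<bar>x\<bar>" using bp'[of x] by simp
        show "2 * a * \<bar>x\<bar> * cmod (p x) \<le> 2 * a * exp \<bar>x\<bar> * (C * exp (b * \<bar>x\<bar>))"
          using a C e1 by (intro mult_mono bp mult_nonneg_nonneg) auto
      qed
      also have "\<dots> = (C + 2 * a * C) * exp ((b + 1) * \<bar>x\<bar>)" by (simp add: algebra_simps exp_add)
      finally have "cmod (f x) \<le> (C + 2 * a * C) * exp ((b + 1) * \<bar>x\<bar>) * exp (- (a * x\<^sup>2))"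
        unfolding f_def by (simp add: norm_mult mult_right_mono)
      also have "\<dots> = (C + 2 * a * C) * exp ((b + 1) * \<bar>x\<bar> - a * x\<^sup>2)" by (simp add: exp_diff exp_minus field_simps)
      finally show "norm (f x) \<le> norm ((C + 2 * a * C) * exp ((b + 1) * \<bar>x\<bar> - a * x\<^sup>2))"
        by (rule order_trans) auto
    qed
  qed (use fm in auto)
  have "(LBINT x=-\<infinity>..\<infinity>. f x) = 0 - 0"
    by (rule interval_integral_FTC_integrable[where F=F])
       (use dF cf intf lim in \<open>auto simp: ereal_tendsto_simps set_integrable_def\<close>)
  then show ?thesis
    by (simp add: interval_lebesgue_integral_def set_lebesgue_integral_def f_def)
qed

subsection \<open>Functions of exponential growth and an anisotropic Gaussian weight\<close>

lemma real_le_exp: "(x::real) \<le> exp x"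
  using exp_ge_add_one_self[of x] by linarith

text \<open>A class of functions that contains the polynomials in \<open>z\<close> and \<open>cnj z\<close>, is closed under sums, products
and conjugation, and is integrable against every Gaussian, so that integrability need not be
established anew for each integrand.\<close>

definition exp_growth :: "(complex \<Rightarrow> complex) \<Rightarrow> bool" where
  "exp_growth f \<longleftrightarrow> (\<exists>C b. b \<ge> 0 \<and> (\<forall>z. cmod (f z) \<le> C * exp (b * cmod z)))"

lemma exp_growth_const: "exp_growth (\<lambda>z. c)"
  unfolding exp_growth_def by (intro exI[of _ "cmod c"] exI[of _ 0]) auto

lemma exp_growth_ident: "exp_growth (\<lambda>z. z)"
  unfolding exp_growth_def
proof (intro exI[of _ 1] conjI allI)
  fix z :: complex show "cmod z \<le> 1 * exp (1 * cmod z)" using real_le_exp[of "cmod z"] by simp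
qed auto

lemma exp_growth_add:
  assumes "exp_growth f" "exp_growth g" shows "exp_growth (\<lambda>z. f z + g z)"
proof -
  obtain C b D d where *: "b \<ge> 0" "\<And>z. cmod (f z) \<le> C * exp (b * cmod z)" "d \<ge> 0" "\<And>z. cmod (g z) \<le> D * exp (d * cmod z)"
    using assms unfolding exp_growth_def by blast
  have C: "0 \<le> C" "0 \<le> D" using order_trans[OF norm_ge_zero *(2)[of 0]] order_trans[OF norm_ge_zero *(4)[of 0]] by simp_all
  have "cmod (f z + g z) \<le> (C + D) * exp ((b + d) * cmod z)" for z
  proof -
    have "cmod (f z + g z) \<le> C * exp (b * cmod z) + D * exp (d * cmod z)"
      by (intro order_trans[OF norm_triangle_ineq] add_mono *)
    also have "\<dots> \<le> C * exp ((b + d) * cmod z) + D * exp ((b + d) * cmod z)"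
      using * C by (intro add_mono mult_left_mono) (auto intro!: mult_right_mono)
    finally show ?thesis by (simp add: algebra_simps)
  qed
  then show ?thesis unfolding exp_growth_def using * by (intro exI[of _ "C + D"] exI[of _ "b + d"]) auto
qed

lemma exp_growth_mult:
  assumes "exp_growth f" "exp_growth g" shows "exp_growth (\<lambda>z. f z * g z)"
proof -
  obtain C b D d where *: "b \<ge> 0" "\<And>z. cmod (f z) \<le> C * exp (b * cmod z)" "d \<ge> 0" "\<And>z. cmod (g z) \<le> D * exp (d * cmod z)"
    using assms unfolding exp_growth_def by blast
  have C: "0 \<le> C" "0 \<le> D" using order_trans[OF norm_ge_zero *(2)[of 0]] order_trans[OF norm_ge_zero *(4)[of 0]] by simp_all
  have "cmod (f z * g z) \<le> (C * D) * exp ((b + d) * cmod z)" for z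
  proof -
    have "cmod (f z * g z) \<le> (C * exp (b * cmod z)) * (D * exp (d * cmod z))"
      unfolding norm_mult using * C by (intro mult_mono) auto
    then show ?thesis by (simp add: algebra_simps exp_add)
  qed
  then show ?thesis unfolding exp_growth_def using * by (intro exI[of _ "C * D"] exI[of _ "b + d"]) auto
qed

lemma exp_growth_diff:
  assumes "exp_growth f" "exp_growth g" shows "exp_growth (\<lambda>z. f z - g z)"
  using exp_growth_add[OF assms(1) exp_growth_mult[OF exp_growth_const[of "-1"] assms(2)]] by simp

lemma exp_growth_cnj: "exp_growth f \<Longrightarrow> exp_growth (\<lambda>z. cnj (f z))"
  by (simp add: exp_growth_def)

definition gauss2 :: "real \<Rightarrow> real \<Rightarrow> complex \<Rightarrow> real" where
  "gauss2 A B z = exp (- (A * (Re z)\<^sup>2) - B * (Im z)\<^sup>2)"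

lemma gauss2_measurable[measurable]: "gauss2 A B \<in> borel_measurable borel"
  unfolding gauss2_def by measurable

lemma integrable_gauss2:
  assumes "A > 0" "B > 0"
  shows "integrable lborel (gauss2 A B)" "(LINT z|lborel. gauss2 A B z) = pi / sqrt (A * B)"
proof -
  have eq: "gauss2 A B = (\<lambda>z. exp (- (A * (Re z)\<^sup>2)) * exp (- (B * (Im z)\<^sup>2)))"
    by (auto simp: gauss2_def fun_eq_iff simp flip: exp_add)
  show "integrable lborel (gauss2 A B)"
    unfolding eq by (intro integrable_complex_prod integrable_gauss assms)
  show "(LINT z|lborel. gauss2 A B z) = pi / sqrt (A * B)"
    unfolding eq using assms
    by (subst integral_complex_prod) (auto simp: integrable_gauss integral_gauss real_sqrt_divide real_sqrt_mult)
qed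

lemma integrable_exp_growth_gauss2:
  assumes AB: "A > 0" "B > 0" and f: "exp_growth f" and fm: "f \<in> borel_measurable borel"
  shows "integrable lborel (\<lambda>z. f z * of_real (gauss2 A B z))"
proof -
  obtain C b where b: "b \<ge> 0" "\<And>z. cmod (f z) \<le> C * exp (b * cmod z)"
    using f unfolding exp_growth_def by blast
  have C: "0 \<le> C" using order_trans[OF norm_ge_zero b(2)[of 0]] by simp
  show ?thesis
  proof (rule Bochner_Integration.integrable_bound)
    show "integrable lborel (\<lambda>z. C * (exp (b * \<bar>Re z\<bar> - A * (Re z)\<^sup>2) * exp (b * \<bar>Im z\<bar> - B * (Im z)\<^sup>2)))"
      by (intro integrable_mult_right integrable_complex_prod integrable_exp_gauss AB)
    show "AE z in lborel. norm (f z * of_real (gauss2 A B z))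
        \<le> norm (C * (exp (b * \<bar>Re z\<bar> - A * (Re z)\<^sup>2) * exp (b * \<bar>Im z\<bar> - B * (Im z)\<^sup>2)))"
    proof (rule AE_I2)
      fix z
      have "cmod (f z) \<le> C * exp (b * (\<bar>Re z\<bar> + \<bar>Im z\<bar>))"
        using b C by (intro order_trans[OF b(2)] mult_left_mono) (auto intro!: mult_left_mono cmod_le)
      then have "norm (f z * of_real (gauss2 A B z)) \<le> C * exp (b * (\<bar>Re z\<bar> + \<bar>Im z\<bar>)) * gauss2 A B z"
        unfolding norm_mult using C by (intro mult_mono) (auto simp: gauss2_def)
      also have "\<dots> = C * (exp (b * \<bar>Re z\<bar> - A * (Re z)\<^sup>2) * exp (b * \<bar>Im z\<bar> - B * (Im z)\<^sup>2))"
        by (simp add: gauss2_def algebra_simps flip: exp_add)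
      finally show "norm (f z * of_real (gauss2 A B z))
        \<le> norm (C * (exp (b * \<bar>Re z\<bar> - A * (Re z)\<^sup>2) * exp (b * \<bar>Im z\<bar> - B * (Im z)\<^sup>2)))"
        by (rule order_trans) auto
    qed
  qed (use fm in measurable)
qed

lemma cmod_Complex_le: "cmod (Complex x y) \<le> \<bar>x\<bar> + \<bar>y\<bar>"
  using cmod_le[of "Complex x y"] by simp

lemma exp_growth_bound_fst:
  assumes "exp_growth f"
  shows "\<exists>C b. b \<ge> 0 \<and> (\<forall>x y. cmod (f (Complex x y)) \<le> C * exp (b * \<bar>y\<bar>) * exp (b * \<bar>x\<bar>))"
proof -
  obtain C b where b: "b \<ge> 0" "\<And>z. cmod (f z) \<le> C * exp (b * cmod z)"
    using assms unfolding exp_growth_def by blast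
  have C: "0 \<le> C" using order_trans[OF norm_ge_zero b(2)[of 0]] by simp
  have "cmod (f (Complex x y)) \<le> C * exp (b * \<bar>y\<bar>) * exp (b * \<bar>x\<bar>)" for x y
  proof -
    have "cmod (f (Complex x y)) \<le> C * exp (b * (\<bar>x\<bar> + \<bar>y\<bar>))"
      using b C by (intro order_trans[OF b(2)] mult_left_mono) (auto intro!: mult_left_mono cmod_Complex_le)
    then show ?thesis by (simp add: algebra_simps exp_add)
  qed
  then show ?thesis using b(1) by blast
qed

text \<open>Integration by parts in the two real coordinates; \<open>p\<close> is typically a holomorphic function
  times an antiholomorphic one, and \<open>px\<close>, \<open>py\<close> are its partial derivatives.\<close>

lemma gauss2_by_parts:
  assumes AB: "A > 0" "B > 0"
    and px: "\<And>x y. ((\<lambda>x. p (Complex x y)) has_vector_derivative px (Complex x y)) (at x)"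
    and py: "\<And>x y. ((\<lambda>y. p (Complex x y)) has_vector_derivative py (Complex x y)) (at y)"
    and cont: "continuous_on UNIV p" "continuous_on UNIV px" "continuous_on UNIV py"
    and gr: "exp_growth p" "exp_growth px" "exp_growth py"
  shows "(LINT z|lborel. (px z - 2 * of_real A * of_real (Re z) * p z) * of_real (gauss2 A B z)) = 0"
    and "(LINT z|lborel. (py z - 2 * of_real B * of_real (Im z) * p z) * of_real (gauss2 A B z)) = 0"
proof -
  have [measurable]: "p \<in> borel_measurable borel" "px \<in> borel_measurable borel" "py \<in> borel_measurable borel"
    using cont by (auto intro: borel_measurable_continuous_onI)
  have growth_Re: "exp_growth (\<lambda>z. of_real (Re z))" and growth_Im: "exp_growth (\<lambda>z. of_real (Im z))"
  proof -
    have "cmod (of_real (Re z)) \<le> 1 * exp (1 * cmod z)" "cmod (of_real (Im z)) \<le> 1 * exp (1 * cmod z)" for z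
      using order_trans[OF abs_Re_le_cmod[of z] real_le_exp] order_trans[OF abs_Im_le_cmod[of z] real_le_exp] by simp_all
    then show "exp_growth (\<lambda>z. of_real (Re z))" "exp_growth (\<lambda>z. of_real (Im z))"
      unfolding exp_growth_def by (meson zero_le_one)+
  qed
  have contl: "isCont (\<lambda>x. f (Complex x y)) x" "isCont (\<lambda>y. f (Complex x y)) y"
    if "continuous_on UNIV f" for x y and f :: "complex \<Rightarrow> complex"
  proof -
    have "continuous_on UNIV (\<lambda>x. f (Complex x y))" "continuous_on UNIV (\<lambda>y. f (Complex x y))"
      by (auto intro!: continuous_on_compose2[OF that] continuous_intros)
    then show "isCont (\<lambda>x. f (Complex x y)) x" "isCont (\<lambda>y. f (Complex x y)) y"
      by (auto simp: continuous_on_eq_continuous_at)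
  qed
  obtain C1 b1 where 1: "b1 \<ge> 0" "\<And>x y. cmod (p (Complex x y)) \<le> C1 * exp (b1 * \<bar>y\<bar>) * exp (b1 * \<bar>x\<bar>)"
    using exp_growth_bound_fst[OF gr(1)] by blast
  obtain C2 b2 where 2: "b2 \<ge> 0" "\<And>x y. cmod (px (Complex x y)) \<le> C2 * exp (b2 * \<bar>y\<bar>) * exp (b2 * \<bar>x\<bar>)"
    using exp_growth_bound_fst[OF gr(2)] by blast
  obtain C3 b3 where 3: "b3 \<ge> 0" "\<And>x y. cmod (py (Complex x y)) \<le> C3 * exp (b3 * \<bar>y\<bar>) * exp (b3 * \<bar>x\<bar>)"
    using exp_growth_bound_fst[OF gr(3)] by blast
  define C where "C = max C1 (max C2 C3)"
  define b where "b = max b1 (max b2 b3)"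
  have C0: "0 \<le> C1" "0 \<le> C2" "0 \<le> C3"
    using order_trans[OF norm_ge_zero 1(2)[of 0 0]] order_trans[OF norm_ge_zero 2(2)[of 0 0]]
      order_trans[OF norm_ge_zero 3(2)[of 0 0]] by simp_all
  have up: "C' * exp (b' * \<bar>y\<bar>) * exp (b' * \<bar>x\<bar>) \<le> C * exp (b * \<bar>y\<bar>) * exp (b * \<bar>x\<bar>)"
    if "0 \<le> C'" "C' \<le> C" "b' \<le> b" for C' b' x y
    using that by (intro mult_mono mult_nonneg_nonneg) (auto intro: mult_right_mono)
  have bd: "cmod (p (Complex x y)) \<le> C * exp (b * \<bar>y\<bar>) * exp (b * \<bar>x\<bar>)"
     "cmod (px (Complex x y)) \<le> C * exp (b * \<bar>y\<bar>) * exp (b * \<bar>x\<bar>)"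
     "cmod (py (Complex x y)) \<le> C * exp (b * \<bar>y\<bar>) * exp (b * \<bar>x\<bar>)" for x y
    by (rule order_trans[OF 1(2) up] order_trans[OF 2(2) up] order_trans[OF 3(2) up]; use C0 in \<open>simp add: C_def b_def\<close>)+
  define gx where "gx z = (px z - 2 * of_real A * of_real (Re z) * p z) * of_real (gauss2 A B z)" for z
  define gy where "gy z = (py z - 2 * of_real B * of_real (Im z) * p z) * of_real (gauss2 A B z)" for z
  have gm[measurable]: "gx \<in> borel_measurable borel" "gy \<in> borel_measurable borel"
    unfolding gx_def gy_def by measurable
  have intx: "integrable lborel gx" unfolding gx_def
    by (intro integrable_exp_growth_gauss2 AB exp_growth_diff exp_growth_mult exp_growth_const growth_Re gr) measurable
  have inty: "integrable lborel gy" unfolding gy_def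
    by (intro integrable_exp_growth_gauss2 AB exp_growth_diff exp_growth_mult exp_growth_const growth_Im gr) measurable
  have "(LINT z|lborel. gx z) = (LINT y|lborel. (LINT x|lborel. gx (Complex x y)))"
    using intx by (simp add: integral_complex_eq integrable_complex_iff lborel_pair.integral_snd[where f="\<lambda>x y. gx (Complex x y)"])
  also have "\<dots> = (LINT y|(lborel::real measure). 0)"
  proof (intro Bochner_Integration.integral_cong refl)
    fix y
    have "(LINT x|lborel. gx (Complex x y)) = (LINT x|lborel. of_real (exp (- (B * y\<^sup>2))) *
      ((px (Complex x y) - 2 * of_real A * of_real x * p (Complex x y)) * of_real (exp (- (A * x\<^sup>2)))))"
      by (intro Bochner_Integration.integral_cong refl)
         (simp add: gx_def gauss2_def exp_diff exp_minus field_simps)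
    also have "\<dots> = 0"
      using gauss_by_parts[OF AB(1) px contl(1)[OF cont(2)], where C="C * exp (b * \<bar>y\<bar>)" and b=b] bd by simp
    finally show "(LINT x|lborel. gx (Complex x y)) = 0" .
  qed
  finally show "(LINT z|lborel. (px z - 2 * of_real A * of_real (Re z) * p z) * of_real (gauss2 A B z)) = 0"
    by (simp add: gx_def)
  have "(LINT z|lborel. gy z) = (LINT x|lborel. (LINT y|lborel. gy (Complex x y)))"
    using inty by (simp add: integral_complex_eq integrable_complex_iff lborel_pair.integral_fst[where f="\<lambda>x y. gy (Complex x y)"])
  also have "\<dots> = (LINT x|(lborel::real measure). 0)"
  proof (intro Bochner_Integration.integral_cong refl)
    fix x
    have "(LINT y|lborel. gy (Complex x y)) = (LINT y|lborel. of_real (exp (- (A * x\<^sup>2))) *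
      ((py (Complex x y) - 2 * of_real B * of_real y * p (Complex x y)) * of_real (exp (- (B * y\<^sup>2)))))"
      by (intro Bochner_Integration.integral_cong refl)
         (simp add: gy_def gauss2_def exp_diff exp_minus field_simps)
    also have "\<dots> = 0"
    proof -
      have "cmod (p (Complex x y)) \<le> C * exp (b * \<bar>x\<bar>) * exp (b * \<bar>y\<bar>)"
        "cmod (py (Complex x y)) \<le> C * exp (b * \<bar>x\<bar>) * exp (b * \<bar>y\<bar>)" for y
        using bd(1,3)[of x y] by (simp_all add: mult_ac)
      from gauss_by_parts[OF AB(2) py contl(2)[OF cont(3)] this] show ?thesis by simp
    qed
    finally show "(LINT y|lborel. gy (Complex x y)) = 0" .
  qed
  finally show "(LINT z|lborel. (py z - 2 * of_real B * of_real (Im z) * p z) * of_real (gauss2 A B z)) = 0"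
    by (simp add: gy_def)
qed

section \<open>Hermite polynomials\<close>

text \<open>The physicists' Hermite polynomials, over the reals and over the complex numbers at once. The
three-term recursion makes them available in both fields; Rodrigues' formula is \<open>deriv_gauss\<close>.\<close>

fun herm :: "nat \<Rightarrow> 'a::real_normed_field \<Rightarrow> 'a" where
  "herm 0 z = 1"
| "herm (Suc 0) z = 2 * z"
| "herm (Suc (Suc n)) z = 2 * z * herm (Suc n) z - 2 * of_nat (Suc n) * herm n z"

lemma herm_Suc: "herm (Suc n) z = 2 * z * herm n z - 2 * of_nat n * herm (n - 1) z"
  by (cases n) auto

lemma herm_has_field_derivative:
  "(herm n has_field_derivative 2 * of_nat n * herm (n - 1) z) (at z)"
proof (induction n arbitrary: z rule: induct_nat_012)
  case 0 then show ?case by (auto intro!: derivative_eq_intros)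
next
  case 1 then show ?case by (auto intro!: derivative_eq_intros)
next
  case (ge2 n)
  have "((\<lambda>z. 2 * z * herm (Suc n) z - 2 * of_nat (Suc n) * herm n z) has_field_derivative
     2 * herm (Suc n) z + 2 * z * (2 * of_nat (Suc n) * herm n z) - 2 * of_nat (Suc n) * (2 * of_nat n * herm (n - 1) z)) (at z)"
    by (rule derivative_eq_intros ge2 refl | simp)+
  also have "2 * herm (Suc n) z + 2 * z * (2 * of_nat (Suc n) * herm n z) - 2 * of_nat (Suc n) * (2 * of_nat n * herm (n - 1) z)
     = 2 * herm (Suc n) z + 2 * of_nat (Suc n) * herm (Suc n) z"
    by (simp only: herm_Suc[of n]) (simp add: algebra_simps)
  finally show ?case by (simp add: algebra_simps)
qed

lemmas herm_derivative[derivative_intros] = DERIV_chain2[OF herm_has_field_derivative]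

lemma herm_of_real: "herm n (of_real x :: 'a::real_normed_field) = of_real (herm n x)"
  by (induction n x rule: herm.induct) simp_all

lemma herm_cnj: "herm n (cnj z) = cnj (herm n z)"
  by (induction n z rule: herm.induct) simp_all

lemma continuous_on_herm[continuous_intros]:
  "continuous_on S f \<Longrightarrow> continuous_on S (\<lambda>x. herm n (f x :: 'a::real_normed_field))"
proof -
  have "continuous_on UNIV (herm n :: 'a \<Rightarrow> 'a)"
    using herm_has_field_derivative DERIV_isCont by (fastforce intro: continuous_at_imp_continuous_on)
  then show "continuous_on S f \<Longrightarrow> continuous_on S (\<lambda>x. herm n (f x))"
    by (rule continuous_on_compose2) auto
qed

lemma exp_growth_herm: "exp_growth (herm n)"
proof (induction n rule: less_induct)
  case (less n)
  consider "n = 0" | "n = 1" | m where "n = Suc (Suc m)" by (metis One_nat_def nat.exhaust)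
  then show ?case
  proof cases
    case 1 then show ?thesis using exp_growth_const[of 1] by (simp add: exp_growth_def)
  next
    case 2 then show ?thesis using exp_growth_mult[OF exp_growth_const[of 2] exp_growth_ident] by (simp add: exp_growth_def)
  next
    case 3
    have "exp_growth (\<lambda>z. 2 * z * herm (Suc m) z - 2 * of_nat (Suc m) * herm m z)"
      by (intro exp_growth_diff exp_growth_mult exp_growth_const exp_growth_ident less) (auto simp: 3)
    then show ?thesis by (simp add: exp_growth_def 3)
  qed
qed

text \<open>Rodrigues' formula: differentiating \<open>herm k x * exp (- x\<^sup>2)\<close> once more reproduces the recursion, with
the sign reversed.\<close>

lemma deriv_gauss: "(deriv ^^ k) (\<lambda>u::real. exp (- u\<^sup>2)) = (\<lambda>x. (-1) ^ k * herm k x * exp (- x\<^sup>2))"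
proof (induction k)
  case (Suc k)
  have "((\<lambda>x. (-1) ^ k * herm k x * exp (- x\<^sup>2)) has_real_derivative (-1) ^ Suc k * herm (Suc k) x * exp (- x\<^sup>2)) (at x)" for x :: real
    by (auto intro!: derivative_eq_intros simp: herm_Suc[of k] algebra_simps)
  then have "deriv (\<lambda>x. (-1) ^ k * herm k x * exp (- x\<^sup>2)) x = (-1) ^ Suc k * herm (Suc k) x * exp (- x\<^sup>2)" for x :: real
    by (rule DERIV_imp_deriv)
  then show ?case by (simp add: Suc fun_eq_iff)
qed simp

definition hconst :: "nat \<Rightarrow> real" where
  "hconst k = 1 / sqrt (2 ^ k * fact k * sqrt pi)"

lemma hconst_sq: "(hconst k)\<^sup>2 = 1 / (2 ^ k * fact k * sqrt pi)"
  by (simp add: hconst_def power_divide)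

text \<open>The entire function that extends \<^const>\<open>hermite_fun\<close> (see \<open>hfunC_of_real\<close>).\<close>

definition hfunC :: "nat \<Rightarrow> complex \<Rightarrow> complex" where
  "hfunC k z = of_real (hconst k) * herm k z * exp (- (z\<^sup>2 / 2))"

lemma hermite_fun_eq: "hermite_fun k x = hconst k * herm k x * exp (- (x\<^sup>2 / 2))"
proof -
  have "exp (x\<^sup>2 / 2) * exp (- x\<^sup>2) = exp (- (x\<^sup>2 / 2))" by (simp flip: exp_add)
  moreover have "(-1) ^ k * (-1) ^ k = (1::real)" by (simp flip: power_mult_distrib)
  moreover have "hermite_fun k x = hconst k * herm k x * ((-1) ^ k * (-1) ^ k) * (exp (x\<^sup>2 / 2) * exp (- x\<^sup>2))"
    unfolding hermite_fun_def deriv_gauss hconst_def by simp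
  ultimately show ?thesis by simp
qed

lemma hfunC_of_real: "hfunC k (of_real x) = of_real (hermite_fun k x)"
  by (simp add: hfunC_def hermite_fun_eq herm_of_real exp_of_real[symmetric])

lemma hfunC_cnj: "hfunC k (cnj z) = cnj (hfunC k z)"
  by (simp add: hfunC_def herm_cnj exp_cnj)

lemma continuous_on_hfunC[continuous_intros]:
  "continuous_on S f \<Longrightarrow> continuous_on S (\<lambda>x. hfunC k (f x))"
  unfolding hfunC_def by (intro continuous_intros) auto

lemma hfunC_has_field_derivative:
  "(hfunC k has_field_derivative of_real (hconst k) * (2 * of_nat k * herm (k - 1) z - z * herm k z) * exp (- (z\<^sup>2 / 2))) (at z)"
  unfolding hfunC_def[abs_def]
  by (auto intro!: derivative_eq_intros simp: algebra_simps power2_eq_square)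

lemma hfunC_holomorphic: "hfunC k holomorphic_on S"
  using hfunC_has_field_derivative by (meson holomorphic_onI field_differentiable_at_within field_differentiable_def)

text \<open>Hermite's differential equation, the reason why the complexified Hermite operator acts diagonally.\<close>

lemma hfunC_ode: "(deriv ^^ 2) (hfunC k) z = z\<^sup>2 * hfunC k z - of_nat (2 * k + 1) * hfunC k z"
proof -
  have d1: "deriv (hfunC k) = (\<lambda>z. of_real (hconst k) * (2 * of_nat k * herm (k - 1) z - z * herm k z) * exp (- (z\<^sup>2 / 2)))"
    using hfunC_has_field_derivative by (auto intro!: DERIV_imp_deriv)
  have "((\<lambda>z. of_real (hconst k) * (2 * of_nat k * herm (k - 1) z - z * herm k z) * exp (- (z\<^sup>2 / 2))) has_field_derivative
     of_real (hconst k) * ((2 * of_nat k * (2 * of_nat (k - 1) * herm (k - 1 - 1) z) - (herm k z + z * (2 * of_nat k * herm (k - 1) z)))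
       - z * (2 * of_nat k * herm (k - 1) z - z * herm k z)) * exp (- (z\<^sup>2 / 2))) (at z)"
    by (auto intro!: derivative_eq_intros simp: algebra_simps power2_eq_square)
  then have d2: "(deriv ^^ 2) (hfunC k) z = of_real (hconst k) * ((2 * of_nat k * (2 * of_nat (k - 1) * herm (k - 1 - 1) z) - (herm k z + z * (2 * of_nat k * herm (k - 1) z)))
       - z * (2 * of_nat k * herm (k - 1) z - z * herm k z)) * exp (- (z\<^sup>2 / 2))"
    by (simp add: numeral_2_eq_2 d1 DERIV_imp_deriv)
  have rec: "2 * of_nat k * (2 * z * herm (k - 1) z - 2 * of_nat (k - 1) * herm (k - 1 - 1) z) = 2 * of_nat k * herm k z"
    using herm_Suc[of "k - 1" z] by (cases k) auto
  have "(2 * of_nat k * (2 * of_nat (k - 1) * herm (k - 1 - 1) z) - (herm k z + z * (2 * of_nat k * herm (k - 1) z)))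
       - z * (2 * of_nat k * herm (k - 1) z - z * herm k z)
     = z\<^sup>2 * herm k z - herm k z - 2 * of_nat k * (2 * z * herm (k - 1) z - 2 * of_nat (k - 1) * herm (k - 1 - 1) z)"
    by (simp add: algebra_simps power2_eq_square)
  also have "\<dots> = z\<^sup>2 * herm k z - of_nat (2 * k + 1) * herm k z"
    unfolding rec by (simp add: algebra_simps)
  finally have eq: "(2 * of_nat k * (2 * of_nat (k - 1) * herm (k - 1 - 1) z) - (herm k z + z * (2 * of_nat k * herm (k - 1) z)))
       - z * (2 * of_nat k * herm (k - 1) z - z * herm k z) = z\<^sup>2 * herm k z - of_nat (2 * k + 1) * herm k z" .
  show ?thesis unfolding d2 hfunC_def eq by (simp add: algebra_simps)
qed

subsection \<open>Orthogonality on the line and in the plane\<close>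

text \<open>Both orthogonality relations come from the following adjointness scheme: raising the first
  index is, up to the factor \<open>\<kappa>\<close>, adjoint to differentiating the second polynomial.\<close>

lemma adjoint_scheme:
  fixes S :: "nat \<Rightarrow> nat \<Rightarrow> complex" and \<kappa> :: real
  assumes rec: "\<And>j k. S (Suc j) k = of_real \<kappa> * (2 * of_nat k * S j (k - 1))"
    and sym: "\<And>j k. S j k = cnj (S k j)"
  shows "S j k = (if j = k then of_real ((2 * \<kappa>) ^ k * fact k) * S 0 0 else 0)"
proof (induction j arbitrary: k)
  case 0
  show ?case
  proof (cases k)
    case (Suc k')
    have "S 0 k = cnj (S k 0)" by (rule sym)
    also have "\<dots> = cnj (S (Suc k') 0)" by (simp add: Suc)
    also have "\<dots> = 0" by (simp add: rec)
    finally show ?thesis using Suc by simp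
  qed simp
next
  case (Suc j)
  show ?case
  proof (cases k)
    case (Suc k')
    then show ?thesis by (auto simp: rec Suc.IH algebra_simps)
  qed (simp add: rec)
qed

definition herm_plane_form :: "real \<Rightarrow> nat \<Rightarrow> nat \<Rightarrow> complex" where
  "herm_plane_form \<kappa> j k =
     (LINT z|lborel. herm j z * cnj (herm k z) * of_real (gauss2 (2 / (1 + \<kappa>)) (2 / (\<kappa> - 1)) z))"

text \<open>Let \<open>f = herm j\<close>, \<open>g = herm k\<close>. Integrating \<open>f * cnj g\<close> by parts in both real coordinates replaces the
factor \<open>z\<close> in the integral of \<open>z * f * cnj g\<close> by derivatives: it becomes the integral of
\<open>(1 / (2 * A) - 1 / (2 * B)) * f' * cnj g + (1 / (2 * A) + 1 / (2 * B)) * f * cnj g'\<close>. The exponents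
\<open>A = 2 / (1 + \<kappa>)\<close> and \<open>B = 2 / (\<kappa> - 1)\<close> make the first coefficient \<open>1 / 2\<close>, so that this term is cancelled
by the last term of the three-term recursion for \<open>herm (Suc j)\<close>, and the second one \<open>\<kappa> / 2\<close>.\<close>

lemma herm_plane_rec:
  assumes \<kappa>: "\<kappa> > 1"
  shows "herm_plane_form \<kappa> (Suc j) k = of_real \<kappa> * (2 * of_nat k * herm_plane_form \<kappa> j (k - 1))"
proof -
  define A where "A = 2 / (1 + \<kappa>)"
  define B where "B = 2 / (\<kappa> - 1)"
  have AB: "A > 0" "B > 0" using \<kappa> by (auto simp: A_def B_def)
  define f where "f z = (herm j z :: complex)" for z
  define f' where "f' z = 2 * of_nat j * (herm (j - 1) z :: complex)" for z
  define g where "g z = (herm k z :: complex)" for z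
  define g' where "g' z = 2 * of_nat k * (herm (k - 1) z :: complex)" for z
  define p where "p z = f z * cnj (g z)" for z
  define u where "u z = f' z * cnj (g z)" for z
  define v where "v z = f z * cnj (g' z)" for z
  have cont: "continuous_on UNIV p" "continuous_on UNIV u" "continuous_on UNIV v"
    unfolding p_def u_def v_def f_def f'_def g_def g'_def by (intro continuous_intros)+
  have gr: "exp_growth p" "exp_growth u" "exp_growth v"
    unfolding p_def u_def v_def f_def f'_def g_def g'_def
    by (intro exp_growth_mult exp_growth_cnj exp_growth_herm exp_growth_const)+
  have fd: "(f has_field_derivative f' z) (at z)" "(g has_field_derivative g' z) (at z)" for z
    unfolding f_def[abs_def] f'_def g_def[abs_def] g'_def by (rule herm_has_field_derivative)+
  have Cx: "((\<lambda>x. Complex x y) has_vector_derivative 1) (at x)" for x y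
    unfolding Complex_eq by (auto intro!: derivative_eq_intros simp: has_vector_derivative_def scaleR_conv_of_real)
  have Cy: "((\<lambda>y. Complex x y) has_vector_derivative \<i>) (at y)" for x y
    unfolding Complex_eq by (auto intro!: derivative_eq_intros simp: has_vector_derivative_def scaleR_conv_of_real)
  have cd: "((\<lambda>x. cnj (h x)) has_vector_derivative cnj h') (at x)"
    if "(h has_vector_derivative h') (at x)" for h :: "real \<Rightarrow> complex" and h' x
    using bounded_linear.has_vector_derivative[OF bounded_linear_cnj that] .
  have px: "((\<lambda>x. p (Complex x y)) has_vector_derivative (u (Complex x y) + v (Complex x y))) (at x)" for x y
    unfolding p_def
    by (rule has_vector_derivative_eq_rhs[OF has_vector_derivative_mult[OF
          field_vector_diff_chain_at[OF Cx fd(1), unfolded o_def] cd[OF field_vector_diff_chain_at[OF Cx fd(2), unfolded o_def]]]])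
       (simp add: u_def v_def)
  have py: "((\<lambda>y. p (Complex x y)) has_vector_derivative (\<i> * u (Complex x y) - \<i> * v (Complex x y))) (at y)" for x y
    unfolding p_def
    by (rule has_vector_derivative_eq_rhs[OF has_vector_derivative_mult[OF
          field_vector_diff_chain_at[OF Cy fd(1), unfolded o_def] cd[OF field_vector_diff_chain_at[OF Cy fd(2), unfolded o_def]]]])
       (simp add: u_def v_def)
  have grxy: "exp_growth (\<lambda>z. u z + v z)" "exp_growth (\<lambda>z. \<i> * u z - \<i> * v z)"
    by (intro exp_growth_add exp_growth_diff exp_growth_mult exp_growth_const gr)+
  have contxy: "continuous_on UNIV (\<lambda>z. u z + v z)" "continuous_on UNIV (\<lambda>z. \<i> * u z - \<i> * v z)"
    by (intro continuous_intros cont)+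
  note parts = gauss2_by_parts[OF AB, of p "\<lambda>z. u z + v z" "\<lambda>z. \<i> * u z - \<i> * v z", OF px py cont(1) contxy gr(1) grxy]
  have meas[measurable]: "p \<in> borel_measurable borel" "u \<in> borel_measurable borel" "v \<in> borel_measurable borel"
    using cont by (auto intro: borel_measurable_continuous_onI)
  have growth_Re: "exp_growth (\<lambda>z. of_real (Re z))" and growth_Im: "exp_growth (\<lambda>z. of_real (Im z))"
  proof -
    have "cmod (of_real (Re z)) \<le> 1 * exp (1 * cmod z)" "cmod (of_real (Im z)) \<le> 1 * exp (1 * cmod z)" for z
      using order_trans[OF abs_Re_le_cmod[of z] real_le_exp] order_trans[OF abs_Im_le_cmod[of z] real_le_exp] by simp_all
    then show "exp_growth (\<lambda>z. of_real (Re z))" "exp_growth (\<lambda>z. of_real (Im z))"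
      unfolding exp_growth_def by (meson zero_le_one)+
  qed
  define X where "X z = (u z + v z - 2 * of_real A * of_real (Re z) * p z) * of_real (gauss2 A B z)" for z
  define Y where "Y z = (\<i> * u z - \<i> * v z - 2 * of_real B * of_real (Im z) * p z) * of_real (gauss2 A B z)" for z
  have iX: "integrable lborel X" unfolding X_def
    by (intro integrable_exp_growth_gauss2 AB exp_growth_diff exp_growth_add exp_growth_mult exp_growth_const growth_Re gr) measurable
  have iY: "integrable lborel Y" unfolding Y_def
    by (intro integrable_exp_growth_gauss2 AB exp_growth_diff exp_growth_add exp_growth_mult exp_growth_const growth_Im gr) measurable
  have iv: "integrable lborel (\<lambda>z. v z * of_real (gauss2 A B z))"
    by (intro integrable_exp_growth_gauss2 AB gr) measurable
  have ab: "of_real (1 / A) = (1 + complex_of_real \<kappa>) / 2" "of_real (1 / B) = (complex_of_real \<kappa> - 1) / 2"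
    by (simp_all add: A_def B_def)
  have A1: "of_real (1 / A) * complex_of_real A = 1" "of_real (1 / B) * complex_of_real B = 1"
    using AB by (simp_all flip: of_real_mult)
  have pt: "herm (Suc j) z * cnj (herm k z) * of_real (gauss2 A B z)
      = of_real \<kappa> * (v z * of_real (gauss2 A B z)) - (of_real (1 / A) * X z + \<i> * of_real (1 / B) * Y z)" for z
  proof -
    have hj: "herm (Suc j) z = 2 * z * f z - f' z" by (simp add: herm_Suc f_def f'_def)
    have hz: "of_real (Re z) + \<i> * of_real (Im z) = z" by (rule complex_eq[symmetric])
    have l: "herm (Suc j) z * cnj (herm k z) = 2 * (of_real (Re z) + \<i> * of_real (Im z)) * p z - u z"
      unfolding hz hj p_def u_def g_def by (simp add: algebra_simps)
    have "of_real (1 / A) * (u z + v z - 2 * of_real A * of_real (Re z) * p z)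
         + \<i> * of_real (1 / B) * (\<i> * u z - \<i> * v z - 2 * of_real B * of_real (Im z) * p z)
       = of_real (1 / A) * (u z + v z) - of_real (1 / B) * (u z - v z)
         - (of_real (1 / A) * complex_of_real A) * 2 * of_real (Re z) * p z - (of_real (1 / B) * complex_of_real B) * 2 * \<i> * of_real (Im z) * p z"
      by (simp add: algebra_simps)
    also have "\<dots> = u z + of_real \<kappa> * v z - 2 * of_real (Re z) * p z - 2 * \<i> * of_real (Im z) * p z"
      unfolding A1 unfolding ab by (simp add: field_simps)
    finally have eq: "herm (Suc j) z * cnj (herm k z) = of_real \<kappa> * v z -
       (of_real (1 / A) * (u z + v z - 2 * of_real A * of_real (Re z) * p z)
         + \<i> * of_real (1 / B) * (\<i> * u z - \<i> * v z - 2 * of_real B * of_real (Im z) * p z))"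
      unfolding l by (simp add: algebra_simps)
    show ?thesis unfolding X_def Y_def eq by (simp only: left_diff_distrib distrib_right mult.assoc)
  qed
  have "herm_plane_form \<kappa> (Suc j) k = (LINT z|lborel. of_real \<kappa> * (v z * of_real (gauss2 A B z)) - (of_real (1 / A) * X z + \<i> * of_real (1 / B) * Y z))"
    unfolding herm_plane_form_def A_def[symmetric] B_def[symmetric] pt ..
  also have "\<dots> = of_real \<kappa> * (LINT z|lborel. v z * of_real (gauss2 A B z)) - (of_real (1 / A) * (LINT z|lborel. X z) + \<i> * of_real (1 / B) * (LINT z|lborel. Y z))"
    using iX iY iv by (simp del: of_real_divide)
  also have "(LINT z|lborel. X z) = 0" using parts(1) by (simp add: X_def)
  also have "(LINT z|lborel. Y z) = 0" using parts(2) by (simp add: Y_def)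
  also have "(LINT z|lborel. v z * of_real (gauss2 A B z)) = 2 * of_nat k * herm_plane_form \<kappa> j (k - 1)"
    unfolding herm_plane_form_def A_def[symmetric] B_def[symmetric]
    by (subst integral_mult_right_zero[symmetric]) (simp add: v_def f_def g'_def mult_ac)
  finally show ?thesis by simp
qed

lemma herm_plane_orthogonal:
  assumes \<kappa>: "\<kappa> > 1"
  shows "herm_plane_form \<kappa> j k = (if j = k then of_real ((2 * \<kappa>) ^ k * fact k * (pi * sqrt (\<kappa>\<^sup>2 - 1) / 2)) else 0)"
proof -
  have sym: "herm_plane_form \<kappa> j k = cnj (herm_plane_form \<kappa> k j)" for j k
    unfolding herm_plane_form_def by (subst Bochner_Integration.integral_cnj[symmetric]) (simp add: mult_ac)
  have "herm_plane_form \<kappa> 0 0 = of_real (LINT z|lborel. gauss2 (2 / (1 + \<kappa>)) (2 / (\<kappa> - 1)) z)"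
    by (simp add: herm_plane_form_def)
  also have "(LINT z|lborel. gauss2 (2 / (1 + \<kappa>)) (2 / (\<kappa> - 1)) z) = pi / sqrt (2 / (1 + \<kappa>) * (2 / (\<kappa> - 1)))"
    using \<kappa> by (intro integrable_gauss2) auto
  also have "2 / (1 + \<kappa>) * (2 / (\<kappa> - 1)) = 4 / (\<kappa>\<^sup>2 - 1)"
    using \<kappa> by (simp add: field_simps power2_eq_square)
  also have "pi / sqrt (4 / (\<kappa>\<^sup>2 - 1)) = pi * sqrt (\<kappa>\<^sup>2 - 1) / 2"
    by (simp add: real_sqrt_divide)
  finally have 00: "herm_plane_form \<kappa> 0 0 = of_real (pi * sqrt (\<kappa>\<^sup>2 - 1) / 2)" .
  show ?thesis
    using adjoint_scheme[of "herm_plane_form \<kappa>" \<kappa>, OF herm_plane_rec[OF \<kappa>] sym, of j k] unfolding 00 by simp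
qed

lemma exp_growth_real:
  assumes "exp_growth f"
  shows "\<exists>C b. \<forall>x. cmod (f (of_real x)) \<le> C * exp (b * \<bar>x\<bar>)"
  using assms unfolding exp_growth_def by (metis norm_of_real)

lemma integrable_exp_growth_gauss:
  assumes a: "a > 0" and f: "exp_growth f" and fc: "continuous_on UNIV f"
  shows "integrable lborel (\<lambda>x::real. f (of_real x) * of_real (exp (- (a * x\<^sup>2))))"
proof -
  obtain C b where b: "\<And>x. cmod (f (of_real x)) \<le> C * exp (b * \<bar>x\<bar>)" using exp_growth_real[OF f] by blast
  show ?thesis
  proof (rule Bochner_Integration.integrable_bound)
    show "integrable lborel (\<lambda>x. C * exp (b * \<bar>x\<bar> - a * x\<^sup>2))"
      by (intro integrable_mult_right integrable_exp_gauss a)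
    have "continuous_on UNIV (\<lambda>x::real. f (of_real x) * of_real (exp (- (a * x\<^sup>2))))"
      by (intro continuous_intros continuous_on_compose2[OF fc]) auto
    then show "(\<lambda>x::real. f (of_real x) * of_real (exp (- (a * x\<^sup>2)))) \<in> borel_measurable lborel"
      by (simp add: borel_measurable_continuous_onI)
    show "AE x in lborel. norm (f (of_real x) * of_real (exp (- (a * x\<^sup>2)))) \<le> norm (C * exp (b * \<bar>x\<bar> - a * x\<^sup>2))"
    proof (rule AE_I2)
      fix x :: real
      have "norm (f (of_real x) * of_real (exp (- (a * x\<^sup>2)))) \<le> C * exp (b * \<bar>x\<bar>) * exp (- (a * x\<^sup>2))"
        unfolding norm_mult by (intro mult_mono b order_trans[OF norm_ge_zero b]) auto
      also have "\<dots> = C * exp (b * \<bar>x\<bar> - a * x\<^sup>2)" by (simp add: exp_diff exp_minus field_simps)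
      finally show "norm (f (of_real x) * of_real (exp (- (a * x\<^sup>2)))) \<le> norm (C * exp (b * \<bar>x\<bar> - a * x\<^sup>2))"
        by (rule order_trans) auto
    qed
  qed
qed

lemma integrable_herm_line:
  "integrable lborel (\<lambda>x::real. herm j (of_real x) * cnj (herm k (of_real x)) * complex_of_real (exp (- x\<^sup>2)))"
  using integrable_exp_growth_gauss[of 1 "\<lambda>z. herm j z * cnj (herm k z)"]
  by (simp add: exp_growth_mult exp_growth_cnj exp_growth_herm continuous_intros)

lemma gauss_by_parts_growth:
  fixes f f' :: "complex \<Rightarrow> complex"
  assumes a: "a > 0" and der: "\<And>z. (f has_field_derivative f' z) (at z)"
    and gr: "exp_growth f" "exp_growth f'" and cont: "continuous_on UNIV f'"
  shows "(LINT x|lborel. f' (of_real x) * of_real (exp (- (a * x\<^sup>2))))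
     = 2 * of_real a * (LINT x|lborel. of_real x * f (of_real x) * of_real (exp (- (a * x\<^sup>2))))"
proof -
  obtain C b where b: "\<And>x. cmod (f (of_real x)) \<le> C * exp (b * \<bar>x\<bar>)" using exp_growth_real[OF gr(1)] by blast
  obtain D d where d: "\<And>x. cmod (f' (of_real x)) \<le> D * exp (d * \<bar>x\<bar>)" using exp_growth_real[OF gr(2)] by blast
  have C: "0 \<le> C" "0 \<le> D" using order_trans[OF norm_ge_zero b[of 0]] order_trans[OF norm_ge_zero d[of 0]] by simp_all
  have up: "C' * exp (b' * \<bar>x\<bar>) \<le> max C D * exp (max b d * \<bar>x\<bar>)" if "0 \<le> C'" "C' \<le> max C D" "b' \<le> max b d" for C' b' x
    using that by (intro mult_mono) (auto intro: mult_right_mono)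
  have bd: "cmod (f (of_real x)) \<le> max C D * exp (max b d * \<bar>x\<bar>)" "cmod (f' (of_real x)) \<le> max C D * exp (max b d * \<bar>x\<bar>)" for x
    by (rule order_trans[OF b up] order_trans[OF d up]; use C in simp)+
  have contf: "continuous_on UNIV f" using der by (meson DERIV_isCont continuous_at_imp_continuous_on)
  have der': "((\<lambda>x. f (of_real x)) has_vector_derivative f' (of_real x)) (at x)" for x :: real
    using has_vector_derivative_real_field[OF der] by simp
  have c': "isCont (\<lambda>x::real. f' (of_real x)) x" for x
    using continuous_on_compose2[OF cont, of UNIV complex_of_real] by (auto simp: continuous_on_eq_continuous_at intro: continuous_intros)
  have 0: "(LINT x|lborel. (f' (of_real x) - 2 * of_real a * of_real x * f (of_real x)) * of_real (exp (- (a * x\<^sup>2)))) = 0"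
    by (rule gauss_by_parts[OF a der' c' bd])
  have i1: "integrable lborel (\<lambda>x. f' (of_real x) * of_real (exp (- (a * x\<^sup>2))))"
    by (intro integrable_exp_growth_gauss a gr cont)
  have i2: "integrable lborel (\<lambda>x. of_real x * f (of_real x) * of_real (exp (- (a * x\<^sup>2))))"
    using integrable_exp_growth_gauss[OF a exp_growth_mult[OF exp_growth_ident gr(1)]] contf by (simp add: continuous_intros)
  have "(LINT x|lborel. f' (of_real x) * of_real (exp (- (a * x\<^sup>2))) - 2 * of_real a * (of_real x * f (of_real x) * of_real (exp (- (a * x\<^sup>2))))) = 0"
    using 0 by (simp add: algebra_simps)
  then show ?thesis using i1 i2 by simp
qed

definition herm_line_form :: "nat \<Rightarrow> nat \<Rightarrow> complex" where
  "herm_line_form j k = (LINT x|lborel. herm j (of_real x) * cnj (herm k (of_real x)) * of_real (exp (- x\<^sup>2)))"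

text \<open>On the line the adjointness relation holds with \<open>\<kappa> = 1\<close>.\<close>

lemma herm_line_orthogonal:
  "herm_line_form j k = (if j = k then of_real (2 ^ k * fact k * sqrt pi) else 0)"
proof -
  have cr: "cnj (herm k (complex_of_real x)) = herm k (of_real x)" for k x by (simp add: herm_of_real)
  have rec: "herm_line_form (Suc j) k = of_real 1 * (2 * of_nat k * herm_line_form j (k - 1))" for j k
  proof -
    define f where "f z = herm j z * (herm k z :: complex)" for z
    define f' where "f' z = 2 * of_nat j * herm (j - 1) z * herm k z + herm j z * (2 * of_nat k * (herm (k - 1) z :: complex))" for z
    have d: "(f has_field_derivative f' z) (at z)" for z
      unfolding f_def[abs_def] f'_def by (auto intro!: derivative_eq_intros)
    have gr: "exp_growth f" "exp_growth f'" unfolding f_def f'_def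
      by (intro exp_growth_mult exp_growth_add exp_growth_herm exp_growth_const)+
    have c: "continuous_on UNIV f'" unfolding f'_def by (intro continuous_intros)
    have cf: "continuous_on UNIV f" unfolding f_def by (intro continuous_intros)
    have parts: "(LINT x|lborel. f' (of_real x) * of_real (exp (- x\<^sup>2)))
     = 2 * (LINT x|lborel. of_real x * f (of_real x) * of_real (exp (- x\<^sup>2)))"
      using gauss_by_parts_growth[OF zero_less_one d gr c] by simp
    have i2: "integrable lborel (\<lambda>x. of_real x * f (of_real x) * of_real (exp (- x\<^sup>2)))"
      using integrable_exp_growth_gauss[OF zero_less_one exp_growth_mult[OF exp_growth_ident gr(1)]] cf by (simp add: continuous_intros)
    have i3: "integrable lborel (\<lambda>x. herm (j - 1) (of_real x) * herm k (of_real x) * complex_of_real (exp (- x\<^sup>2)))"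
      "integrable lborel (\<lambda>x. herm j (of_real x) * herm (k - 1) (of_real x) * complex_of_real (exp (- x\<^sup>2)))"
      using integrable_herm_line[of "j - 1" k] integrable_herm_line[of j "k - 1"] by (simp_all add: cr)
    have "herm_line_form (Suc j) k = (LINT x|lborel. 2 * (of_real x * f (of_real x) * of_real (exp (- x\<^sup>2)))
       - 2 * of_nat j * (herm (j - 1) (of_real x) * herm k (of_real x) * complex_of_real (exp (- x\<^sup>2))))"
      unfolding herm_line_form_def cr by (simp add: herm_Suc f_def algebra_simps)
    also have "\<dots> = 2 * (LINT x|lborel. of_real x * f (of_real x) * of_real (exp (- x\<^sup>2)))
       - 2 * of_nat j * (LINT x|lborel. herm (j - 1) (of_real x) * herm k (of_real x) * complex_of_real (exp (- x\<^sup>2)))"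
      using i2 i3 by simp
    also have "2 * (LINT x|lborel. of_real x * f (of_real x) * of_real (exp (- x\<^sup>2)))
       = (LINT x|lborel. 2 * of_nat j * (herm (j - 1) (of_real x) * herm k (of_real x) * complex_of_real (exp (- x\<^sup>2)))
         + 2 * of_nat k * (herm j (of_real x) * herm (k - 1) (of_real x) * complex_of_real (exp (- x\<^sup>2))))"
      unfolding parts[symmetric] by (simp add: f'_def algebra_simps)
    also have "\<dots> = 2 * of_nat j * (LINT x|lborel. herm (j - 1) (of_real x) * herm k (of_real x) * complex_of_real (exp (- x\<^sup>2)))
         + 2 * of_nat k * herm_line_form j (k - 1)"
      using i3 by (simp add: herm_line_form_def cr)
    finally show ?thesis by simp
  qed
  have sym: "herm_line_form j k = cnj (herm_line_form k j)" for j k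
    unfolding herm_line_form_def by (subst Bochner_Integration.integral_cnj[symmetric]) (simp add: mult_ac)
  have 00: "herm_line_form 0 0 = of_real (sqrt pi)"
    using integral_gauss[of 1] by (simp add: herm_line_form_def)
  show ?thesis
    using adjoint_scheme[of "herm_line_form" 1, OF rec sym, of j k] unfolding 00 by simp
qed

lemma
  shows integrable_hfunC_line: "integrable lborel (\<lambda>x. hfunC j (of_real x) * cnj (hfunC k (of_real x)))"
    and integral_hfunC_line: "(LINT x|lborel. hfunC j (of_real x) * cnj (hfunC k (of_real x))) = (if j = k then 1 else 0)"
proof -
  have eq: "hfunC j (of_real x) * cnj (hfunC k (of_real x)) = of_real (hconst j * hconst k) *
      (herm j (of_real x) * cnj (herm k (of_real x)) * of_real (exp (- x\<^sup>2)))" for x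
  proof -
    have "exp (- ((complex_of_real x)\<^sup>2 / 2)) * cnj (exp (- ((complex_of_real x)\<^sup>2 / 2))) = of_real (exp (- x\<^sup>2))"
    proof -
      have 1: "exp (- ((complex_of_real x)\<^sup>2 / 2)) = of_real (exp (- (x\<^sup>2 / 2)))"
        by (simp add: exp_of_real[symmetric])
      have 2: "exp (- (x\<^sup>2 / 2)) * exp (- (x\<^sup>2 / 2)) = exp (- x\<^sup>2)"
        by (simp flip: exp_add)
      show ?thesis unfolding 1 complex_cnj_complex_of_real of_real_mult[symmetric] 2 ..
    qed
    then show ?thesis unfolding hfunC_def by (simp add: mult_ac)
  qed
  show "integrable lborel (\<lambda>x. hfunC j (of_real x) * cnj (hfunC k (of_real x)))"
    unfolding eq by (intro integrable_mult_right integrable_herm_line)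
  have "(LINT x|lborel. hfunC j (of_real x) * cnj (hfunC k (of_real x))) = of_real (hconst j * hconst k) * herm_line_form j k"
    unfolding eq herm_line_form_def by simp
  moreover have "hconst k * hconst k * (2 ^ k * fact k * sqrt pi) = 1"
    using hconst_sq[of k] by (simp add: power2_eq_square)
  ultimately show "(LINT x|lborel. hfunC j (of_real x) * cnj (hfunC k (of_real x))) = (if j = k then 1 else 0)"
    by (auto simp: herm_line_orthogonal simp flip: of_real_mult)
qed

text \<open>The factor that a single complex coordinate contributes to \<^const>\<open>weight_U\<close>.\<close>

definition weight_u :: "real \<Rightarrow> complex \<Rightarrow> real" where
  "weight_u t z = 2 * sinh (4 * t) powr (- (1 / 2))
     * exp (- (cosh (2 * t) / sinh (2 * t)) * (Im z)\<^sup>2 + tanh (2 * t) * (Re z)\<^sup>2)"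

lemma weight_u_measurable[measurable]: "weight_u t \<in> borel_measurable borel"
  unfolding weight_u_def by measurable

text \<open>The weight turns \<open>\<bar>exp (- z\<^sup>2 / 2)\<bar>\<^sup>2\<close> into the anisotropic Gaussian for
  \<open>\<kappa> = exp (4 * t)\<close>.\<close>

lemma
  assumes t: "t > 0"
  shows integrable_hfunC_plane: "integrable lborel (\<lambda>z. hfunC j z * cnj (hfunC k z) * of_real (weight_u t z))"
    and integral_hfunC_plane: "(LINT z|lborel. hfunC j z * cnj (hfunC k z) * of_real (weight_u t z))
      = (if j = k then of_real (sqrt (2 * pi) * exp (2 * (2 * real k + 1) * t)) else 0)"
proof -
  define \<kappa> where "\<kappa> = exp (4 * t)"
  have \<kappa>: "\<kappa> > 1" using t by (simp add: \<kappa>_def)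
  define e where "e = exp (2 * t)"
  have e: "e > 1" "\<kappa> = e\<^sup>2" "exp (- (2 * t)) = 1 / e" using t
    by (auto simp: e_def \<kappa>_def power2_eq_square exp_minus field_simps simp flip: exp_add)
  have e2: "e * e > 1" using \<kappa> by (simp add: e(2) power2_eq_square)
  have sh: "sinh (2 * t) = (e - 1 / e) / 2" "cosh (2 * t) = (e + 1 / e) / 2"
    unfolding sinh_def cosh_def e(3) e_def[symmetric] by simp_all
  have sh': "sinh (2 * t) = (\<kappa> - 1) / (2 * e)" "cosh (2 * t) = (\<kappa> + 1) / (2 * e)"
    unfolding sh using e(1) by (simp_all add: e(2) field_simps power2_eq_square)
  have th: "tanh (2 * t) = 1 - 2 / (1 + \<kappa>)"
  proof -
    have nz: "1 + \<kappa> \<noteq> 0" "e \<noteq> 0" using \<kappa> e(1) by auto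
    have "tanh (2 * t) = (\<kappa> - 1) / (1 + \<kappa>)" unfolding tanh_def sh' using nz by (simp add: add.commute)
    also have "\<dots> = 1 - 2 / (1 + \<kappa>)" using nz by (simp add: field_simps)
    finally show ?thesis .
  qed
  have ct: "cosh (2 * t) / sinh (2 * t) = 1 + 2 / (\<kappa> - 1)"
    unfolding sh' using e(1) \<kappa> by (simp add: field_simps)
  have sh4: "sinh (4 * t) = (\<kappa>\<^sup>2 - 1) / (2 * \<kappa>)"
  proof -
    have "exp (4 * t) = \<kappa>" "exp (- (4 * t)) = 1 / \<kappa>" by (simp_all add: \<kappa>_def exp_minus inverse_eq_divide)
    then have "sinh (4 * t) = (\<kappa> - 1 / \<kappa>) / 2" unfolding sinh_def by simp
    then show ?thesis using \<kappa> by (simp add: field_simps power2_eq_square)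
  qed
  have sqc: "2 * sinh (4 * t) powr (- (1 / 2)) * (pi * sqrt (\<kappa>\<^sup>2 - 1) / 2) = pi * sqrt 2 * e"
  proof -
    have pos: "\<kappa>\<^sup>2 - 1 > 0" using \<kappa> by (simp add: one_less_power)
    have sp: "sinh (4 * t) > 0" using pos \<kappa> by (simp add: sh4)
    have "sinh (4 * t) powr (- (1 / 2)) = 1 / sqrt (sinh (4 * t))"
      using sp by (simp add: powr_minus powr_half_sqrt inverse_eq_divide)
    also have "\<dots> = sqrt (2 * \<kappa>) / sqrt (\<kappa>\<^sup>2 - 1)" by (simp add: sh4 real_sqrt_divide)
    finally have pw: "sinh (4 * t) powr (- (1 / 2)) = sqrt (2 * \<kappa>) / sqrt (\<kappa>\<^sup>2 - 1)" .
    have s2: "sqrt (2 * \<kappa>) = sqrt 2 * e" using e(1,2) by (simp add: real_sqrt_mult)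
    have "sqrt (\<kappa>\<^sup>2 - 1) > 0" using pos by simp
    then show ?thesis unfolding pw s2 by (simp add: field_simps)
  qed
  define c where "c = 2 * sinh (4 * t) powr (- (1 / 2))"
  have eq: "hfunC j z * cnj (hfunC k z) * of_real (weight_u t z) = of_real (hconst j * hconst k * c) *
      (herm j z * cnj (herm k z) * of_real (gauss2 (2 / (1 + \<kappa>)) (2 / (\<kappa> - 1)) z))" for z
  proof -
    have "exp (- (z\<^sup>2 / 2)) * cnj (exp (- (z\<^sup>2 / 2))) = of_real (exp (- ((Re z)\<^sup>2 - (Im z)\<^sup>2)))"
    proof -
      have "exp (- (z\<^sup>2 / 2)) * cnj (exp (- (z\<^sup>2 / 2))) = of_real ((cmod (exp (- (z\<^sup>2 / 2))))\<^sup>2)"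
        by (rule complex_norm_square[symmetric])
      also have "(cmod (exp (- (z\<^sup>2 / 2))))\<^sup>2 = exp (2 * Re (- (z\<^sup>2 / 2)))"
        by (simp only: norm_exp_eq_Re exp_double)
      also have "2 * Re (- (z\<^sup>2 / 2)) = - ((Re z)\<^sup>2 - (Im z)\<^sup>2)"
        by (simp add: power2_eq_square field_simps)
      finally show ?thesis .
    qed
    moreover have "exp (- ((Re z)\<^sup>2 - (Im z)\<^sup>2)) * weight_u t z = c * gauss2 (2 / (1 + \<kappa>)) (2 / (\<kappa> - 1)) z"
      unfolding weight_u_def gauss2_def th ct c_def by (simp add: algebra_simps flip: exp_add)
    then have "of_real (exp (- ((Re z)\<^sup>2 - (Im z)\<^sup>2))) * complex_of_real (weight_u t z) = of_real c * of_real (gauss2 (2 / (1 + \<kappa>)) (2 / (\<kappa> - 1)) z)"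
      by (simp only: of_real_mult[symmetric])
    ultimately have "(exp (- (z\<^sup>2 / 2)) * cnj (exp (- (z\<^sup>2 / 2)))) * complex_of_real (weight_u t z) = of_real c * of_real (gauss2 (2 / (1 + \<kappa>)) (2 / (\<kappa> - 1)) z)"
      by simp
    moreover have "hfunC j z * cnj (hfunC k z) * of_real (weight_u t z) = of_real (hconst j * hconst k) * herm j z * cnj (herm k z) *
       ((exp (- (z\<^sup>2 / 2)) * cnj (exp (- (z\<^sup>2 / 2)))) * complex_of_real (weight_u t z))"
      unfolding hfunC_def by (simp add: mult_ac)
    ultimately show ?thesis by (simp add: mult_ac)
  qed
  show "integrable lborel (\<lambda>z. hfunC j z * cnj (hfunC k z) * of_real (weight_u t z))"
    unfolding eq
  proof (intro integrable_mult_right integrable_exp_growth_gauss2 exp_growth_mult exp_growth_cnj exp_growth_herm)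
    have "continuous_on UNIV (\<lambda>z::complex. herm j z * cnj (herm k z))" by (intro continuous_intros)
    then show "(\<lambda>z. herm j z * cnj (herm k z)) \<in> borel_measurable borel" by (rule borel_measurable_continuous_onI)
  qed (use \<kappa> in auto)
  have "(LINT z|lborel. hfunC j z * cnj (hfunC k z) * of_real (weight_u t z)) = of_real (hconst j * hconst k * c) * herm_plane_form \<kappa> j k"
    unfolding eq herm_plane_form_def by simp
  also have "\<dots> = (if j = k then of_real ((hconst k)\<^sup>2 * (2 * \<kappa>) ^ k * fact k * (c * (pi * sqrt (\<kappa>\<^sup>2 - 1) / 2))) else 0)"
    by (auto simp: herm_plane_orthogonal[OF \<kappa>] power2_eq_square)
  also have "(hconst k)\<^sup>2 * (2 * \<kappa>) ^ k * fact k * (c * (pi * sqrt (\<kappa>\<^sup>2 - 1) / 2)) = \<kappa> ^ k / sqrt pi * (pi * sqrt 2 * e)"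
    unfolding c_def sqc hconst_sq by (simp add: power_mult_distrib)
  also have "\<dots> = sqrt (2 * pi) * (\<kappa> ^ k * e)"
    by (simp add: real_sqrt_mult field_simps)
  also have "\<kappa> ^ k * e = exp (2 * (2 * real k + 1) * t)"
    by (simp add: \<kappa>_def e_def algebra_simps flip: exp_add exp_of_nat_mult)
  finally show "(LINT z|lborel. hfunC j z * cnj (hfunC k z) * of_real (weight_u t z))
      = (if j = k then of_real (sqrt (2 * pi) * exp (2 * (2 * real k + 1) * t)) else 0)" .
qed

section \<open>Mehler's formula\<close>

lemma deriv_herm_generating:
  "(deriv ^^ k) (\<lambda>s. exp (2 * s * z - s\<^sup>2)) = (\<lambda>s::complex. herm k (z - s) * exp (2 * s * z - s\<^sup>2))"
proof (induction k)
  case (Suc k)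
  have "((\<lambda>s. herm k (z - s) * exp (2 * s * z - s\<^sup>2)) has_field_derivative herm (Suc k) (z - s) * exp (2 * s * z - s\<^sup>2)) (at s)" for s :: complex
    by (auto intro!: derivative_eq_intros simp: herm_Suc[of k] algebra_simps)
  then show ?case by (auto simp: Suc fun_eq_iff intro!: DERIV_imp_deriv)
qed simp

text \<open>The Taylor series in \<open>s\<close>, at the origin, of an entire function.\<close>

lemma herm_generating: "(\<lambda>k. herm k z * s ^ k / fact k) sums exp (2 * s * z - s\<^sup>2)" for z s :: complex
proof -
  have "(\<lambda>n. (deriv ^^ n) (\<lambda>s. exp (2 * s * z - s\<^sup>2)) 0 / fact n * (s - 0) ^ n) sums exp (2 * s * z - s\<^sup>2)"
    by (rule holomorphic_power_series[where r="cmod s + 1"]) (auto intro!: holomorphic_intros)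
  then show ?thesis by (simp add: deriv_herm_generating)
qed

text \<open>The Hermite polynomials with all coefficients replaced by their absolute values. They majorise the
Hermite polynomials, and since \<open>herm_abs k r = (- \<i>) ^ k * herm k (\<i> * r)\<close> their generating function
is known as well.\<close>

fun herm_abs :: "nat \<Rightarrow> real \<Rightarrow> real" where
  "herm_abs 0 r = 1"
| "herm_abs (Suc 0) r = 2 * r"
| "herm_abs (Suc (Suc n)) r = 2 * r * herm_abs (Suc n) r + 2 * of_nat (Suc n) * herm_abs n r"

lemma herm_abs_eq: "complex_of_real (herm_abs k r) = (- \<i>) ^ k * herm k (\<i> * of_real r)"
proof (induction k rule: induct_nat_012)
  case (ge2 n)
  have "complex_of_real (herm_abs (Suc (Suc n)) r) = 2 * of_real r * of_real (herm_abs (Suc n) r) + 2 * of_nat (Suc n) * of_real (herm_abs n r)"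
    by simp
  also have "\<dots> = (- \<i>) ^ Suc (Suc n) * herm (Suc (Suc n)) (\<i> * of_real r)"
    unfolding ge2 by (simp add: algebra_simps)
  finally show ?case .
qed auto

lemma norm_herm_le: "cmod (herm k z) \<le> herm_abs k (cmod z)"
proof (induction k rule: induct_nat_012)
  case (ge2 n)
  have "cmod (herm (Suc (Suc n)) z) \<le> cmod (2 * z * herm (Suc n) z) + cmod (2 * of_nat (Suc n) * herm n z)"
    unfolding herm.simps by (rule norm_triangle_ineq4)
  also have "\<dots> = 2 * cmod z * cmod (herm (Suc n) z) + 2 * of_nat (Suc n) * cmod (herm n z)"
    by (simp only: norm_mult norm_of_nat norm_numeral)
  also have "\<dots> \<le> herm_abs (Suc (Suc n)) (cmod z)"
    unfolding herm_abs.simps by (intro add_mono mult_left_mono ge2) auto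
  finally show ?case .
qed (auto simp: norm_mult)

lemma herm_abs_nonneg: "0 \<le> r \<Longrightarrow> 0 \<le> herm_abs k r"
  using norm_herm_le[of k "of_real r"] by (metis abs_of_nonneg norm_ge_zero norm_of_real order_trans)

lemma herm_abs_generating: "(\<lambda>k. herm_abs k r * s ^ k / fact k) sums exp (2 * s * r + s\<^sup>2)"
proof -
  have "(\<lambda>k. herm k (\<i> * of_real r) * (- \<i> * of_real s) ^ k / fact k) sums exp (2 * (- \<i> * of_real s) * (\<i> * of_real r) - (- \<i> * of_real s)\<^sup>2)"
    by (rule herm_generating)
  moreover have "herm k (\<i> * of_real r) * (- \<i> * of_real s) ^ k / fact k = complex_of_real (herm_abs k r * s ^ k / fact k)" for k
  proof -
    have "complex_of_real (herm_abs k r * s ^ k / fact k) = complex_of_real (herm_abs k r) * of_real s ^ k / fact k" by simp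
    moreover have "(- \<i> * complex_of_real s) ^ k = (- \<i>) ^ k * of_real s ^ k" by (rule power_mult_distrib)
    ultimately show ?thesis unfolding herm_abs_eq by (simp only: mult_ac)
  qed
  moreover have "exp (2 * (- \<i> * of_real s) * (\<i> * of_real r) - (- \<i> * of_real s)\<^sup>2) = complex_of_real (exp (2 * s * r + s\<^sup>2))"
    by (simp add: exp_of_real[symmetric] power_mult_distrib algebra_simps)
  ultimately have "(\<lambda>k. complex_of_real (herm_abs k r * s ^ k / fact k)) sums complex_of_real (exp (2 * s * r + s\<^sup>2))"
    by simp
  then show ?thesis by (simp only: sums_of_real_iff)
qed

lemma exp_growth_affine_power: "exp_growth (\<lambda>z. (y + \<i> * z) ^ k)"
proof (induction k)
  case (Suc k)
  show ?case unfolding power_Suc by (intro exp_growth_mult exp_growth_add exp_growth_const exp_growth_ident Suc)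
qed (simp add: exp_growth_const)

lemma integrable_power_gauss: "integrable lborel (\<lambda>u. (y + \<i> * of_real u) ^ k * complex_of_real (exp (- u\<^sup>2)))"
proof -
  show ?thesis
    using integrable_exp_growth_gauss[OF zero_less_one exp_growth_affine_power] by (simp add: continuous_intros)
qed

text \<open>Integration by parts shows that the integrals satisfy the three-term recursion.\<close>

lemma herm_integral:
  "of_real (2 ^ k / sqrt pi) * (LINT u|lborel. (y + \<i> * of_real u) ^ k * of_real (exp (- u\<^sup>2))) = herm k y"
proof -
  define I where "I k = (LINT u|lborel. (y + \<i> * of_real u) ^ k * complex_of_real (exp (- u\<^sup>2)))" for k
  note gr = exp_growth_affine_power[of y]
  have rec: "I (Suc k) = y * I k - of_nat k / 2 * I (k - 1)" for k
  proof -
    have parts: "(LINT u|lborel. of_nat k * (\<i> * (y + \<i> * of_real u) ^ (k - 1)) * of_real (exp (- (1 * u\<^sup>2))))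
      = 2 * of_real 1 * (LINT u|lborel. of_real u * (y + \<i> * of_real u) ^ k * complex_of_real (exp (- (1 * u\<^sup>2))))"
      by (rule gauss_by_parts_growth[where f="\<lambda>z. (y + \<i> * z) ^ k"])
         (auto intro!: derivative_eq_intros gr exp_growth_mult exp_growth_const continuous_intros)
    have i2: "integrable lborel (\<lambda>u. of_real u * (y + \<i> * of_real u) ^ k * complex_of_real (exp (- u\<^sup>2)))"
      using integrable_exp_growth_gauss[OF zero_less_one exp_growth_mult[OF exp_growth_ident gr]] by (simp add: continuous_intros)
    have "I (Suc k) = (LINT u|lborel. y * ((y + \<i> * of_real u) ^ k * complex_of_real (exp (- u\<^sup>2)))
       + \<i> * (of_real u * (y + \<i> * of_real u) ^ k * complex_of_real (exp (- u\<^sup>2))))"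
      unfolding I_def by (simp add: algebra_simps)
    also have "\<dots> = y * I k + \<i> * (LINT u|lborel. of_real u * (y + \<i> * of_real u) ^ k * complex_of_real (exp (- u\<^sup>2)))"
      unfolding I_def by (subst Bochner_Integration.integral_add) (use i2 in \<open>auto intro: integrable_power_gauss\<close>)
    also have "(LINT u|lborel. of_real u * (y + \<i> * of_real u) ^ k * complex_of_real (exp (- u\<^sup>2)))
       = of_nat k * \<i> / 2 * I (k - 1)"
    proof -
      have "(LINT u|lborel. of_nat k * (\<i> * (y + \<i> * of_real u) ^ (k - 1)) * complex_of_real (exp (- u\<^sup>2)))
        = of_nat k * \<i> * I (k - 1)"
        unfolding I_def by (subst integral_mult_right_zero[symmetric]) (simp add: mult_ac)
      then show ?thesis using parts by simp
    qed
    also have "y * I k + \<i> * (of_nat k * \<i> / 2 * I (k - 1)) = y * I k + (\<i> * \<i>) * (of_nat k / 2 * I (k - 1))"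
      by (simp only: times_divide_eq_left times_divide_eq_right mult_ac)
    finally show ?thesis by simp
  qed
  have I0: "I 0 = of_real (sqrt pi)" unfolding I_def using integral_gauss[of 1] by simp
  have "of_real (2 ^ k / sqrt pi) * I k = herm k y"
  proof (induction k rule: induct_nat_012)
    case 0 show ?case by (simp add: I0)
  next
    case 1 show ?case by (simp add: rec I0)
  next
    case (ge2 n)
    have "of_real (2 ^ Suc (Suc n) / sqrt pi) * I (Suc (Suc n))
      = 2 * y * (of_real (2 ^ Suc n / sqrt pi) * I (Suc n)) - 2 * of_nat (Suc n) * (of_real (2 ^ n / sqrt pi) * I n)"
      by (simp add: rec[of "Suc n"] field_simps)
    then show ?case unfolding ge2 by simp
  qed
  then show ?thesis by (simp add: I_def)
qed

text \<open>Mehler's kernel in one variable, in closed form; \<open>mehler_sums\<close> is its Hermite expansion.\<close>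

definition mehler :: "real \<Rightarrow> complex \<Rightarrow> complex \<Rightarrow> complex" where
  "mehler \<rho> x y = of_real (1 / sqrt (pi * (1 - \<rho>\<^sup>2))) *
     exp (- (of_real ((1 + \<rho>\<^sup>2) / (2 * (1 - \<rho>\<^sup>2))) * (x\<^sup>2 + y\<^sup>2)) + of_real (2 * \<rho> / (1 - \<rho>\<^sup>2)) * x * y)"

text \<open>Inserting the integral representation of \<open>herm k y\<close> makes the series in \<open>k\<close>, under the integral, an
instance of the generating function of the \<open>herm k x\<close>. What is left is a Gaussian integral whose
quadratic coefficient is \<open>1 - \<rho>\<^sup>2\<close>.\<close>

lemma mehler_herm:
  fixes x y :: complex
  assumes \<rho>: "0 \<le> \<rho>" "\<rho> < 1"
  defines "term \<equiv> \<lambda>k. of_real (\<rho> ^ k / (2 ^ k * fact k)) * herm k x * herm k y"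
  shows "summable (\<lambda>k. cmod (term k))"
    and "term sums (of_real (1 / sqrt (1 - \<rho>\<^sup>2)) * exp ((2 * of_real \<rho> * x * y - of_real (\<rho>\<^sup>2) * (x\<^sup>2 + y\<^sup>2)) / of_real (1 - \<rho>\<^sup>2)))"
proof -
  have \<rho>2: "1 - \<rho>\<^sup>2 > 0" using \<rho> by (simp add: abs_square_less_1)
  define s where "s u = of_real \<rho> * (y + \<i> * of_real u)" for u :: real
  define g where "g k u = of_real (1 / sqrt pi) * (herm k x * s u ^ k / fact k) * complex_of_real (exp (- u\<^sup>2))" for k u
  have g_eq: "g k u = of_real (1 / sqrt pi) * herm k x * of_real \<rho> ^ k / fact k * ((y + \<i> * of_real u) ^ k * complex_of_real (exp (- u\<^sup>2)))" for k u
    by (simp add: g_def s_def power_mult_distrib mult_ac)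
  have int_g: "integrable lborel (g k)" for k
    unfolding g_eq by (intro integrable_mult_right integrable_power_gauss)
  have lint_g: "(LINT u|lborel. g k u) = term k" for k
  proof -
    have "term k = of_real (\<rho> ^ k / (2 ^ k * fact k)) * herm k x * (of_real (2 ^ k / sqrt pi) * (LINT u|lborel. (y + \<i> * of_real u) ^ k * of_real (exp (- u\<^sup>2))))"
      unfolding herm_integral by (simp add: term_def)
    also have "\<dots> = of_real (1 / sqrt pi) * herm k x * of_real \<rho> ^ k / fact k * (LINT u|lborel. (y + \<i> * of_real u) ^ k * of_real (exp (- u\<^sup>2)))"
      by (simp add: field_simps)
    also have "\<dots> = (LINT u|lborel. g k u)"
      unfolding g_eq by simp
    finally show ?thesis ..
  qed
  \<comment> \<open>a majorant of the series of absolute values, which justifies the interchange of sum and integral\<close>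
  define G where "G u = (1 / sqrt pi) * exp (2 * cmod (s u) * cmod x + (cmod (s u))\<^sup>2) * exp (- u\<^sup>2)" for u
  define N where "N k u = (1 / sqrt pi) * (herm_abs k (cmod x) * cmod (s u) ^ k / fact k) * exp (- u\<^sup>2)" for k u
  have N: "(\<lambda>k. N k u) sums G u" for u
    unfolding N_def G_def by (intro sums_mult sums_mult2 herm_abs_generating)
  have N0: "0 \<le> N k u" for k u unfolding N_def by (simp add: herm_abs_nonneg)
  have gN: "cmod (g k u) \<le> N k u" for k u
    unfolding g_def N_def
    by (simp add: norm_mult norm_divide norm_power norm_herm_le divide_right_mono mult_right_mono)
  have int_G: "integrable lborel G"
  proof (rule Bochner_Integration.integrable_bound)
    define C where "C = (1 / sqrt pi) * exp (2 * \<rho> * cmod y * cmod x + \<rho>\<^sup>2 * (cmod y)\<^sup>2)"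
    define b where "b = 2 * \<rho> * cmod x + 2 * \<rho>\<^sup>2 * cmod y"
    \<comment> \<open>the term \<open>\<bar>s u\<bar>\<^sup>2\<close> of the exponent uses up only the part \<open>\<rho>\<^sup>2 * u\<^sup>2\<close> of the Gaussian\<close>
    show "integrable lborel (\<lambda>u. C * exp (b * \<bar>u\<bar> - (1 - \<rho>\<^sup>2) * u\<^sup>2))"
      by (intro integrable_mult_right integrable_exp_gauss \<rho>2)
    have "continuous_on UNIV G" unfolding G_def s_def by (intro continuous_intros)
    then show "G \<in> borel_measurable lborel" by (simp add: borel_measurable_continuous_onI)
    show "AE u in lborel. norm (G u) \<le> norm (C * exp (b * \<bar>u\<bar> - (1 - \<rho>\<^sup>2) * u\<^sup>2))"
    proof (rule AE_I2)
      fix u :: real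
      have l: "cmod (s u) \<le> \<rho> * (cmod y + \<bar>u\<bar>)"
      proof -
        have "cmod (s u) = \<rho> * cmod (y + \<i> * of_real u)" using \<rho> by (simp add: s_def norm_mult)
        also have "\<dots> \<le> \<rho> * (cmod y + \<bar>u\<bar>)"
          using \<rho> norm_triangle_ineq[of y "\<i> * of_real u"] by (intro mult_left_mono) (auto simp: norm_mult)
        finally show ?thesis .
      qed
      have "2 * cmod (s u) * cmod x + (cmod (s u))\<^sup>2 \<le> 2 * (\<rho> * (cmod y + \<bar>u\<bar>)) * cmod x + (\<rho> * (cmod y + \<bar>u\<bar>))\<^sup>2"
        using l by (intro add_mono mult_right_mono mult_left_mono power_mono) auto
      also have "\<dots> = (2 * \<rho> * cmod y * cmod x + \<rho>\<^sup>2 * (cmod y)\<^sup>2) + (b * \<bar>u\<bar> + \<rho>\<^sup>2 * u\<^sup>2)"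
        unfolding b_def by (simp add: power2_eq_square algebra_simps)
      finally have le: "2 * cmod (s u) * cmod x + (cmod (s u))\<^sup>2 - u\<^sup>2 \<le> (2 * \<rho> * cmod y * cmod x + \<rho>\<^sup>2 * (cmod y)\<^sup>2) + (b * \<bar>u\<bar> - (1 - \<rho>\<^sup>2) * u\<^sup>2)"
        by (simp add: algebra_simps)
      have "G u = (1 / sqrt pi) * exp (2 * cmod (s u) * cmod x + (cmod (s u))\<^sup>2 - u\<^sup>2)"
        unfolding G_def by (simp add: exp_diff exp_minus field_simps)
      also have "\<dots> \<le> (1 / sqrt pi) * exp ((2 * \<rho> * cmod y * cmod x + \<rho>\<^sup>2 * (cmod y)\<^sup>2) + (b * \<bar>u\<bar> - (1 - \<rho>\<^sup>2) * u\<^sup>2))"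
        using le by (intro mult_left_mono) auto
      also have "\<dots> = C * exp (b * \<bar>u\<bar> - (1 - \<rho>\<^sup>2) * u\<^sup>2)" unfolding C_def exp_add by simp
      finally have "G u \<le> C * exp (b * \<bar>u\<bar> - (1 - \<rho>\<^sup>2) * u\<^sup>2)" .
      moreover have "0 \<le> G u" by (simp add: G_def)
      ultimately show "norm (G u) \<le> norm (C * exp (b * \<bar>u\<bar> - (1 - \<rho>\<^sup>2) * u\<^sup>2))" by simp
    qed
  qed
  have summ_norm: "summable (\<lambda>k. LINT u|lborel. cmod (g k u))"
  proof (rule summableI_nonneg_bounded)
    fix n
    have "(\<Sum>k<n. LINT u|lborel. cmod (g k u)) = (LINT u|lborel. (\<Sum>k<n. cmod (g k u)))"
      by (rule Bochner_Integration.integral_sum[symmetric]) (use int_g in auto)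
    also have "\<dots> \<le> (LINT u|lborel. G u)"
    proof (rule integral_mono)
      show "integrable lborel (\<lambda>u. \<Sum>k<n. cmod (g k u))" using int_g by auto
      fix u
      have "(\<Sum>k<n. cmod (g k u)) \<le> (\<Sum>k<n. N k u)" by (intro sum_mono gN)
      also have "\<dots> \<le> (\<Sum>k. N k u)" using N by (intro sum_le_suminf) (auto simp: sums_iff N0)
      finally show "(\<Sum>k<n. cmod (g k u)) \<le> G u" using N by (simp add: sums_iff)
    qed (rule int_G)
    finally show "(\<Sum>k<n. LINT u|lborel. cmod (g k u)) \<le> (LINT u|lborel. G u)" .
  qed auto
  show "summable (\<lambda>k. cmod (term k))"
    by (rule summable_comparison_test_ev[OF _ summ_norm]) (simp add: lint_g[symmetric])
  have "(\<lambda>k. LINT u|lborel. g k u) sums (LINT u|lborel. (\<Sum>k. g k u))"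
  proof (rule sums_integral)
    show "AE u in lborel. summable (\<lambda>k. norm (g k u))"
    proof (rule AE_I2)
      fix u show "summable (\<lambda>k. norm (g k u))"
        by (rule summable_comparison_test_ev[OF _ sums_summable[OF N[of u]]]) (simp add: gN)
    qed
  qed (use int_g summ_norm in auto)
  moreover have "(\<Sum>k. g k u) = of_real (1 / sqrt pi) * exp (2 * of_real \<rho> * x * y - of_real (\<rho>\<^sup>2) * y\<^sup>2) *
      exp (- (of_real (1 - \<rho>\<^sup>2) * of_real u ^ 2) + (2 * \<i> * of_real \<rho> * (x - of_real \<rho> * y)) * of_real u)" for u
  proof -
    have "(\<lambda>k. g k u) sums (of_real (1 / sqrt pi) * exp (2 * s u * x - (s u)\<^sup>2) * of_real (exp (- u\<^sup>2)))"
      unfolding g_def by (intro sums_mult sums_mult2 herm_generating)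
    then have "(\<Sum>k. g k u) = of_real (1 / sqrt pi) * (exp (2 * s u * x - (s u)\<^sup>2) * exp (- (of_real u ^ 2)))"
      by (simp add: sums_iff exp_of_real[symmetric])
    also have "exp (2 * s u * x - (s u)\<^sup>2) * exp (- (of_real u ^ 2)) = exp (2 * s u * x - (s u)\<^sup>2 - of_real u ^ 2)"
      by (simp flip: exp_add)
    also have "2 * s u * x - (s u)\<^sup>2 - of_real u ^ 2 = (2 * of_real \<rho> * x * y - of_real (\<rho>\<^sup>2) * y\<^sup>2)
       + (- (of_real (1 - \<rho>\<^sup>2) * of_real u ^ 2) + (2 * \<i> * of_real \<rho> * (x - of_real \<rho> * y)) * of_real u)"
      unfolding s_def by (simp add: power2_eq_square algebra_simps)
    finally show ?thesis unfolding exp_add by simp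
  qed
  ultimately have "term sums (LINT u|lborel. of_real (1 / sqrt pi) * exp (2 * of_real \<rho> * x * y - of_real (\<rho>\<^sup>2) * y\<^sup>2) *
      exp (- (of_real (1 - \<rho>\<^sup>2) * of_real u ^ 2) + (2 * \<i> * of_real \<rho> * (x - of_real \<rho> * y)) * of_real u))"
    by (simp add: lint_g)
  also have "(LINT u|lborel. of_real (1 / sqrt pi) * exp (2 * of_real \<rho> * x * y - of_real (\<rho>\<^sup>2) * y\<^sup>2) *
      exp (- (of_real (1 - \<rho>\<^sup>2) * of_real u ^ 2) + (2 * \<i> * of_real \<rho> * (x - of_real \<rho> * y)) * of_real u))
    = of_real (1 / sqrt pi) * exp (2 * of_real \<rho> * x * y - of_real (\<rho>\<^sup>2) * y\<^sup>2) *
       (of_real (sqrt (pi / (1 - \<rho>\<^sup>2))) * exp ((2 * \<i> * of_real \<rho> * (x - of_real \<rho> * y))\<^sup>2 / (4 * of_real (1 - \<rho>\<^sup>2))))"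
    by (subst integral_mult_right_zero) (simp only: integral_gauss_complex[OF \<rho>2])
  also have "\<dots> = of_real (1 / sqrt pi * sqrt (pi / (1 - \<rho>\<^sup>2))) *
       exp (2 * of_real \<rho> * x * y - of_real (\<rho>\<^sup>2) * y\<^sup>2 + (2 * \<i> * of_real \<rho> * (x - of_real \<rho> * y))\<^sup>2 / (4 * of_real (1 - \<rho>\<^sup>2)))"
    unfolding exp_add of_real_mult by (simp only: mult_ac)
  also have "1 / sqrt pi * sqrt (pi / (1 - \<rho>\<^sup>2)) = 1 / sqrt (1 - \<rho>\<^sup>2)"
    by (simp add: real_sqrt_divide)
  also have "2 * of_real \<rho> * x * y - of_real (\<rho>\<^sup>2) * y\<^sup>2 + (2 * \<i> * of_real \<rho> * (x - of_real \<rho> * y))\<^sup>2 / (4 * of_real (1 - \<rho>\<^sup>2))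
     = (2 * of_real \<rho> * x * y - of_real (\<rho>\<^sup>2) * (x\<^sup>2 + y\<^sup>2)) / of_real (1 - \<rho>\<^sup>2)"
  proof -
    define d where "d = complex_of_real (1 - \<rho>\<^sup>2)"
    have "1 - \<rho>\<^sup>2 \<noteq> 0" using \<rho>2 by linarith
    then have d: "d \<noteq> 0" "d = 1 - of_real \<rho> * of_real \<rho>"
      unfolding d_def of_real_eq_0_iff by (auto simp: power2_eq_square)
    have "(2 * \<i> * of_real \<rho> * (x - of_real \<rho> * y))\<^sup>2 / (4 * d) = - ((of_real \<rho> * (x - of_real \<rho> * y))\<^sup>2) / d"
    proof -
      have "(2 * \<i> * of_real \<rho> * (x - of_real \<rho> * y))\<^sup>2 = (2 * \<i>)\<^sup>2 * (of_real \<rho> * (x - of_real \<rho> * y))\<^sup>2"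
        by (simp only: power_mult_distrib mult_ac)
      also have "(2 * \<i>)\<^sup>2 = - 4" by (simp add: power2_eq_square)
      finally have sq: "(2 * \<i> * of_real \<rho> * (x - of_real \<rho> * y))\<^sup>2 = - 4 * (of_real \<rho> * (x - of_real \<rho> * y))\<^sup>2" .
      show ?thesis unfolding sq using d(1) by simp
    qed
    moreover have "(2 * of_real \<rho> * x * y - of_real (\<rho>\<^sup>2) * y\<^sup>2) * d + - ((of_real \<rho> * (x - of_real \<rho> * y))\<^sup>2)
       = 2 * of_real \<rho> * x * y - of_real (\<rho>\<^sup>2) * (x\<^sup>2 + y\<^sup>2)"
      unfolding d(2) by (simp add: power2_eq_square algebra_simps)
    ultimately show ?thesis unfolding d_def[symmetric] using d(1) by (simp add: field_simps)
  qed
  finally show "term sums (of_real (1 / sqrt (1 - \<rho>\<^sup>2)) * exp ((2 * of_real \<rho> * x * y - of_real (\<rho>\<^sup>2) * (x\<^sup>2 + y\<^sup>2)) / of_real (1 - \<rho>\<^sup>2)))" .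
qed

lemma mehler_sums:
  fixes x y :: complex
  assumes \<rho>: "0 \<le> \<rho>" "\<rho> < 1"
  shows "summable (\<lambda>k. cmod (of_real (\<rho> ^ k) * hfunC k x * hfunC k y))"
    and "(\<lambda>k. of_real (\<rho> ^ k) * hfunC k x * hfunC k y) sums mehler \<rho> x y"
proof -
  have \<rho>2: "1 - \<rho>\<^sup>2 > 0" using \<rho> by (simp add: abs_square_less_1)
  define c where "c = of_real (1 / sqrt pi) * exp (- (x\<^sup>2 / 2)) * exp (- (y\<^sup>2 / 2))"
  have eq: "of_real (\<rho> ^ k) * hfunC k x * hfunC k y = c * (of_real (\<rho> ^ k / (2 ^ k * fact k)) * herm k x * herm k y)" for k
  proof -
    have "of_real (\<rho> ^ k) * hfunC k x * hfunC k y = of_real (\<rho> ^ k * (hconst k)\<^sup>2) * herm k x * herm k y * exp (- (x\<^sup>2 / 2)) * exp (- (y\<^sup>2 / 2))"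
      unfolding hfunC_def by (simp add: power2_eq_square mult_ac)
    also have "\<rho> ^ k * (hconst k)\<^sup>2 = 1 / sqrt pi * (\<rho> ^ k / (2 ^ k * fact k))" by (simp add: hconst_sq)
    finally show ?thesis unfolding c_def by (simp add: mult_ac)
  qed
  show "summable (\<lambda>k. cmod (of_real (\<rho> ^ k) * hfunC k x * hfunC k y))"
    unfolding eq norm_mult[of c] by (intro summable_mult mehler_herm(1) \<rho>)
  have "(\<lambda>k. of_real (\<rho> ^ k) * hfunC k x * hfunC k y) sums
     (c * (of_real (1 / sqrt (1 - \<rho>\<^sup>2)) * exp ((2 * of_real \<rho> * x * y - of_real (\<rho>\<^sup>2) * (x\<^sup>2 + y\<^sup>2)) / of_real (1 - \<rho>\<^sup>2))))"
    unfolding eq by (intro sums_mult mehler_herm(2) \<rho>)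
  also have "c * (of_real (1 / sqrt (1 - \<rho>\<^sup>2)) * exp ((2 * of_real \<rho> * x * y - of_real (\<rho>\<^sup>2) * (x\<^sup>2 + y\<^sup>2)) / of_real (1 - \<rho>\<^sup>2)))
     = of_real (1 / sqrt pi * (1 / sqrt (1 - \<rho>\<^sup>2))) * exp (- (x\<^sup>2 / 2) + - (y\<^sup>2 / 2) + (2 * of_real \<rho> * x * y - of_real (\<rho>\<^sup>2) * (x\<^sup>2 + y\<^sup>2)) / of_real (1 - \<rho>\<^sup>2))"
    unfolding c_def exp_add of_real_mult by (simp only: mult_ac)
  also have "1 / sqrt pi * (1 / sqrt (1 - \<rho>\<^sup>2)) = 1 / sqrt (pi * (1 - \<rho>\<^sup>2))" by (simp add: real_sqrt_mult)
  also have "- (x\<^sup>2 / 2) + - (y\<^sup>2 / 2) + (2 * of_real \<rho> * x * y - of_real (\<rho>\<^sup>2) * (x\<^sup>2 + y\<^sup>2)) / of_real (1 - \<rho>\<^sup>2)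
    = - (of_real ((1 + \<rho>\<^sup>2) / (2 * (1 - \<rho>\<^sup>2))) * (x\<^sup>2 + y\<^sup>2)) + of_real (2 * \<rho> / (1 - \<rho>\<^sup>2)) * x * y"
  proof -
    define d where "d = complex_of_real (1 - \<rho>\<^sup>2)"
    have "1 - \<rho>\<^sup>2 \<noteq> 0" using \<rho>2 by linarith
    then have d: "d \<noteq> 0" "of_real (\<rho>\<^sup>2) = 1 - d" unfolding d_def of_real_eq_0_iff by auto
    have 1: "of_real ((1 + \<rho>\<^sup>2) / (2 * (1 - \<rho>\<^sup>2))) = (2 - d) / (2 * d)" "of_real (2 * \<rho> / (1 - \<rho>\<^sup>2)) = 2 * of_real \<rho> / d"
      by (simp_all add: d_def)
    show ?thesis unfolding 1 d_def[symmetric] d(2) using d(1) by (simp add: field_simps)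
  qed
  finally show "(\<lambda>k. of_real (\<rho> ^ k) * hfunC k x * hfunC k y) sums mehler \<rho> x y"
    by (simp only: mehler_def)
qed

section \<open>Hermite functions of several variables\<close>

definition PhiC :: "('n::finite \<Rightarrow> nat) \<Rightarrow> complex^'n \<Rightarrow> complex" where
  "PhiC \<alpha> z = (\<Prod>j\<in>UNIV. hfunC (\<alpha> j) (z $ j))"

definition mdeg :: "('n::finite \<Rightarrow> nat) \<Rightarrow> nat" where
  "mdeg \<alpha> = (\<Sum>j\<in>UNIV. \<alpha> j)"

text \<open>The multi-indices of the eigenvalue \<open>2 * k + n\<close>.\<close>

definition level :: "nat \<Rightarrow> ('n::finite \<Rightarrow> nat) set" where
  "level k = {\<alpha>. mdeg \<alpha> = k}"

text \<open>The dimension \<open>n\<close> enters through the type argument.\<close>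

definition eigval :: "'n::finite itself \<Rightarrow> nat \<Rightarrow> real" where
  "eigval _ k = real (2 * k + CARD('n))"

definition gauss_measure :: "real \<Rightarrow> (complex^'n::finite) measure" where
  "gauss_measure t = density lborel (\<lambda>z. ennreal (weight_U t z))"

text \<open>The number \<open>(2 * \<pi>) powr (n / 2)\<close>, which is the ratio of the squares of the norms of the heat kernel
transform of \<open>f\<close> and of \<open>f\<close> (see \<open>weighted_norm2_heat_transform\<close>).\<close>

definition iso_const :: "'n::finite itself \<Rightarrow> real" where
  "iso_const _ = sqrt (2 * pi) ^ CARD('n)"

lemma iso_const_pos: "iso_const TYPE('n::finite) > 0"
  by (simp add: iso_const_def)

lemma eigval_ge_1: "1 \<le> eigval TYPE('n::finite) k"
proof -
  have "CARD('n) \<ge> 1" by (simp add: Suc_le_eq)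
  then have "1 \<le> real CARD('n)" by linarith
  moreover have "0 \<le> real k" by simp
  ultimately show ?thesis unfolding eigval_def of_nat_add of_nat_mult of_nat_numeral by linarith
qed

lemma mdeg_le: "\<alpha> j \<le> mdeg \<alpha>"
  unfolding mdeg_def by (rule member_le_sum) auto

lemma finite_mdeg_less: "finite {\<alpha> :: 'n::finite \<Rightarrow> nat. mdeg \<alpha> < N}"
proof (rule finite_subset)
  show "{\<alpha> :: 'n \<Rightarrow> nat. mdeg \<alpha> < N} \<subseteq> Pi\<^sub>E UNIV (\<lambda>_. {..<N})"
    by (auto simp: PiE_UNIV_domain intro: le_less_trans[OF mdeg_le])
qed (auto intro: finite_PiE)

lemma finite_level[simp]: "finite (level k)"
  by (rule finite_subset[OF _ finite_mdeg_less[of "Suc k"]]) (auto simp: level_def)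

lemma level_disjoint: "j \<noteq> k \<Longrightarrow> level j \<inter> level k = {}"
  by (auto simp: level_def)

lemma sum_levels: "(\<Sum>k<N. \<Sum>\<alpha>\<in>level k. f \<alpha>) = (\<Sum>\<alpha>\<in>{\<alpha>. mdeg \<alpha> < N}. f \<alpha>)"
proof -
  have eq: "{\<alpha>. mdeg \<alpha> < N} = (\<Union>k\<in>{..<N}. level k)" by (auto simp: level_def)
  show ?thesis unfolding eq by (subst sum.UNION_disjoint) (simp_all add: level_disjoint)
qed

text \<open>Sums over all multi-indices are unconditional, while the spectral decomposition is a series of levels;
summing over all levels below \<open>N\<close> is a cofinal way to exhaust the multi-indices.\<close>

lemma filterlim_mdeg_less:
  "filterlim (\<lambda>N. {\<alpha> :: 'n::finite \<Rightarrow> nat. mdeg \<alpha> < N}) (finite_subsets_at_top UNIV) sequentially"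
proof (subst filterlim_finite_subsets_at_top, intro allI impI)
  fix X :: "('n \<Rightarrow> nat) set" assume X: "finite X \<and> X \<subseteq> UNIV"
  show "\<forall>\<^sub>F N in sequentially. finite {\<alpha> :: 'n \<Rightarrow> nat. mdeg \<alpha> < N} \<and> X \<subseteq> {\<alpha>. mdeg \<alpha> < N} \<and> {\<alpha> :: 'n \<Rightarrow> nat. mdeg \<alpha> < N} \<subseteq> UNIV"
    unfolding eventually_sequentially
  proof (intro exI allI impI)
    fix N assume N: "Suc (Max (insert 0 (mdeg ` X))) \<le> N"
    have "mdeg \<alpha> < N" if "\<alpha> \<in> X" for \<alpha>
    proof -
      have "mdeg \<alpha> \<le> Max (insert 0 (mdeg ` X))" using X that by (intro Max_ge) auto
      then show ?thesis using N by simp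
    qed
    then show "finite {\<alpha> :: 'n \<Rightarrow> nat. mdeg \<alpha> < N} \<and> X \<subseteq> {\<alpha>. mdeg \<alpha> < N} \<and> {\<alpha> :: 'n \<Rightarrow> nat. mdeg \<alpha> < N} \<subseteq> UNIV"
      using finite_mdeg_less by auto
  qed
qed

lemma has_sum_imp_sums_levels:
  assumes "(f has_sum S) UNIV"
  shows "(\<lambda>k. \<Sum>\<alpha>\<in>level k. f \<alpha>) sums S"
proof -
  have "((\<lambda>N. sum f {\<alpha>. mdeg \<alpha> < N}) \<longlongrightarrow> S) sequentially"
    using assms unfolding has_sum_def by (rule filterlim_compose[OF _ filterlim_mdeg_less])
  then show ?thesis unfolding sums_def by (simp add: sum_levels)
qed

lemma hermite_Phi_eq: "hermite_Phi \<alpha> x = PhiC \<alpha> (complex_vec x)"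
  by (simp add: hermite_Phi_def PhiC_def complex_vec_def hfunC_of_real)

definition cnj_vec :: "complex^'n \<Rightarrow> complex^'n" where
  "cnj_vec z = (\<chi> j. cnj (z $ j))"

lemma PhiC_cnj: "PhiC \<alpha> (cnj_vec z) = cnj (PhiC \<alpha> z)"
  by (simp add: PhiC_def cnj_vec_def hfunC_cnj)

lemma continuous_on_PhiC: "continuous_on S (PhiC \<alpha>)"
  unfolding PhiC_def[abs_def] by (intro continuous_intros)

lemma continuous_on_complex_vec: "continuous_on S (complex_vec :: real^'n \<Rightarrow> complex^'n)"
  unfolding complex_vec_def[abs_def] by (intro continuous_intros)

lemma PhiC_measurable[measurable]: "PhiC \<alpha> \<in> borel_measurable borel"
  by (rule borel_measurable_continuous_onI[OF continuous_on_PhiC])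

lemma continuous_on_hermite_Phi: "continuous_on S (hermite_Phi \<alpha>)"
  unfolding hermite_Phi_eq[abs_def]
  by (rule continuous_on_compose2[OF continuous_on_PhiC[of UNIV] continuous_on_complex_vec]) auto

lemma hermite_Phi_measurable[measurable]: "hermite_Phi \<alpha> \<in> borel_measurable borel"
  by (rule borel_measurable_continuous_onI[OF continuous_on_hermite_Phi])

lemma weight_U_eq:
  fixes z :: "complex^'n"
  shows "weight_U t z = (\<Prod>j\<in>UNIV. weight_u t (z $ j))"
proof -
  have n1: "(norm (im_vec z))\<^sup>2 = (\<Sum>j\<in>UNIV. (Im (z $ j))\<^sup>2)" "(norm (re_vec z))\<^sup>2 = (\<Sum>j\<in>UNIV. (Re (z $ j))\<^sup>2)"
    by (simp_all add: norm_vec_def L2_set_def im_vec_def re_vec_def sum_nonneg)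
  have p: "(sinh (4 * t) powr (- (1 / 2))) ^ CARD('n) = sinh (4 * t) powr (- (real CARD('n) / 2))"
  proof (cases "t = 0")
    case False
    then show ?thesis by (subst powr_power) (simp_all add: mult.commute)
  qed simp
  have "(\<Prod>j\<in>UNIV. weight_u t (z $ j)) = (2 * sinh (4 * t) powr (- (1 / 2))) ^ CARD('n) *
     exp (\<Sum>j\<in>UNIV. - (cosh (2 * t) / sinh (2 * t)) * (Im (z $ j))\<^sup>2 + tanh (2 * t) * (Re (z $ j))\<^sup>2)"
    unfolding weight_u_def prod.distrib by (simp add: exp_sum)
  also have "(\<Sum>j\<in>UNIV. - (cosh (2 * t) / sinh (2 * t)) * (Im (z $ j))\<^sup>2 + tanh (2 * t) * (Re (z $ j))\<^sup>2)
    = - (cosh (2 * t) / sinh (2 * t)) * (norm (im_vec z))\<^sup>2 + tanh (2 * t) * (norm (re_vec z))\<^sup>2"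
    unfolding n1 sum.distrib sum_distrib_left ..
  finally show ?thesis unfolding weight_U_def power_mult_distrib p by simp
qed

lemma borel_measurable_vec_nth[measurable]: "(\<lambda>z::'a::euclidean_space^'n::finite. z $ j) \<in> borel_measurable borel"
  by (intro borel_measurable_continuous_onI continuous_intros)

lemma weight_U_measurable[measurable]: "weight_U t \<in> borel_measurable borel"
  unfolding weight_U_eq[abs_def] by measurable

lemma weight_U_nonneg: "0 \<le> weight_U t z"
  unfolding weight_U_def by simp

lemma sets_gauss_measure[simp, measurable_cong]: "sets (gauss_measure t) = sets borel"
  by (simp add: gauss_measure_def)

lemma integrable_gauss_measure_iff:
  fixes f :: "complex^'n \<Rightarrow> complex"
  assumes [measurable]: "f \<in> borel_measurable borel"
  shows "integrable (gauss_measure t) f \<longleftrightarrow> integrable lborel (\<lambda>z. f z * of_real (weight_U t z))"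
  unfolding gauss_measure_def
  by (subst integrable_density) (auto simp: weight_U_nonneg scaleR_conv_of_real mult.commute)

lemma integral_gauss_measure:
  fixes f :: "complex^'n \<Rightarrow> complex"
  assumes [measurable]: "f \<in> borel_measurable borel"
  shows "(LINT z|gauss_measure t. f z) = (LINT z|lborel. f z * of_real (weight_U t z))"
  unfolding gauss_measure_def
  by (subst integral_density) (auto simp: weight_U_nonneg scaleR_conv_of_real mult.commute)

lemma sqi_from_prod:
  assumes [measurable]: "f \<in> borel_measurable M" and "integrable M (\<lambda>x. f x * cnj (f x))"
  shows "f \<in> sqi M"
  using integrable_norm[OF assms(2)] assms(1) by (simp add: sqi_def norm_mult power2_eq_square)

lemma prod_plane_norms:
  fixes \<alpha> :: "'n::finite \<Rightarrow> nat"
  shows "(\<Prod>j\<in>UNIV. sqrt (2 * pi) * exp (2 * (2 * real (\<alpha> j) + 1) * t))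
    = iso_const TYPE('n) * exp (2 * eigval TYPE('n) (mdeg \<alpha>) * t)"
proof -
  have "(\<Sum>j\<in>UNIV. 2 * (2 * real (\<alpha> j) + 1) * t) = 2 * eigval TYPE('n) (mdeg \<alpha>) * t"
    by (simp add: eigval_def mdeg_def sum_distrib_left sum_distrib_right sum.distrib algebra_simps)
  then show ?thesis by (simp add: prod.distrib iso_const_def flip: exp_sum)
qed

text \<open>Fubini's theorem reduces both orthogonality relations to a single coordinate.\<close>

lemma orth_family_plane:
  assumes t: "t > 0"
  shows "orth_family (gauss_measure t) (PhiC :: ('n::finite \<Rightarrow> nat) \<Rightarrow> _)
     (\<lambda>\<alpha>. iso_const TYPE('n) * exp (2 * eigval TYPE('n) (mdeg \<alpha>) * t))"
proof
  fix \<alpha> \<beta> :: "'n \<Rightarrow> nat"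
  have eq: "PhiC \<alpha> z * cnj (PhiC \<beta> z) * of_real (weight_U t z)
     = (\<Prod>j\<in>UNIV. hfunC (\<alpha> j) (z $ j) * cnj (hfunC (\<beta> j) (z $ j)) * of_real (weight_u t (z $ j)))" for \<alpha> \<beta> z
    by (simp add: PhiC_def weight_U_eq prod.distrib)
  have m: "(\<lambda>z. PhiC \<alpha> z * cnj (PhiC \<beta> z)) \<in> borel_measurable borel" for \<alpha> \<beta> :: "'n \<Rightarrow> nat" by measurable
  have int: "integrable (gauss_measure t) (\<lambda>z. PhiC \<alpha> z * cnj (PhiC \<beta> z))" for \<alpha> \<beta> :: "'n \<Rightarrow> nat"
    unfolding integrable_gauss_measure_iff[OF m] eq
    by (rule integrable_vec_prod[of "\<lambda>j z. hfunC (\<alpha> j) z * cnj (hfunC (\<beta> j) z) * of_real (weight_u t z)"])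
       (rule integrable_hfunC_plane[OF t])
  show "PhiC \<alpha> \<in> sqi (gauss_measure t)"
    by (rule sqi_from_prod[OF _ int]) measurable
  have "ip (gauss_measure t) (PhiC \<alpha>) (PhiC \<beta>)
     = (\<Prod>j\<in>UNIV. LINT z|lborel. hfunC (\<alpha> j) z * cnj (hfunC (\<beta> j) z) * of_real (weight_u t z))"
    unfolding ip_def integral_gauss_measure[OF m] eq
    by (rule integral_vec_prod[of "\<lambda>j z. hfunC (\<alpha> j) z * cnj (hfunC (\<beta> j) z) * of_real (weight_u t z)"])
       (rule integrable_hfunC_plane[OF t])
  also have "\<dots> = (\<Prod>j\<in>UNIV. if \<alpha> j = \<beta> j then of_real (sqrt (2 * pi) * exp (2 * (2 * real (\<alpha> j) + 1) * t)) else 0)"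
    by (intro prod.cong refl) (auto simp: integral_hfunC_plane[OF t])
  also have "\<dots> = (if \<alpha> = \<beta> then complex_of_real (iso_const TYPE('n) * exp (2 * eigval TYPE('n) (mdeg \<alpha>) * t)) else 0)"
  proof (cases "\<alpha> = \<beta>")
    case True
    then show ?thesis by (simp only: if_True refl of_real_prod[symmetric] prod_plane_norms)
  next
    case False
    then obtain j where "\<alpha> j \<noteq> \<beta> j" by auto
    then show ?thesis using False by (auto intro!: prod_zero)
  qed
  finally show "ip (gauss_measure t) (PhiC \<alpha>) (PhiC \<beta>)
     = (if \<alpha> = \<beta> then complex_of_real (iso_const TYPE('n) * exp (2 * eigval TYPE('n) (mdeg \<alpha>) * t)) else 0)" .
  show "0 < iso_const TYPE('n) * exp (2 * eigval TYPE('n) (mdeg \<alpha>) * t)" by (simp add: iso_const_pos)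
qed

lemma orth_family_real: "orth_family lborel (hermite_Phi :: ('n::finite \<Rightarrow> nat) \<Rightarrow> _) (\<lambda>_. 1)"
proof
  fix \<alpha> \<beta> :: "'n \<Rightarrow> nat"
  have eq: "hermite_Phi \<alpha> x * cnj (hermite_Phi \<beta> x)
     = (\<Prod>j\<in>UNIV. hfunC (\<alpha> j) (of_real (x $ j)) * cnj (hfunC (\<beta> j) (of_real (x $ j))))" for \<alpha> \<beta> :: "'n \<Rightarrow> nat" and x
    by (simp add: hermite_Phi_eq PhiC_def complex_vec_def prod.distrib)
  have int: "integrable lborel (\<lambda>x. hermite_Phi \<alpha> x * cnj (hermite_Phi \<beta> x))" for \<alpha> \<beta> :: "'n \<Rightarrow> nat"
    unfolding eq
    by (rule integrable_vec_prod[of "\<lambda>j x. hfunC (\<alpha> j) (of_real x) * cnj (hfunC (\<beta> j) (of_real x))"])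
       (rule integrable_hfunC_line)
  show "hermite_Phi \<alpha> \<in> sqi lborel"
    by (rule sqi_from_prod[OF _ int]) measurable
  have "ip lborel (hermite_Phi \<alpha>) (hermite_Phi \<beta>)
     = (\<Prod>j\<in>UNIV. LINT x|lborel. hfunC (\<alpha> j) (of_real x) * cnj (hfunC (\<beta> j) (of_real x)))"
    unfolding ip_def eq
    by (rule integral_vec_prod[of "\<lambda>j x. hfunC (\<alpha> j) (of_real x) * cnj (hfunC (\<beta> j) (of_real x))"])
       (rule integrable_hfunC_line)
  also have "\<dots> = (\<Prod>j\<in>UNIV. if \<alpha> j = \<beta> j then 1 else 0)"
    by (simp add: integral_hfunC_line)
  also have "\<dots> = (if \<alpha> = \<beta> then complex_of_real 1 else 0)"
  proof (cases "\<alpha> = \<beta>")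
    case False
    then obtain j where "\<alpha> j \<noteq> \<beta> j" by auto
    then show ?thesis using False by (auto intro!: prod_zero)
  qed simp
  finally show "ip lborel (hermite_Phi \<alpha>) (hermite_Phi \<beta>) = (if \<alpha> = \<beta> then complex_of_real 1 else 0)" .
qed simp

interpretation HR: orth_family lborel "hermite_Phi :: ('n::finite \<Rightarrow> nat) \<Rightarrow> _" "\<lambda>_. 1"
  by (rule orth_family_real)

subsection \<open>Mehler's formula in several variables\<close>

definition mehlerN :: "real \<Rightarrow> complex^'n \<Rightarrow> complex^'n \<Rightarrow> complex" where
  "mehlerN \<rho> z w = (\<Prod>j\<in>UNIV. mehler \<rho> (z $ j) (w $ j))"

text \<open>Distributivity for absolutely convergent series: a multi-index selects one summand in every factor.
Finite sets of multi-indices are contained in cubes, which bounds the sums of the absolute values.\<close>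

lemma product_has_sum:
  fixes f :: "'n::finite \<Rightarrow> nat \<Rightarrow> complex"
  assumes summ: "\<And>j. summable (\<lambda>k. cmod (f j k))" and sums: "\<And>j. f j sums S j"
  shows "((\<lambda>\<alpha>. \<Prod>j\<in>UNIV. f j (\<alpha> j)) has_sum (\<Prod>j\<in>UNIV. S j)) UNIV"
proof -
  have abs: "(\<lambda>\<alpha>. cmod (\<Prod>j\<in>UNIV. f j (\<alpha> j))) summable_on UNIV"
  proof (rule nonneg_bdd_above_summable_on, simp)
    have "(\<Sum>\<alpha>\<in>P. cmod (\<Prod>j\<in>UNIV. f j (\<alpha> j))) \<le> (\<Prod>j\<in>UNIV. \<Sum>k. cmod (f j k))" if "finite P" for P
    proof -
      define N where "N = Suc (Max (insert 0 (mdeg ` P)))"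
      have sub: "P \<subseteq> Pi\<^sub>E UNIV (\<lambda>_. {..<N})"
      proof (intro subsetI PiE_I)
        fix \<alpha> j assume "\<alpha> \<in> P"
        then have "mdeg \<alpha> \<le> Max (insert 0 (mdeg ` P))" using that by (intro Max_ge) auto
        then show "\<alpha> j \<in> {..<N}" using mdeg_le[of \<alpha> j] by (simp add: N_def)
      qed auto
      have "(\<Sum>\<alpha>\<in>P. cmod (\<Prod>j\<in>UNIV. f j (\<alpha> j))) \<le> (\<Sum>\<alpha>\<in>Pi\<^sub>E UNIV (\<lambda>_. {..<N}). cmod (\<Prod>j\<in>UNIV. f j (\<alpha> j)))"
        by (intro sum_mono2 sub) (auto intro: finite_PiE)
      also have "\<dots> = (\<Prod>j\<in>UNIV. \<Sum>k<N. cmod (f j k))"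
        by (subst prod_sum_PiE) (auto simp: prod_norm)
      also have "\<dots> \<le> (\<Prod>j\<in>UNIV. \<Sum>k. cmod (f j k))"
        by (intro prod_mono conjI sum_nonneg sum_le_suminf summ) auto
      finally show ?thesis .
    qed
    then show "bdd_above (sum (\<lambda>\<alpha>. cmod (\<Prod>j\<in>UNIV. f j (\<alpha> j))) ` {F. F \<subseteq> UNIV \<and> finite F})"
      by (intro bdd_aboveI[of _ "\<Prod>j\<in>UNIV. \<Sum>k. cmod (f j k)"]) auto
  qed
  have abs1: "(\<lambda>k. cmod (f j k)) summable_on UNIV" for j
    using summ[of j] by (simp add: summable_on_UNIV_nonneg_real_iff)
  have "infsum (\<lambda>\<alpha>. \<Prod>j\<in>UNIV. f j (\<alpha> j)) (Pi\<^sub>E UNIV (\<lambda>_. UNIV)) = (\<Prod>j\<in>UNIV. infsum (f j) UNIV)"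
    by (rule infsum_prod_PiE_abs) (auto simp: abs1)
  also have "\<dots> = (\<Prod>j\<in>UNIV. S j)"
  proof (intro prod.cong refl)
    fix j
    have "f j sums (infsum (f j) UNIV)"
      using abs1[of j] has_sum_imp_sums by (metis abs_summable_summable has_sum_infsum)
    then show "infsum (f j) UNIV = S j" using sums sums_unique2 by blast
  qed
  finally show ?thesis
    using abs_summable_summable[OF abs] has_sum_infsum by fastforce
qed

lemma mehlerN_sums:
  fixes z w :: "complex^'n::finite"
  assumes \<rho>: "0 \<le> \<rho>" "\<rho> < 1"
  shows "(\<lambda>k. of_real (\<rho> ^ k) * (\<Sum>\<alpha>\<in>level k. PhiC \<alpha> z * PhiC \<alpha> w)) sums mehlerN \<rho> z w"
proof -
  have "((\<lambda>\<alpha>. \<Prod>j\<in>UNIV. of_real (\<rho> ^ \<alpha> j) * hfunC (\<alpha> j) (z $ j) * hfunC (\<alpha> j) (w $ j)) has_sum mehlerN \<rho> z w) UNIV"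
    unfolding mehlerN_def by (intro product_has_sum mehler_sums \<rho>)
  from has_sum_imp_sums_levels[OF this]
  have "(\<lambda>k. \<Sum>\<alpha>\<in>level k. \<Prod>j\<in>UNIV. of_real (\<rho> ^ \<alpha> j) * hfunC (\<alpha> j) (z $ j) * hfunC (\<alpha> j) (w $ j)) sums mehlerN \<rho> z w" .
  moreover have "(\<Sum>\<alpha>\<in>level k. \<Prod>j\<in>UNIV. of_real (\<rho> ^ \<alpha> j) * hfunC (\<alpha> j) (z $ j) * hfunC (\<alpha> j) (w $ j))
     = of_real (\<rho> ^ k) * (\<Sum>\<alpha>\<in>level k. PhiC \<alpha> z * PhiC \<alpha> w)" for k
    unfolding sum_distrib_left
    by (intro sum.cong refl)
       (auto simp: PhiC_def prod.distrib level_def mdeg_def mult.assoc power_sum simp flip: of_real_prod)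
  ultimately show ?thesis by simp
qed

text \<open>On the antidiagonal \<open>w = cnj_vec z\<close> the terms of Mehler's series are nonnegative, since \<open>PhiC\<close> has real
Taylor coefficients. The values of the kernel there control all Hermite series (see
\<open>synth_uniform_limit\<close>).\<close>

definition mehler_diag :: "real \<Rightarrow> complex^'n \<Rightarrow> real" where
  "mehler_diag \<rho> z = Re (mehlerN \<rho> z (cnj_vec z))"

lemma mehler_diag_sums:
  fixes z :: "complex^'n::finite"
  assumes \<rho>: "0 \<le> \<rho>" "\<rho> < 1"
  shows "(\<lambda>k. \<rho> ^ k * (\<Sum>\<alpha>\<in>level k. (cmod (PhiC \<alpha> z))\<^sup>2)) sums mehler_diag \<rho> z"
proof -
  have "(\<lambda>k. Re (of_real (\<rho> ^ k) * (\<Sum>\<alpha>\<in>level k. PhiC \<alpha> z * PhiC \<alpha> (cnj_vec z)))) sums mehler_diag \<rho> z"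
    unfolding mehler_diag_def by (intro sums_Re mehlerN_sums \<rho>)
  moreover have "of_real (\<rho> ^ k) * (\<Sum>\<alpha>\<in>level k. PhiC \<alpha> z * PhiC \<alpha> (cnj_vec z))
     = complex_of_real (\<rho> ^ k * (\<Sum>\<alpha>\<in>level k. (cmod (PhiC \<alpha> z))\<^sup>2))" for k
    by (simp add: PhiC_cnj complex_norm_square del: of_real_power)
  ultimately show ?thesis by (simp only: Re_complex_of_real)
qed

lemma mehler_diag_bounded: "\<exists>C>0. \<forall>z::complex^'n::finite. norm z \<le> R \<longrightarrow> mehler_diag \<rho> z \<le> C"
proof -
  have "continuous_on (cball (0::complex^'n) R) (mehler_diag \<rho>)"
    unfolding mehler_diag_def[abs_def] mehlerN_def mehler_def cnj_vec_def by (intro continuous_intros)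
  then have "bounded (mehler_diag \<rho> ` cball (0::complex^'n) R)"
    by (intro compact_imp_bounded compact_continuous_image) auto
  then obtain C where "\<forall>x\<in>mehler_diag \<rho> ` cball (0::complex^'n) R. norm x \<le> C" unfolding bounded_iff by blast
  then have "\<forall>z::complex^'n. norm z \<le> R \<longrightarrow> mehler_diag \<rho> z \<le> max C 1" by (force simp: max_def)
  then show ?thesis by (intro exI[of _ "max C 1"]) auto
qed

section \<open>Entire functions of several variables\<close>

lemma bounded_linear_vector_scalar_mult: "bounded_linear (\<lambda>h::complex. h *s (u :: complex^'n))"
  by (rule linear_conv_bounded_linear[THEN iffD1], rule linearI) (auto simp: vec_eq_iff algebra_simps)

lemma entire_line_derivative:
  fixes F :: "complex^'n \<Rightarrow> complex"
  assumes "(F has_derivative D) (at (z + \<zeta> *s u))" "\<And>c v. D (c *s v) = c * D v"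
  shows "((\<lambda>\<zeta>. F (z + \<zeta> *s u)) has_field_derivative D u) (at \<zeta>)"
proof -
  have "((\<lambda>\<zeta>. z + \<zeta> *s u) has_derivative (\<lambda>h. h *s u)) (at \<zeta>)"
    using has_derivative_add[OF has_derivative_const bounded_linear_imp_has_derivative[OF bounded_linear_vector_scalar_mult]] by simp
  from diff_chain_at[OF this] assms(1)
  have "((\<lambda>\<zeta>. F (z + \<zeta> *s u)) has_derivative (\<lambda>h. D (h *s u))) (at \<zeta>)" by (simp add: o_def)
  then show ?thesis unfolding has_field_derivative_def by (simp add: assms(2) mult.commute[of _ "D u"])
qed

lemma entire_line_holomorphic:
  assumes "entire F"
  shows "(\<lambda>\<zeta>. F (z + \<zeta> *s u)) holomorphic_on S"
proof -
  have "\<exists>d. ((\<lambda>\<zeta>. F (z + \<zeta> *s u)) has_field_derivative d) (at \<zeta>)" for \<zeta>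
    using assms entire_line_derivative unfolding entire_def by metis
  then show ?thesis by (meson holomorphic_onI field_differentiable_at_within field_differentiable_def)
qed

lemma entire_continuous: "entire F \<Longrightarrow> continuous_on S F"
  unfolding entire_def by (meson has_derivative_continuous continuous_at_imp_continuous_on)

lemma entire_measurable: "entire F \<Longrightarrow> F \<in> borel_measurable borel"
  by (intro borel_measurable_continuous_onI entire_continuous)

lemma norm_vector_scalar_mult: "norm (c *s (v :: complex^'n)) = cmod c * norm v"
  by (simp add: norm_vec_def norm_mult L2_set_right_distrib)

text \<open>Cauchy's inequality on the complex line through \<^term>\<open>z\<close> in the direction \<^term>\<open>v\<close>.\<close>

lemma entire_derivative_bound:
  fixes F :: "complex^'n \<Rightarrow> complex"
  assumes F: "entire F" and D: "(F has_derivative D) (at z)" "\<And>c v. D (c *s v) = c * D v"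
    and B: "\<And>w. norm (w - z) \<le> 1 \<Longrightarrow> cmod (F w) \<le> B"
  shows "cmod (D v) \<le> B * norm v"
proof (cases "v = 0")
  case True
  have "D (0 *s v) = 0 * D v" by (rule D(2))
  then show ?thesis using True by simp
next
  case False
  define u where "u = of_real (1 / norm v) *s v"
  have nu: "norm u = 1" using False by (simp add: u_def norm_vector_scalar_mult norm_divide)
  have v: "v = of_real (norm v) *s u" using False by (simp add: u_def vec_eq_iff)
  have "((\<lambda>\<zeta>. F (z + \<zeta> *s u)) has_field_derivative D u) (at 0)"
    by (rule entire_line_derivative) (use D in auto)
  then have "D u = (deriv ^^ 1) (\<lambda>\<zeta>. F (z + \<zeta> *s u)) 0" by (simp add: DERIV_imp_deriv)
  also have "cmod \<dots> \<le> fact 1 * B / 1 ^ 1"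
  proof (rule Cauchy_inequality)
    show "(\<lambda>\<zeta>. F (z + \<zeta> *s u)) holomorphic_on ball 0 1" by (rule entire_line_holomorphic[OF F])
    show "continuous_on (cball 0 1) (\<lambda>\<zeta>. F (z + \<zeta> *s u))"
      by (rule holomorphic_on_imp_continuous_on[OF entire_line_holomorphic[OF F]])
    show "cmod (F (z + x *s u)) \<le> B" if "cmod (0 - x) = 1" for x
      using that by (intro B) (simp add: norm_vector_scalar_mult nu)
  qed simp
  finally have "cmod (D u) \<le> B" by simp
  moreover have "D v = of_real (norm v) * D u" by (subst v) (rule D(2))
  ultimately show ?thesis
    using mult_right_mono[of "cmod (D u)" B "norm v"] by (simp add: norm_mult mult.commute)
qed

lemma entire_add:
  assumes "entire F" "entire G" shows "entire (\<lambda>z. F z + G z)"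
  unfolding entire_def
proof
  fix z
  obtain D E where "(F has_derivative D) (at z)" "\<And>c v. D (c *s v) = c * D v"
    "(G has_derivative E) (at z)" "\<And>c v. E (c *s v) = c * E v"
    using assms unfolding entire_def by metis
  then show "\<exists>D. ((\<lambda>z. F z + G z) has_derivative D) (at z) \<and> (\<forall>c v. D (c *s v) = c * D v)"
    by (intro exI[of _ "\<lambda>v. D v + E v"]) (auto simp: algebra_simps)
qed

lemma entire_cmult:
  assumes "entire F" shows "entire (\<lambda>z. a * F z)"
  unfolding entire_def
proof
  fix z
  obtain D where "(F has_derivative D) (at z)" "\<And>c v. D (c *s v) = c * D v"
    using assms unfolding entire_def by metis
  then show "\<exists>D. ((\<lambda>z. a * F z) has_derivative D) (at z) \<and> (\<forall>c v. D (c *s v) = c * D v)"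
    by (intro exI[of _ "\<lambda>v. a * D v"]) (auto simp: algebra_simps intro: has_derivative_mult_right)
qed

lemma entire_diff: "entire F \<Longrightarrow> entire G \<Longrightarrow> entire (\<lambda>z. F z - G z)"
  using entire_add[of F "\<lambda>z. (-1) * G z"] entire_cmult[of G "-1"] by simp

lemma entire_zero: "entire (\<lambda>z. 0)"
  unfolding entire_def by (auto intro!: exI[of _ "\<lambda>v. 0"])

lemma entire_sum: "(\<And>i. i \<in> A \<Longrightarrow> entire (F i)) \<Longrightarrow> entire (\<lambda>z. \<Sum>i\<in>A. F i z)"
  by (induction A rule: infinite_finite_induct) (auto simp: entire_zero intro: entire_add)

lemma entire_PhiC: "entire (PhiC \<alpha> :: complex^'n \<Rightarrow> complex)"
  unfolding entire_def
proof
  fix z :: "complex^'n"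
  define d where "d j = deriv (hfunC (\<alpha> j)) (z $ j)" for j
  have hd: "(hfunC (\<alpha> j) has_field_derivative d j) (at (z $ j))" for j
    unfolding d_def using hfunC_has_field_derivative DERIV_deriv_iff_field_differentiable field_differentiable_def by blast
  have "((\<lambda>z. hfunC (\<alpha> j) (z $ j)) has_derivative (\<lambda>v. d j * v $ j)) (at z)" for j
  proof -
    have "((\<lambda>z::complex^'n. z $ j) has_derivative (\<lambda>v. v $ j)) (at z)"
      by (rule bounded_linear_imp_has_derivative[OF bounded_linear_vec_nth])
    from diff_chain_at[OF this hd[unfolded has_field_derivative_def]] show ?thesis by (simp add: o_def)
  qed
  then have "((\<lambda>z. \<Prod>j\<in>UNIV. hfunC (\<alpha> j) (z $ j)) has_derivative
      (\<lambda>v. \<Sum>j\<in>UNIV. d j * v $ j * (\<Prod>i\<in>UNIV - {j}. hfunC (\<alpha> i) (z $ i)))) (at z)"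
    by (intro has_derivative_prod)
  then show "\<exists>D. (PhiC \<alpha> has_derivative D) (at z) \<and> (\<forall>c v. D (c *s v) = c * D v)"
    unfolding PhiC_def[abs_def] by (intro exI conjI) (auto simp: sum_distrib_left mult_ac)
qed

text \<open>The derivatives of a locally uniformly convergent sequence converge locally uniformly as well,
  by Cauchy's inequality.\<close>

lemma entire_uniform_limit:
  fixes f :: "nat \<Rightarrow> complex^'n \<Rightarrow> complex"
  assumes ent: "\<And>N. entire (f N)"
    and ulim: "\<And>R. uniform_limit (cball 0 R) f F sequentially"
  shows "entire F"
  unfolding entire_def
proof
  fix z0 :: "complex^'n"
  define R where "R = norm z0 + 1"
  have "\<forall>N z. \<exists>D. (f N has_derivative D) (at z) \<and> (\<forall>c v. D (c *s v) = c * D v)"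
    using ent unfolding entire_def by blast
  then obtain D where D: "\<And>N z. (f N has_derivative D N z) (at z)" "\<And>N z c v. D N z (c *s v) = c * D N z v"
    by metis
  \<comment> \<open>derivatives on the ball of radius \<open>R\<close> are controlled by values on the ball of radius \<open>R + 1\<close>\<close>
  have cauchy: "\<exists>M. \<forall>m\<ge>M. \<forall>n\<ge>M. \<forall>z\<in>ball 0 R. \<forall>v. cmod (D m z v - D n z v) \<le> e * norm v" if "e > 0" for e
  proof -
    have "uniformly_Cauchy_on (cball 0 (R + 1)) f"
      using ulim[of "R + 1"] by (metis uniformly_convergent_Cauchy uniformly_convergent_on_def)
    then obtain M where M: "\<And>x m n. x \<in> cball 0 (R + 1) \<Longrightarrow> m \<ge> M \<Longrightarrow> n \<ge> M \<Longrightarrow> dist (f m x) (f n x) < e"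
      unfolding uniformly_Cauchy_on_def using \<open>e > 0\<close> by metis
    have "cmod (D m z v - D n z v) \<le> e * norm v" if "m \<ge> M" "n \<ge> M" "z \<in> ball 0 R" for m n z v
    proof (rule entire_derivative_bound[where F="\<lambda>z. f m z - f n z" and z=z])
      show "entire (\<lambda>z. f m z - f n z)" by (intro entire_diff ent)
      show "((\<lambda>z. f m z - f n z) has_derivative (\<lambda>v. D m z v - D n z v)) (at z)"
        by (intro has_derivative_diff D)
      show "D m z (c *s v) - D n z (c *s v) = c * (D m z v - D n z v)" for c v
        by (simp add: D algebra_simps)
      fix w assume "norm (w - z) \<le> 1"
      then have "norm w \<le> R + 1" using that(3) norm_triangle_ineq[of z "w - z"] by simp
      then show "cmod (f m w - f n w) \<le> e" using M[of w m n] that by (simp add: dist_norm)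
    qed
    then show ?thesis by blast
  qed
  have conv: "\<exists>l. (\<lambda>N. D N z v) \<longlonglongrightarrow> l" if "z \<in> ball 0 R" for z v
  proof -
    have "Cauchy (\<lambda>N. D N z v)"
    proof (rule metric_CauchyI)
      fix e :: real assume "e > 0"
      define e' where "e' = e / (norm v + 1)"
      have p: "norm v + 1 > 0" by (simp add: add_nonneg_pos)
      have "e' > 0" using \<open>e > 0\<close> p by (simp add: e'_def)
      then obtain M where M: "\<forall>m\<ge>M. \<forall>n\<ge>M. \<forall>z\<in>ball 0 R. \<forall>v. cmod (D m z v - D n z v) \<le> e' * norm v"
        using cauchy by blast
      have "e' * norm v < e" using \<open>e > 0\<close> p by (simp add: e'_def field_simps)
      then have "dist (D m z v) (D n z v) < e" if "m \<ge> M" "n \<ge> M" for m n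
        using M \<open>z \<in> ball 0 R\<close> that unfolding dist_norm by (meson le_less_trans)
      then show "\<exists>M. \<forall>m\<ge>M. \<forall>n\<ge>M. dist (D m z v) (D n z v) < e" by blast
    qed
    then show ?thesis by (simp add: Cauchy_convergent_iff convergent_def)
  qed
  define g' where "g' z v = lim (\<lambda>N. D N z v)" for z v
  have g': "(\<lambda>N. D N z v) \<longlonglongrightarrow> g' z v" if "z \<in> ball 0 R" for z v
    using conv[OF that] unfolding g'_def by (metis limI)
  have "\<exists>g. \<forall>x\<in>ball 0 R. (\<lambda>n. f n x) \<longlonglongrightarrow> g x \<and> (g has_derivative g' x) (at x within ball 0 R)"
  proof (rule has_derivative_sequence)
    show "convex (ball (0::complex^'n) R)" by (rule convex_ball)
    show "(f n has_derivative D n x) (at x within ball 0 R)" for n x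
      by (rule has_derivative_at_withinI[OF D(1)])
    show "z0 \<in> ball 0 R" by (simp add: R_def)
    show "(\<lambda>n. f n z0) \<longlonglongrightarrow> F z0" by (rule tendsto_uniform_limitI[OF ulim[of R]]) (simp add: R_def)
    fix e :: real assume "e > 0"
    then obtain M where M: "\<forall>m\<ge>M. \<forall>n\<ge>M. \<forall>z\<in>ball 0 R. \<forall>v. cmod (D m z v - D n z v) \<le> e * norm v"
      using cauchy by blast
    have "cmod (D n x h - g' x h) \<le> e * norm h" if "n \<ge> M" "x \<in> ball 0 R" for n x h
    proof (rule LIMSEQ_le_const2)
      show "(\<lambda>m. cmod (D n x h - D m x h)) \<longlonglongrightarrow> cmod (D n x h - g' x h)"
        by (intro tendsto_intros g' that)
      show "\<exists>N. \<forall>m\<ge>N. cmod (D n x h - D m x h) \<le> e * norm h" using M that by blast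
    qed
    then show "\<forall>\<^sub>F n in sequentially. \<forall>x\<in>ball 0 R. \<forall>h. cmod (D n x h - g' x h) \<le> e * norm h"
      unfolding eventually_sequentially by blast
  qed
  then obtain g where g: "\<And>x. x \<in> ball 0 R \<Longrightarrow> (\<lambda>n. f n x) \<longlonglongrightarrow> g x"
    "\<And>x. x \<in> ball 0 R \<Longrightarrow> (g has_derivative g' x) (at x within ball 0 R)" by blast
  have gF: "g x = F x" if "x \<in> ball 0 R" for x
    using LIMSEQ_unique[OF g(1)[OF that]] tendsto_uniform_limitI[OF ulim[of R], of x] that by auto
  have z0: "z0 \<in> ball 0 R" by (simp add: R_def)
  have "(F has_derivative g' z0) (at z0 within ball 0 R)"
    using g(2)[OF z0] by (rule has_derivative_transform[OF z0, rotated]) (simp add: gF)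
  then have "(F has_derivative g' z0) (at z0)" using z0 by (simp add: at_within_open[OF _ open_ball])
  moreover have "g' z0 (c *s v) = c * g' z0 v" for c v
  proof (rule LIMSEQ_unique[OF g'[OF z0]])
    show "(\<lambda>N. D N z0 (c *s v)) \<longlonglongrightarrow> c * g' z0 v"
      unfolding D(2) by (intro tendsto_intros g' z0)
  qed
  ultimately show "\<exists>D. (F has_derivative D) (at z0) \<and> (\<forall>c v. D (c *s v) = c * D v)" by blast
qed

text \<open>The complex line through \<open>x\<close> in the direction \<open>y\<close>, both real, meets the real vectors
  in a line and contains \<open>x + i y\<close>.\<close>

lemma entire_zero_on_reals:
  fixes F :: "complex^'n \<Rightarrow> complex"
  assumes F: "entire F" and zero: "\<And>x. F (complex_vec x) = 0"
  shows "F z = 0"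
proof -
  define x where "x = re_vec z"
  define y where "y = im_vec z"
  define \<phi> where "\<phi> \<zeta> = F (complex_vec x + \<zeta> *s complex_vec y)" for \<zeta>
  have real: "\<phi> (of_real r) = 0" for r
  proof -
    have "complex_vec x + of_real r *s complex_vec y = complex_vec (x + r *\<^sub>R y)"
      by (simp add: complex_vec_def vec_eq_iff)
    then show ?thesis by (simp add: \<phi>_def zero)
  qed
  have "\<phi> \<i> = 0"
  proof (rule analytic_continuation[of \<phi> UNIV "range complex_of_real" 0])
    show "\<phi> holomorphic_on UNIV" unfolding \<phi>_def by (rule entire_line_holomorphic[OF F])
    have "(0::complex) islimpt range of_real"
      unfolding islimpt_approachable
    proof (intro allI impI)
      fix e :: real assume "e > 0"
      then show "\<exists>x'\<in>range complex_of_real. x' \<noteq> 0 \<and> dist x' 0 < e"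
        by (intro bexI[of _ "of_real (e / 2)"] rangeI) (auto simp: dist_norm norm_divide)
    qed
    then show "(0::complex) islimpt range of_real" .
  qed (auto simp: real)
  moreover have "complex_vec x + \<i> *s complex_vec y = z"
    by (simp add: complex_vec_def vec_eq_iff x_def y_def re_vec_def im_vec_def complex_eq[symmetric])
  ultimately show ?thesis by (simp add: \<phi>_def)
qed

section \<open>Rapidly convergent Hermite series\<close>

text \<open>The coefficient families \<open>a\<close> with \<open>rapid r a\<close> are those of the entire functions that are square
integrable for the weight at time \<open>r\<close> (\<open>synth_isometry\<close>, \<open>entire_sqi_expansion\<close>); \<open>level_sq a k\<close> is the
square of the norm of the projection to the level \<open>k\<close> of the function on real space with
coefficients \<open>a\<close>.\<close>

definition block :: "(('n::finite \<Rightarrow> nat) \<Rightarrow> complex) \<Rightarrow> nat \<Rightarrow> complex^'n \<Rightarrow> complex" where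
  "block a k z = (\<Sum>\<alpha>\<in>level k. a \<alpha> * PhiC \<alpha> z)"

definition synth :: "(('n::finite \<Rightarrow> nat) \<Rightarrow> complex) \<Rightarrow> complex^'n \<Rightarrow> complex" where
  "synth a z = (\<Sum>k. block a k z)"

definition level_sq :: "(('n::finite \<Rightarrow> nat) \<Rightarrow> complex) \<Rightarrow> nat \<Rightarrow> real" where
  "level_sq a k = (\<Sum>\<alpha>\<in>level k. (cmod (a \<alpha>))\<^sup>2)"

definition rapid :: "real \<Rightarrow> (('n::finite \<Rightarrow> nat) \<Rightarrow> complex) \<Rightarrow> bool" where
  "rapid r a \<longleftrightarrow> summable (\<lambda>k. exp (2 * eigval TYPE('n) k * r) * level_sq a k)"

lemma level_sq_nonneg: "0 \<le> level_sq a k"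
  by (simp add: level_sq_def sum_nonneg)

lemma block_bound:
  fixes a :: "('n::finite \<Rightarrow> nat) \<Rightarrow> complex"
  shows "(cmod (block a k z))\<^sup>2 \<le> level_sq a k * (\<Sum>\<alpha>\<in>level k. (cmod (PhiC \<alpha> z))\<^sup>2)"
proof -
  have "cmod (block a k z) \<le> (\<Sum>\<alpha>\<in>level k. cmod (a \<alpha>) * cmod (PhiC \<alpha> z))"
    unfolding block_def by (rule order_trans[OF norm_sum]) (simp add: norm_mult)
  then have "(cmod (block a k z))\<^sup>2 \<le> (\<Sum>\<alpha>\<in>level k. cmod (a \<alpha>) * cmod (PhiC \<alpha> z))\<^sup>2"
    by (intro power_mono) auto
  also have "\<dots> \<le> level_sq a k * (\<Sum>\<alpha>\<in>level k. (cmod (PhiC \<alpha> z))\<^sup>2)"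
    unfolding level_sq_def by (rule Cauchy_Schwarz_ineq_sum)
  finally show ?thesis .
qed

lemma rapid_level_sq_bound:
  fixes a :: "('n::finite \<Rightarrow> nat) \<Rightarrow> complex"
  assumes "rapid r a" "r > 0"
  shows "\<exists>C>0. \<forall>k. level_sq a k \<le> C * (exp (- 2 * r) ^ k)\<^sup>2"
proof -
  have "(\<lambda>k. exp (2 * eigval TYPE('n) k * r) * level_sq a k) \<longlonglongrightarrow> 0"
    using assms(1) unfolding rapid_def by (rule summable_LIMSEQ_zero)
  then have "Bseq (\<lambda>k. exp (2 * eigval TYPE('n) k * r) * level_sq a k)"
    using convergent_imp_Bseq convergentI by blast
  then obtain C where C: "C > 0" "\<And>k. norm (exp (2 * eigval TYPE('n) k * r) * level_sq a k) \<le> C"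
    unfolding Bseq_def by blast
  have "level_sq a k \<le> C * (exp (- 2 * r) ^ k)\<^sup>2" for k
  proof -
    have "exp (4 * real k * r) * level_sq a k \<le> exp (2 * eigval TYPE('n) k * r) * level_sq a k"
      using assms(2) by (intro mult_right_mono level_sq_nonneg) (simp add: eigval_def algebra_simps)
    also have "\<dots> \<le> C" using C(2)[of k] by (simp add: level_sq_nonneg)
    finally have "exp (- (4 * real k * r)) * (exp (4 * real k * r) * level_sq a k) \<le> exp (- (4 * real k * r)) * C"
      by (intro mult_left_mono) auto
    moreover have "exp (- (4 * real k * r)) * (exp (4 * real k * r) * level_sq a k) = level_sq a k"
      by (simp add: mult.assoc[symmetric] exp_add[symmetric])
    moreover have "exp (- (4 * real k * r)) = (exp (- 2 * r) ^ k)\<^sup>2"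
      unfolding power_mult[symmetric] exp_of_nat_mult[symmetric] by (simp add: algebra_simps)
    ultimately show ?thesis by (simp only: mult.commute)
  qed
  then show ?thesis using C(1) by blast
qed

text \<open>Cauchy--Schwarz on each level and the diagonal of Mehler's kernel with
  \<open>\<rho> = exp (- 2 * r)\<close> give a geometric majorant on bounded sets: the coefficients on the level \<open>k\<close>
  are of the order \<open>\<rho> ^ k\<close>, and the functions \<open>PhiC \<alpha>\<close> of that level cost at most
  \<open>sqrt (1 / \<rho>) ^ k\<close>.\<close>

lemma synth_uniform_limit:
  fixes a :: "('n::finite \<Rightarrow> nat) \<Rightarrow> complex"
  assumes a: "rapid r a" and r: "r > 0"
  shows "uniform_limit (cball 0 R) (\<lambda>N z. \<Sum>k<N. block a k z) (synth a) sequentially"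
proof -
  define \<rho> where "\<rho> = exp (- 2 * r)"
  have \<rho>: "0 < \<rho>" "\<rho> < 1" using r by (auto simp: \<rho>_def)
  obtain C where C: "C > 0" "\<And>k. level_sq a k \<le> C * (\<rho> ^ k)\<^sup>2"
  proof -
    from rapid_level_sq_bound[OF a r] obtain C where "C > 0" "\<forall>k. level_sq a k \<le> C * (exp (- 2 * r) ^ k)\<^sup>2" by auto
    then show thesis by (intro that[of C]) (simp_all only: \<rho>_def)
  qed
  obtain D where D: "D > 0" "\<And>z::complex^'n. norm z \<le> R \<Longrightarrow> mehler_diag \<rho> z \<le> D"
    using mehler_diag_bounded[of R \<rho>, where ?'n = 'n] by blast
  have bd: "cmod (block a k z) \<le> sqrt (C * D) * sqrt \<rho> ^ k" if "z \<in> cball 0 R" for k z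
  proof -
    have s: "(\<lambda>k. \<rho> ^ k * (\<Sum>\<alpha>\<in>level k. (cmod (PhiC \<alpha> z))\<^sup>2)) sums mehler_diag \<rho> z"
      using \<rho> by (intro mehler_diag_sums) auto
    have "\<rho> ^ k * (\<Sum>\<alpha>\<in>level k. (cmod (PhiC \<alpha> z))\<^sup>2) \<le> mehler_diag \<rho> z"
      using sum_le_suminf[OF sums_summable[OF s], of "{k}"] \<rho> by (simp add: sums_unique[OF s] sum_nonneg)
    also have "\<dots> \<le> D" using that by (intro D(2)) simp
    finally have le: "\<rho> ^ k * (\<Sum>\<alpha>\<in>level k. (cmod (PhiC \<alpha> z))\<^sup>2) \<le> D" .
    have "(cmod (block a k z))\<^sup>2 \<le> level_sq a k * (\<Sum>\<alpha>\<in>level k. (cmod (PhiC \<alpha> z))\<^sup>2)" by (rule block_bound)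
    also have "\<dots> \<le> (C * (\<rho> ^ k)\<^sup>2) * (\<Sum>\<alpha>\<in>level k. (cmod (PhiC \<alpha> z))\<^sup>2)"
      by (intro mult_right_mono C) (simp add: sum_nonneg)
    also have "\<dots> = C * \<rho> ^ k * (\<rho> ^ k * (\<Sum>\<alpha>\<in>level k. (cmod (PhiC \<alpha> z))\<^sup>2))"
      by (simp add: power2_eq_square)
    also have "\<dots> \<le> C * \<rho> ^ k * D" using C \<rho> le by (intro mult_left_mono) auto
    also have "\<dots> = (sqrt (C * D) * sqrt \<rho> ^ k)\<^sup>2"
    proof -
      have "(sqrt \<rho> ^ k)\<^sup>2 = ((sqrt \<rho>)\<^sup>2) ^ k" by (metis power_mult mult.commute)
      then have "(sqrt \<rho> ^ k)\<^sup>2 = \<rho> ^ k" using \<rho> by simp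
      then show ?thesis using C D by (simp add: power_mult_distrib)
    qed
    finally have sq: "(cmod (block a k z))\<^sup>2 \<le> (sqrt (C * D) * sqrt \<rho> ^ k)\<^sup>2" .
    show ?thesis by (rule power2_le_imp_le[OF sq]) (use C D \<rho> in auto)
  qed
  have "uniform_limit (cball 0 R) (\<lambda>N z. \<Sum>k<N. block a k z) (\<lambda>z. \<Sum>k. block a k z) sequentially"
  proof (rule Weierstrass_m_test[where M="\<lambda>k. sqrt (C * D) * sqrt \<rho> ^ k"])
    show "cmod (block a k z) \<le> sqrt (C * D) * sqrt \<rho> ^ k" if "z \<in> cball 0 R" for k z
      by (rule bd[OF that])
    show "summable (\<lambda>k. sqrt (C * D) * sqrt \<rho> ^ k)"
      using \<rho> by (intro summable_mult summable_geometric) auto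
  qed
  then show ?thesis by (simp add: synth_def[abs_def])
qed

lemma synth_pointwise:
  assumes "rapid r a" "r > 0"
  shows "(\<lambda>N. \<Sum>k<N. block a k z) \<longlonglongrightarrow> synth a z"
  using tendsto_uniform_limitI[OF synth_uniform_limit[OF assms, of "norm z"], of z] by simp

lemma entire_block: "entire (block a k)"
  unfolding block_def[abs_def] by (intro entire_sum entire_cmult entire_PhiC)

lemma entire_synth:
  assumes "rapid r a" "r > 0"
  shows "entire (synth a)"
  by (rule entire_uniform_limit[OF _ synth_uniform_limit[OF assms]]) (intro entire_sum entire_block)

subsection \<open>The complexified Hermite operator acts on the coefficients\<close>

definition upd_vec :: "complex^'n \<Rightarrow> 'n \<Rightarrow> complex \<Rightarrow> complex^'n" where
  "upd_vec z j w = (\<chi> i. if i = j then w else z $ i)"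

lemma cpartial_twice: "cpartial j (cpartial j F) z = (deriv ^^ 2) (\<lambda>w. F (upd_vec z j w)) (z $ j)"
proof -
  have "cpartial j F (upd_vec z j w) = deriv (\<lambda>w. F (upd_vec z j w)) w" for w
  proof -
    have "(\<chi> i. if i = j then w' else upd_vec z j w $ i) = upd_vec z j w'" for w'
      by (simp add: upd_vec_def vec_eq_iff)
    then show ?thesis unfolding cpartial_def by (simp only:) (simp add: upd_vec_def)
  qed
  then show ?thesis
    unfolding cpartial_def[of j "cpartial j F"] upd_vec_def[symmetric] by (simp add: numeral_2_eq_2)
qed

lemma upd_vec_line: "upd_vec z j w = (z - (z $ j) *s axis j 1) + w *s axis j 1"
  by (simp add: upd_vec_def vec_eq_iff axis_def)

lemma norm_axis_one: "norm (axis j (1::complex)) = 1"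
proof -
  have "(\<Sum>i\<in>UNIV. (norm (axis j (1::complex) $ i))\<^sup>2) = (\<Sum>i\<in>UNIV. if i = j then 1 else 0)"
    by (intro sum.cong) (auto simp: axis_def)
  then show ?thesis by (simp add: norm_vec_def L2_set_def)
qed

lemma upd_vec_holomorphic: "entire F \<Longrightarrow> (\<lambda>w. F (upd_vec z j w)) holomorphic_on S"
  unfolding upd_vec_line by (rule entire_line_holomorphic)

lemma upd_vec_PhiC: "PhiC \<alpha> (upd_vec z j w) = (\<Prod>i\<in>UNIV - {j}. hfunC (\<alpha> i) (z $ i)) * hfunC (\<alpha> j) w"
proof -
  have "PhiC \<alpha> (upd_vec z j w) = hfunC (\<alpha> j) w * (\<Prod>i\<in>UNIV - {j}. hfunC (\<alpha> i) (upd_vec z j w $ i))"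
    unfolding PhiC_def by (subst prod.remove[of UNIV j]) (auto simp: upd_vec_def)
  also have "(\<Prod>i\<in>UNIV - {j}. hfunC (\<alpha> i) (upd_vec z j w $ i)) = (\<Prod>i\<in>UNIV - {j}. hfunC (\<alpha> i) (z $ i))"
    by (intro prod.cong) (auto simp: upd_vec_def)
  finally show ?thesis by simp
qed

lemma deriv2_sum:
  assumes "finite A" "\<And>i. i \<in> A \<Longrightarrow> f i holomorphic_on UNIV"
  shows "(deriv ^^ 2) (\<lambda>w. \<Sum>i\<in>A. f i w) z = (\<Sum>i\<in>A. (deriv ^^ 2) (f i) z)"
  using assms
proof (induction A rule: finite_induct)
  case (insert i A)
  have "(deriv ^^ 2) (\<lambda>w. f i w + (\<Sum>i\<in>A. f i w)) z = (deriv ^^ 2) (f i) z + (deriv ^^ 2) (\<lambda>w. \<Sum>i\<in>A. f i w) z"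
    by (rule higher_deriv_add[of _ UNIV]) (use insert in \<open>auto intro!: holomorphic_intros\<close>)
  then show ?case using insert by simp
qed (simp add: numeral_2_eq_2)

lemma deriv2_cmult: "f holomorphic_on UNIV \<Longrightarrow> (deriv ^^ 2) (\<lambda>w. c * f w) z = c * (deriv ^^ 2) f z"
  by (rule higher_deriv_cmult[of _ UNIV]) auto

lemma cpartial_twice_PhiC:
  "cpartial j (cpartial j (PhiC \<alpha>)) z = (z $ j)\<^sup>2 * PhiC \<alpha> z - of_nat (2 * \<alpha> j + 1) * PhiC \<alpha> z"
proof -
  have "PhiC \<alpha> z = (\<Prod>i\<in>UNIV - {j}. hfunC (\<alpha> i) (z $ i)) * hfunC (\<alpha> j) (z $ j)"
  proof -
    have "upd_vec z j (z $ j) = z" by (simp add: upd_vec_def vec_eq_iff)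
    then show ?thesis using upd_vec_PhiC[of \<alpha> z j "z $ j"] by simp
  qed
  moreover have "(deriv ^^ 2) (\<lambda>w. (\<Prod>i\<in>UNIV - {j}. hfunC (\<alpha> i) (z $ i)) * hfunC (\<alpha> j) w) (z $ j)
     = (\<Prod>i\<in>UNIV - {j}. hfunC (\<alpha> i) (z $ i)) * ((z $ j)\<^sup>2 * hfunC (\<alpha> j) (z $ j) - of_nat (2 * \<alpha> j + 1) * hfunC (\<alpha> j) (z $ j))"
    by (subst deriv2_cmult) (auto simp only: hfunC_holomorphic hfunC_ode)
  ultimately show ?thesis unfolding cpartial_twice upd_vec_PhiC
    by (simp only: right_diff_distrib mult_ac)
qed

definition scale_eig :: "nat \<Rightarrow> (('n::finite \<Rightarrow> nat) \<Rightarrow> complex) \<Rightarrow> ('n \<Rightarrow> nat) \<Rightarrow> complex" where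
  "scale_eig m a \<alpha> = of_real (eigval TYPE('n) (mdeg \<alpha>) ^ m) * a \<alpha>"

lemma hermite_op_C_PhiC:
  fixes z :: "complex^'n"
  shows "(\<Sum>j\<in>UNIV. - cpartial j (cpartial j (PhiC \<alpha>)) z + (z $ j)\<^sup>2 * PhiC \<alpha> z) = of_real (eigval TYPE('n) (mdeg \<alpha>)) * PhiC \<alpha> z"
proof -
  have "(\<Sum>j\<in>UNIV. - cpartial j (cpartial j (PhiC \<alpha>)) z + (z $ j)\<^sup>2 * PhiC \<alpha> z) = of_nat (\<Sum>j\<in>UNIV. 2 * \<alpha> j + 1) * PhiC \<alpha> z"
    unfolding cpartial_twice_PhiC of_nat_sum sum_distrib_right by (intro sum.cong refl) (simp add: algebra_simps)
  also have "(\<Sum>j\<in>UNIV. 2 * \<alpha> j + 1) = 2 * mdeg \<alpha> + CARD('n)"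
    by (simp only: sum.distrib mdeg_def sum_distrib_left) simp
  finally show ?thesis by (simp add: eigval_def)
qed

lemma cpartial_twice_partial_sum:
  "cpartial j (cpartial j (\<lambda>z. \<Sum>k<N. block a k z)) z
     = (\<Sum>k<N. \<Sum>\<alpha>\<in>level k. a \<alpha> * cpartial j (cpartial j (PhiC \<alpha>)) z)"
  unfolding cpartial_twice block_def
  by (subst deriv2_sum, simp, (intro holomorphic_intros upd_vec_holomorphic entire_PhiC), intro sum.cong refl,
      subst deriv2_sum, simp, (intro holomorphic_intros upd_vec_holomorphic entire_PhiC), intro sum.cong refl,
      rule deriv2_cmult, rule upd_vec_holomorphic, rule entire_PhiC)

lemma hermite_op_C_partial_sum:
  fixes z :: "complex^'n"
  shows "hermite_op_C (\<lambda>z. \<Sum>k<N. block a k z) z = (\<Sum>k<N. block (scale_eig 1 a) k z)"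
proof -
  have "hermite_op_C (\<lambda>z. \<Sum>k<N. block a k z) z
     = (\<Sum>j\<in>UNIV. \<Sum>k<N. \<Sum>\<alpha>\<in>level k. a \<alpha> * (- cpartial j (cpartial j (PhiC \<alpha>)) z + (z $ j)\<^sup>2 * PhiC \<alpha> z))"
    unfolding hermite_op_C_def cpartial_twice_partial_sum unfolding block_def
    by (simp add: sum_distrib_left sum.distrib sum_subtractf right_diff_distrib mult_ac)
  also have "\<dots> = (\<Sum>k<N. \<Sum>\<alpha>\<in>level k. a \<alpha> * (\<Sum>j\<in>UNIV. - cpartial j (cpartial j (PhiC \<alpha>)) z + (z $ j)\<^sup>2 * PhiC \<alpha> z))"
    by (subst sum.swap, intro sum.cong refl, subst sum.swap) (simp add: sum_distrib_left)
  finally show ?thesis unfolding hermite_op_C_PhiC by (simp add: block_def scale_eig_def mult_ac)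
qed

text \<open>The partial sums converge uniformly on bounded parts of each coordinate line, hence so do their
second derivatives along these lines.\<close>

lemma hermite_op_C_synth_pointwise:
  fixes z :: "complex^'n"
  assumes a: "rapid r a" "r > 0"
  shows "(\<lambda>N. hermite_op_C (\<lambda>z. \<Sum>k<N. block a k z) z) \<longlonglongrightarrow> hermite_op_C (synth a) z"
  unfolding hermite_op_C_def
proof (intro tendsto_intros)
  fix j :: 'n
  show "(\<lambda>N. \<Sum>k<N. block a k z) \<longlonglongrightarrow> synth a z" by (rule synth_pointwise[OF a])
  define r0 where "r0 = cmod (z $ j) + 1"
  define R where "R = norm (z - (z $ j) *s axis j 1) + r0"
  have sub: "upd_vec z j w \<in> cball 0 R" if "w \<in> ball 0 r0" for w
  proof -
    have "norm (upd_vec z j w) \<le> norm (z - (z $ j) *s axis j 1) + norm (w *s axis j (1::complex))"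
      unfolding upd_vec_line by (rule norm_triangle_ineq)
    also have "norm (w *s axis j (1::complex)) = cmod w"
      by (simp add: norm_vector_scalar_mult norm_axis_one)
    finally show ?thesis using that by (simp add: R_def)
  qed
  have ulim: "uniform_limit (ball 0 r0) (\<lambda>N w. \<Sum>k<N. block a k (upd_vec z j w)) (\<lambda>w. synth a (upd_vec z j w)) sequentially"
  proof (rule uniform_limitI)
    fix e :: real assume "e > 0"
    from uniform_limitD[OF synth_uniform_limit[OF a, of R] this]
    show "\<forall>\<^sub>F N in sequentially. \<forall>w\<in>ball 0 r0. dist (\<Sum>k<N. block a k (upd_vec z j w)) (synth a (upd_vec z j w)) < e"
      by (rule eventually_mono) (use sub in blast)
  qed
  have hol: "\<forall>\<^sub>F N in sequentially. (\<lambda>w. \<Sum>k<N. block a k (upd_vec z j w)) holomorphic_on ball 0 r0"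
  proof (rule always_eventually, rule allI)
    fix N
    have "entire (\<lambda>v. \<Sum>k<N. block a k v)" by (rule entire_sum) (rule entire_block)
    from upd_vec_holomorphic[OF this] show "(\<lambda>w. \<Sum>k<N. block a k (upd_vec z j w)) holomorphic_on ball 0 r0" .
  qed
  have "z $ j \<in> ball 0 r0" by (simp add: r0_def)
  from higher_deriv_complex_uniform_limit[OF ulim hol sequentially_bot open_ball this, of 2]
  show "(\<lambda>N. cpartial j (cpartial j (\<lambda>z. \<Sum>k<N. block a k z)) z) \<longlonglongrightarrow> cpartial j (cpartial j (synth a)) z"
    unfolding cpartial_twice .
qed

lemma level_sq_scale:
  fixes a :: "('n::finite \<Rightarrow> nat) \<Rightarrow> complex"
  shows "level_sq (scale_eig m a) k = eigval TYPE('n) k ^ (2 * m) * level_sq a k"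
proof -
  have nn: "0 \<le> eigval TYPE('n) k" for k by (simp add: eigval_def)
  show ?thesis unfolding level_sq_def sum_distrib_left scale_eig_def
    by (intro sum.cong refl) (simp add: level_def norm_mult power_mult_distrib norm_power nn power_mult mult.commute[of 2])
qed

text \<open>Powers of the eigenvalue are absorbed by an arbitrarily small decrease of the exponent.\<close>

lemma rapid_scale:
  fixes a :: "('n::finite \<Rightarrow> nat) \<Rightarrow> complex"
  assumes a: "rapid t a" and r: "r < t"
  shows "rapid r (scale_eig m a)"
proof -
  define c where "c = 2 * (t - r)"
  have c: "c > 0" using r by (simp add: c_def)
  have "((\<lambda>x. x ^ (2 * m) * exp (- (c * x))) \<longlongrightarrow> 0) at_top"
    using c by real_asymp
  moreover have "filterlim (eigval TYPE('n)) at_top sequentially"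
    unfolding eigval_def[abs_def] by (simp add: filterlim_tendsto_add_at_top[OF tendsto_const] filterlim_real_sequentially add.commute
       filterlim_tendsto_pos_mult_at_top[OF tendsto_const])
  ultimately have "(\<lambda>k. eigval TYPE('n) k ^ (2 * m) * exp (- (c * eigval TYPE('n) k))) \<longlonglongrightarrow> 0"
    by (rule filterlim_compose)
  then have ev: "\<forall>\<^sub>F k in sequentially. eigval TYPE('n) k ^ (2 * m) * exp (- (c * eigval TYPE('n) k)) < 1"
    by (rule order_tendstoD) simp
  show ?thesis
    unfolding rapid_def
  proof (rule summable_comparison_test_ev[OF _ a[unfolded rapid_def]])
    show "\<forall>\<^sub>F k in sequentially. norm (exp (2 * eigval TYPE('n) k * r) * level_sq (scale_eig m a) k) \<le> exp (2 * eigval TYPE('n) k * t) * level_sq a k"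
      using ev
    proof eventually_elim
      case (elim k)
      have nn: "0 \<le> eigval TYPE('n) k" by (simp add: eigval_def)
      have "norm (exp (2 * eigval TYPE('n) k * r) * level_sq (scale_eig m a) k)
          = (eigval TYPE('n) k ^ (2 * m) * exp (- (c * eigval TYPE('n) k))) * (exp (2 * eigval TYPE('n) k * t) * level_sq a k)"
        using nn by (simp add: level_sq_scale level_sq_nonneg c_def algebra_simps flip: exp_add)
      also have "\<dots> \<le> 1 * (exp (2 * eigval TYPE('n) k * t) * level_sq a k)"
        using elim by (intro mult_right_mono) (auto simp: level_sq_nonneg)
      finally show ?case by simp
    qed
  qed
qed

lemma hermite_op_C_synth:
  assumes a: "rapid r a" "r > 0"
  shows "hermite_op_C (synth a) = synth (scale_eig 1 a)"
proof
  fix z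
  have "rapid (r / 2) (scale_eig 1 a)" by (rule rapid_scale[OF a(1)]) (use a in simp)
  then have "(\<lambda>N. \<Sum>k<N. block (scale_eig 1 a) k z) \<longlonglongrightarrow> synth (scale_eig 1 a) z"
    by (rule synth_pointwise) (use a in simp)
  then show "hermite_op_C (synth a) z = synth (scale_eig 1 a) z"
    using hermite_op_C_synth_pointwise[OF a, of z] unfolding hermite_op_C_partial_sum
    by (metis LIMSEQ_unique)
qed

lemma scale_eig_Suc: "scale_eig (Suc m) a = scale_eig 1 (scale_eig m a)"
  by (simp add: scale_eig_def fun_eq_iff)

lemma hermite_op_C_power_synth:
  assumes a: "rapid r a" "r > 0"
  shows "(hermite_op_C ^^ m) (synth a) = synth (scale_eig m a)"
proof (induction m)
  case 0 show ?case by (simp add: scale_eig_def)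
next
  case (Suc m)
  have "rapid (r / 2) (scale_eig m a)" by (rule rapid_scale[OF a(1)]) (use a in simp)
  then have "hermite_op_C (synth (scale_eig m a)) = synth (scale_eig 1 (scale_eig m a))"
    by (rule hermite_op_C_synth) (use a in simp)
  then show ?case using Suc by (simp only: funpow.simps o_apply scale_eig_Suc[of m])
qed

subsection \<open>Isometry on coefficients\<close>

text \<open>The partial sums converge both pointwise and, by orthogonality, in mean square.\<close>

lemma synth_isometry:
  fixes a :: "('n::finite \<Rightarrow> nat) \<Rightarrow> complex"
  assumes a: "rapid r a" and r: "r > 0"
  shows "synth a \<in> sqi (gauss_measure r)"
    and "(\<lambda>k. iso_const TYPE('n) * (exp (2 * eigval TYPE('n) k * r) * level_sq a k)) sums nsq (gauss_measure r) (synth a)"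
    and "ip (gauss_measure r) (synth a) (PhiC \<alpha>) = a \<alpha> * of_real (iso_const TYPE('n) * exp (2 * eigval TYPE('n) (mdeg \<alpha>) * r))"
proof -
  interpret H: orth_family "gauss_measure r" "PhiC :: ('n \<Rightarrow> nat) \<Rightarrow> _" "\<lambda>\<alpha>. iso_const TYPE('n) * exp (2 * eigval TYPE('n) (mdeg \<alpha>) * r)"
    by (rule orth_family_plane[OF r])
  interpret B: orth_seq "gauss_measure r" "block a"
    unfolding block_def[abs_def] by (rule H.orth_seq_blocks) (auto simp: level_disjoint)
  have nb: "nsq (gauss_measure r) (block a k) = iso_const TYPE('n) * (exp (2 * eigval TYPE('n) k * r) * level_sq a k)" for k
    unfolding block_def[abs_def] H.nsq_comb[OF finite_level] level_sq_def sum_distrib_left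
    by (intro sum.cong refl) (simp add: level_def mult_ac)
  have summ: "summable (\<lambda>k. nsq (gauss_measure r) (block a k))"
    unfolding nb using a unfolding rapid_def by (rule summable_mult)
  have meas: "synth a \<in> borel_measurable (gauss_measure r)"
    using entire_measurable[OF entire_synth[OF a r]] by (simp add: measurable_cong_sets[OF sets_gauss_measure refl])
  show s: "synth a \<in> sqi (gauss_measure r)"
    by (rule B.nsq_convergence(1)[OF summ meas strict_mono_id]) (simp add: synth_pointwise[OF a r])
  have lim: "(\<lambda>N. nsq (gauss_measure r) (\<lambda>x. synth a x - (\<Sum>k<N. block a k x))) \<longlonglongrightarrow> 0"
    by (rule B.nsq_convergence(2)[OF summ meas strict_mono_id]) (simp add: synth_pointwise[OF a r])
  show "(\<lambda>k. iso_const TYPE('n) * (exp (2 * eigval TYPE('n) k * r) * level_sq a k)) sums nsq (gauss_measure r) (synth a)"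
    unfolding nb[symmetric]
    by (rule B.nsq_convergence(3)[OF summ meas strict_mono_id]) (simp add: synth_pointwise[OF a r])
  have "(\<lambda>N. ip (gauss_measure r) (\<lambda>x. \<Sum>k<N. block a k x) (PhiC \<alpha>)) \<longlonglongrightarrow> ip (gauss_measure r) (synth a) (PhiC \<alpha>)"
    by (rule ip_tendsto_left[OF s _ H.phi_sqi lim]) (intro sqi_sum B.q_sqi)
  moreover have "\<forall>\<^sub>F N in sequentially. ip (gauss_measure r) (\<lambda>x. \<Sum>k<N. block a k x) (PhiC \<alpha>) = a \<alpha> * of_real (iso_const TYPE('n) * exp (2 * eigval TYPE('n) (mdeg \<alpha>) * r))"
    unfolding eventually_sequentially
  proof (intro exI allI impI)
    fix N assume "Suc (mdeg \<alpha>) \<le> N"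
    then show "ip (gauss_measure r) (\<lambda>x. \<Sum>k<N. block a k x) (PhiC \<alpha>) = a \<alpha> * of_real (iso_const TYPE('n) * exp (2 * eigval TYPE('n) (mdeg \<alpha>) * r))"
      unfolding block_def sum_levels by (subst H.ip_comb_phi[OF finite_mdeg_less]) auto
  qed
  ultimately show "ip (gauss_measure r) (synth a) (PhiC \<alpha>) = a \<alpha> * of_real (iso_const TYPE('n) * exp (2 * eigval TYPE('n) (mdeg \<alpha>) * r))"
    by (rule LIMSEQ_unique[OF _ tendsto_eventually])
qed

section \<open>The reproducing property\<close>

subsection \<open>Rotations preserve Lebesgue measure\<close>

text \<open>On every line parallel to the first axis the shear is a translation.\<close>

lemma nn_integral_shear_fst:
  fixes f :: "real \<times> real \<Rightarrow> ennreal"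
  assumes [measurable]: "f \<in> borel_measurable (lborel \<Otimes>\<^sub>M lborel)"
  shows "(\<integral>\<^sup>+p. f (fst p + a * snd p, snd p) \<partial>(lborel \<Otimes>\<^sub>M lborel)) = (\<integral>\<^sup>+p. f p \<partial>(lborel \<Otimes>\<^sub>M lborel))"
proof -
  have "(\<integral>\<^sup>+p. f (fst p + a * snd p, snd p) \<partial>(lborel \<Otimes>\<^sub>M lborel)) = (\<integral>\<^sup>+y. (\<integral>\<^sup>+x. f (x + a * y, y) \<partial>lborel) \<partial>lborel)"
    by (subst lborel_pair.nn_integral_snd[symmetric]) auto
  also have "\<dots> = (\<integral>\<^sup>+y. (\<integral>\<^sup>+x. f (x, y) \<partial>lborel) \<partial>lborel)"
  proof (rule nn_integral_cong)
    fix y show "(\<integral>\<^sup>+x. f (x + a * y, y) \<partial>lborel) = (\<integral>\<^sup>+x. f (x, y) \<partial>lborel)"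
      using nn_integral_real_affine[of "\<lambda>x. f (x, y)" 1 "a * y"] by (simp add: add.commute)
  qed
  also have "\<dots> = (\<integral>\<^sup>+p. f p \<partial>(lborel \<Otimes>\<^sub>M lborel))"
    by (rule lborel_pair.nn_integral_snd) measurable
  finally show ?thesis .
qed

lemma nn_integral_shear_snd:
  fixes f :: "real \<times> real \<Rightarrow> ennreal"
  assumes [measurable]: "f \<in> borel_measurable (lborel \<Otimes>\<^sub>M lborel)"
  shows "(\<integral>\<^sup>+p. f (fst p, snd p + a * fst p) \<partial>(lborel \<Otimes>\<^sub>M lborel)) = (\<integral>\<^sup>+p. f p \<partial>(lborel \<Otimes>\<^sub>M lborel))"
proof -
  have "(\<integral>\<^sup>+p. f (fst p, snd p + a * fst p) \<partial>(lborel \<Otimes>\<^sub>M lborel)) = (\<integral>\<^sup>+x. (\<integral>\<^sup>+y. f (x, y + a * x) \<partial>lborel) \<partial>lborel)"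
    by (subst lborel.nn_integral_fst[symmetric]) auto
  also have "\<dots> = (\<integral>\<^sup>+x. (\<integral>\<^sup>+y. f (x, y) \<partial>lborel) \<partial>lborel)"
  proof (rule nn_integral_cong)
    fix x show "(\<integral>\<^sup>+y. f (x, y + a * x) \<partial>lborel) = (\<integral>\<^sup>+y. f (x, y) \<partial>lborel)"
      using nn_integral_real_affine[of "\<lambda>y. f (x, y)" 1 "a * x"] by (simp add: add.commute)
  qed
  also have "\<dots> = (\<integral>\<^sup>+p. f p \<partial>(lborel \<Otimes>\<^sub>M lborel))"
    by (rule lborel.nn_integral_fst) measurable
  finally show ?thesis .
qed

text \<open>A rotation of the plane is a composition of three shears.\<close>

lemma nn_integral_rotate_aux:
  fixes f :: "complex \<Rightarrow> ennreal"
  assumes [measurable]: "f \<in> borel_measurable borel" and \<eta>: "cmod \<eta> = 1" "Re \<eta> \<ge> 0"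
  shows "(\<integral>\<^sup>+z. f (\<eta> * z) \<partial>lborel) = (\<integral>\<^sup>+z. f z \<partial>lborel)"
proof -
  define c where "c = Re \<eta>"
  define s where "s = Im \<eta>"
  have cs: "c\<^sup>2 + s\<^sup>2 = 1" using \<eta>(1) by (simp add: c_def s_def cmod_def)
  have c: "1 + c > 0" using \<eta>(2) by (simp add: c_def)
  \<comment> \<open>for \<open>\<eta> = cis \<theta>\<close> the shears have the parameters \<open>a = - tan (\<theta> / 2)\<close>, \<open>s = sin \<theta>\<close> and again \<open>a\<close>;
    the condition on \<open>Re \<eta>\<close> keeps the denominator away from zero\<close>
  define a where "a = - s / (1 + c)"
  have sa: "1 + s * a = c" "a * (1 + c) = - s" "a + a * c = - s"
  proof -
    have "(1 + s * a) * (1 + c) = 1 + c - s\<^sup>2" using c by (simp add: a_def field_simps power2_eq_square)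
    also have "\<dots> = c * (1 + c)" using cs by (simp add: power2_eq_square algebra_simps)
    finally show "1 + s * a = c" using c by simp
    show "a * (1 + c) = - s" using c by (simp add: a_def)
    then show "a + a * c = - s" by (simp add: algebra_simps)
  qed
  define g where "g p = f (Complex (fst p) (snd p))" for p
  have g[measurable]: "g \<in> borel_measurable (lborel \<Otimes>\<^sub>M lborel)"
  proof -
    have "(\<lambda>p. case p of (x, y) \<Rightarrow> Complex x y) \<in> borel_measurable (lborel \<Otimes>\<^sub>M lborel)" by measurable
    then have [measurable]: "(\<lambda>p. Complex (fst p) (snd p)) \<in> borel_measurable (lborel \<Otimes>\<^sub>M lborel)" by (simp add: case_prod_beta')
    show ?thesis unfolding g_def by measurable
  qed
  have nn: "(\<integral>\<^sup>+z. h z \<partial>lborel) = (\<integral>\<^sup>+p. h (Complex (fst p) (snd p)) \<partial>(lborel \<Otimes>\<^sub>M lborel))"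
    if [measurable]: "h \<in> borel_measurable borel" for h :: "complex \<Rightarrow> ennreal"
    by (subst lborel_complex, subst nn_integral_distr) (auto simp: case_prod_beta')
  define g1 where "g1 p = g (fst p + a * snd p, snd p)" for p
  define g2 where "g2 p = g1 (fst p, snd p + s * fst p)" for p
  have [measurable]: "g1 \<in> borel_measurable (lborel \<Otimes>\<^sub>M lborel)" unfolding g1_def by measurable
  have [measurable]: "g2 \<in> borel_measurable (lborel \<Otimes>\<^sub>M lborel)" unfolding g2_def by measurable
  have "f (\<eta> * Complex x y) = g2 (x + a * y, y)" for x y
  proof -
    have y1: "y + s * (x + a * y) = s * x + c * y" using sa(1) by (simp add: algebra_simps) (metis distrib_left mult.commute mult.left_commute mult_1_right)
    have x2: "(x + a * y) + a * (s * x + c * y) = c * x - s * y"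
    proof -
      have "(x + a * y) + a * (s * x + c * y) = (1 + s * a) * x + (a + a * c) * y" by (simp add: algebra_simps)
      then show ?thesis unfolding sa by simp
    qed
    have "\<eta> * Complex x y = Complex (c * x - s * y) (s * x + c * y)"
      by (simp add: complex_eq_iff c_def s_def)
    then show ?thesis unfolding g2_def g1_def g_def by (simp only: fst_conv snd_conv y1 x2)
  qed
  then have "(\<integral>\<^sup>+z. f (\<eta> * z) \<partial>lborel) = (\<integral>\<^sup>+p. g2 (fst p + a * snd p, snd p) \<partial>(lborel \<Otimes>\<^sub>M lborel))"
    by (subst nn) simp_all
  also have "\<dots> = (\<integral>\<^sup>+p. g2 p \<partial>(lborel \<Otimes>\<^sub>M lborel))" by (rule nn_integral_shear_fst) measurable
  also have "\<dots> = (\<integral>\<^sup>+p. g1 p \<partial>(lborel \<Otimes>\<^sub>M lborel))" unfolding g2_def by (rule nn_integral_shear_snd) measurable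
  also have "\<dots> = (\<integral>\<^sup>+p. g p \<partial>(lborel \<Otimes>\<^sub>M lborel))" unfolding g1_def by (rule nn_integral_shear_fst) measurable
  also have "\<dots> = (\<integral>\<^sup>+z. f z \<partial>lborel)" unfolding g_def by (rule nn[symmetric]) measurable
  finally show ?thesis .
qed

text \<open>Rotations by an angle beyond a quarter turn are squares of smaller ones.\<close>

lemma nn_integral_rotate:
  fixes f :: "complex \<Rightarrow> ennreal"
  assumes [measurable]: "f \<in> borel_measurable borel" and \<zeta>: "cmod \<zeta> = 1"
  shows "(\<integral>\<^sup>+z. f (\<zeta> * z) \<partial>lborel) = (\<integral>\<^sup>+z. f z \<partial>lborel)"
proof -
  define \<eta> where "\<eta> = csqrt \<zeta>"
  have e2: "\<eta> * \<eta> = \<zeta>" using power2_csqrt[of \<zeta>] by (simp add: \<eta>_def power2_eq_square)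
  have "cmod \<eta> * cmod \<eta> = 1" using \<zeta> by (simp flip: norm_mult add: e2)
  then have \<eta>: "cmod \<eta> = 1" by (metis abs_norm_cancel real_sqrt_abs2 real_sqrt_one)
  have re: "Re \<eta> \<ge> 0" using Re_csqrt[of \<zeta>] by (simp add: \<eta>_def)
  have "(\<integral>\<^sup>+z. f (\<zeta> * z) \<partial>lborel) = (\<integral>\<^sup>+z. f (\<eta> * (\<eta> * z)) \<partial>lborel)"
    by (simp add: e2[symmetric] mult.assoc)
  also have "\<dots> = (\<integral>\<^sup>+z. f (\<eta> * z) \<partial>lborel)"
    by (rule nn_integral_rotate_aux[of "\<lambda>z. f (\<eta> * z)", OF _ \<eta> re]) measurable
  also have "\<dots> = (\<integral>\<^sup>+z. f z \<partial>lborel)" by (rule nn_integral_rotate_aux[OF _ \<eta> re]) measurable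
  finally show ?thesis .
qed

lemma vec_scalar_measurable[measurable]: "(\<lambda>z::complex^'n::finite. \<zeta> *s z) \<in> borel_measurable borel"
  unfolding vector_scalar_mult_def by (intro borel_measurable_continuous_onI continuous_intros)

lemma lborel_rotate:
  assumes \<zeta>: "cmod \<zeta> = 1"
  shows "distr lborel borel (\<lambda>z::complex^'n::finite. \<zeta> *s z) = lborel"
proof (rule lborel_eqI[symmetric])
  interpret product_sigma_finite "\<lambda>_::'n. lborel :: complex measure" ..
  fix l u :: "complex^'n"
  assume le: "\<And>b. b \<in> Basis \<Longrightarrow> l \<bullet> b \<le> u \<bullet> b"
  define B where "B i = (\<lambda>z. \<zeta> * z) -` box (l $ i) (u $ i)" for i
  have Bm[measurable]: "B i \<in> sets borel" for i
  proof -
    have "(\<lambda>z. \<zeta> * z) -` box (l $ i) (u $ i) \<inter> space borel \<in> sets borel"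
      by (rule measurable_sets[where A=borel]) auto
    then show ?thesis by (simp add: B_def)
  qed
  have em: "emeasure lborel (B i) = emeasure lborel (box (l $ i) (u $ i))" for i
  proof -
    have "emeasure lborel (B i) = (\<integral>\<^sup>+z. indicator (box (l $ i) (u $ i)) (\<zeta> * z) \<partial>lborel)"
    proof -
      have "emeasure lborel (B i) = (\<integral>\<^sup>+z. indicator (B i) z \<partial>lborel)" using Bm by simp
      also have "\<dots> = (\<integral>\<^sup>+z. indicator (box (l $ i) (u $ i)) (\<zeta> * z) \<partial>lborel)"
        by (intro nn_integral_cong) (auto simp: B_def indicator_def)
      finally show ?thesis .
    qed
    also have "\<dots> = (\<integral>\<^sup>+z. indicator (box (l $ i) (u $ i)) z \<partial>lborel)" by (rule nn_integral_rotate[OF _ \<zeta>]) auto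
    finally show ?thesis by simp
  qed
  have inb: "w \<in> box l u \<longleftrightarrow> (\<forall>i. w $ i \<in> box (l $ i) (u $ i))" for w
    by (auto simp: mem_box Basis_vec_def inner_axis)
  have pre: "(\<lambda>f. \<chi> i. f i) -` ((\<lambda>z. \<zeta> *s z) -` box l u) \<inter> space (Pi\<^sub>M UNIV (\<lambda>_. lborel)) = Pi\<^sub>E UNIV B"
    by (auto simp: inb B_def space_PiM PiE_UNIV_domain Pi_iff)
  have pre': "(\<lambda>f. \<chi> i. f i) -` box l u \<inter> space (Pi\<^sub>M UNIV (\<lambda>_. lborel)) = Pi\<^sub>E UNIV (\<lambda>i. box (l $ i) (u $ i))"
    by (auto simp: inb space_PiM PiE_UNIV_domain Pi_iff)
  have ms: "(\<lambda>z. \<zeta> *s z) -` box l u \<in> sets borel"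
    using measurable_sets[OF vec_scalar_measurable[of \<zeta>, where 'n='n], of "box l u"] by simp
  have "emeasure (distr lborel borel (\<lambda>z::complex^'n. \<zeta> *s z)) (box l u) = emeasure lborel ((\<lambda>z. \<zeta> *s z) -` box l u)"
    by (subst emeasure_distr) auto
  also have "\<dots> = emeasure (Pi\<^sub>M UNIV (\<lambda>_. lborel)) (Pi\<^sub>E UNIV B)"
    by (subst lborel_vec, subst emeasure_distr) (use ms in \<open>auto simp: pre\<close>)
  also have "\<dots> = (\<Prod>i\<in>UNIV. emeasure lborel (box (l $ i) (u $ i)))"
    by (subst emeasure_PiM) (auto simp: em)
  also have "\<dots> = emeasure (Pi\<^sub>M UNIV (\<lambda>_. lborel)) (Pi\<^sub>E UNIV (\<lambda>i. box (l $ i) (u $ i)))"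
    by (subst emeasure_PiM) auto
  also have "\<dots> = emeasure lborel (box l u)"
    by (subst lborel_vec, subst emeasure_distr) (auto simp: pre')
  also have "\<dots> = ennreal (\<Prod>b\<in>Basis. (u - l) \<bullet> b)"
    by (rule emeasure_lborel_box) (rule le)
  finally show "emeasure (distr lborel borel (\<lambda>z::complex^'n. \<zeta> *s z)) (box l u) = ennreal (\<Prod>b\<in>Basis. (u - l) \<bullet> b)" .
qed simp

subsection \<open>The mean value property\<close>

lemma circle_mean:
  assumes f: "f holomorphic_on UNIV"
  shows "((\<lambda>t. f (exp (2 * of_real pi * \<i> * of_real t))) has_integral f 0) {0..1}"
proof -
  have "((\<lambda>u. f u / (u - 0)) has_contour_integral (2 * of_real pi * \<i> * f 0)) (circlepath 0 1)"
    by (rule Cauchy_integral_circlepath_simple) (auto intro: holomorphic_on_subset[OF f])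
  then have "((\<lambda>t. f (circlepath 0 1 t) / (circlepath 0 1 t - 0) * vector_derivative (circlepath 0 1) (at t within {0..1})) has_integral (2 * of_real pi * \<i> * f 0)) {0..1}"
    unfolding has_contour_integral_def .
  then have "((\<lambda>t. (2 * of_real pi * \<i>) * f (exp (2 * of_real pi * \<i> * of_real t))) has_integral (2 * of_real pi * \<i> * f 0)) {0..1}"
    by (rule has_integral_eq[rotated]) (simp add: vector_derivative_circlepath01, simp add: circlepath)
  then have "((\<lambda>t. inverse (2 * of_real pi * \<i>) * ((2 * of_real pi * \<i>) * f (exp (2 * of_real pi * \<i> * of_real t)))) has_integral inverse (2 * of_real pi * \<i>) * (2 * of_real pi * \<i> * f 0)) {0..1}"
    by (rule has_integral_mult_right)
  then show ?thesis by (simp add: field_simps)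
qed

lemma circle_mean_lebesgue:
  assumes f: "f holomorphic_on UNIV"
  shows "(LINT t|lborel. indicator {0..1} t *\<^sub>R f (exp (2 * of_real pi * \<i> * of_real t))) = f 0"
proof -
  have "continuous_on {0..1} (\<lambda>t. f (exp (2 * of_real pi * \<i> * complex_of_real t)))"
    by (intro continuous_on_compose2[OF holomorphic_on_imp_continuous_on[OF f]] continuous_intros) auto
  from set_borel_integral_eq_integral(2)[OF borel_integrable_atLeastAtMost'[OF this]]
  show ?thesis using circle_mean[OF f] by (simp add: set_lebesgue_integral_def has_integral_iff)
qed

text \<open>Averaging a weighted integral over the rotations \<open>z \<mapsto> exp (2 \<pi> i t) z\<close> replaces the
  entire function by its value at the origin.\<close>

lemma radial_mean_value:
  fixes G :: "complex^'n::finite \<Rightarrow> complex"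
  assumes G: "entire G" and \<phi>[measurable]: "\<phi> \<in> borel_measurable borel"
    and int: "integrable lborel (\<lambda>z. G z * of_real (\<phi> (norm z)))"
  shows "(LINT z|lborel. G z * of_real (\<phi> (norm z))) = G 0 * of_real (LINT z|(lborel :: (complex^'n) measure). \<phi> (norm z))"
proof -
  define e where "e t = exp (2 * of_real pi * \<i> * complex_of_real t)" for t
  have e1: "cmod (e t) = 1" for t by (simp add: e_def norm_exp_eq_Re)
  have Gm[measurable]: "G \<in> borel_measurable borel" by (rule entire_measurable[OF G])
  define g where "g z = G z * of_real (\<phi> (norm z))" for z
  have gm[measurable]: "g \<in> borel_measurable borel" unfolding g_def by measurable
  have rot_int: "integrable lborel (\<lambda>z. g (e t *s z))" for t
  proof -
    have "integrable (distr lborel borel (\<lambda>z::complex^'n. e t *s z)) g"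
      unfolding lborel_rotate[OF e1] using int by (simp only: g_def[symmetric])
    then show ?thesis by (subst (asm) integrable_distr_eq) auto
  qed
  have rot: "(LINT z|lborel. g (e t *s z)) = (LINT z|lborel. g z)" for t
    by (subst (2) lborel_rotate[OF e1[of t], symmetric], subst integral_distr) auto
  have rotn: "(LINT z|lborel. norm (g (e t *s z))) = (LINT z|lborel. norm (g z))" for t
    by (subst (2) lborel_rotate[OF e1[of t], symmetric], subst integral_distr) auto
  have gn: "g (e t *s z) = G (e t *s z) * of_real (\<phi> (norm z))" for t z
    by (simp add: g_def norm_vector_scalar_mult e1)
  define k where "k t z = indicator {0..1} t *\<^sub>R g (e t *s z)" for t :: real and z
  have em: "(\<lambda>p. e (fst p) *s snd p) \<in> borel_measurable (borel :: (real \<times> (complex^'n)) measure)"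
    unfolding e_def vector_scalar_mult_def by (intro borel_measurable_continuous_onI continuous_intros)
  have "case_prod k \<in> borel_measurable (borel :: (real \<times> (complex^'n)) measure)"
  proof -
    have "(\<lambda>p::real \<times> (complex^'n). indicator {0..1} (fst p) *\<^sub>R g (e (fst p) *s snd p)) \<in> borel_measurable borel"
    proof (rule borel_measurable_scaleR)
      show "(\<lambda>p::real \<times> (complex^'n). g (e (fst p) *s snd p)) \<in> borel_measurable borel"
        using em by (rule measurable_compose) measurable
      have "(\<lambda>p::real \<times> (complex^'n). fst p) \<in> borel_measurable borel"
        by (intro borel_measurable_continuous_onI continuous_intros)
      then show "(\<lambda>p::real \<times> (complex^'n). indicator {0..1} (fst p) :: real) \<in> borel_measurable borel" by measurable
    qed
    then show ?thesis by (simp add: k_def case_prod_beta')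
  qed
  then have km: "case_prod k \<in> borel_measurable (lborel \<Otimes>\<^sub>M lborel)" by (simp add: lborel_prod)
  have ik: "integrable (lborel \<Otimes>\<^sub>M lborel) (case_prod k)"
  proof (rule lborel_pair.Fubini_integrable[OF km])
    have "(LINT z|lborel. norm (case_prod k (t, z))) = indicator {0..1} t *\<^sub>R (LINT z|lborel. norm (g z))" for t
      by (simp add: k_def rotn)
    then show "integrable lborel (\<lambda>t. LINT z|lborel. norm (case_prod k (t, z)))"
      by (simp add: integrable_real_indicator)
    show "AE t in lborel. integrable lborel (\<lambda>z. case_prod k (t, z))"
      by (simp add: k_def rot_int)
  qed
  have "(LINT z|lborel. g z) = (LINT t|(lborel :: real measure). indicator {0..1} t *\<^sub>R (LINT z|lborel. g z))" by simp
  also have "\<dots> = (LINT t|lborel. (LINT z|lborel. k t z))" by (simp add: k_def rot)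
  also have "\<dots> = (LINT z|lborel. (LINT t|lborel. k t z))"
    by (rule lborel_pair.Fubini_integral[OF ik, symmetric])
  also have "\<dots> = (LINT z|(lborel :: (complex^'n) measure). G 0 * of_real (\<phi> (norm z)))"
  proof (intro Bochner_Integration.integral_cong refl)
    fix z :: "complex^'n"
    have "(LINT t|lborel. k t z) = (LINT t|lborel. (indicator {0..1} t *\<^sub>R G (0 + exp (2 * of_real pi * \<i> * of_real t) *s z)) * of_real (\<phi> (norm z)))"
      unfolding k_def gn by (simp add: e_def)
    also have "\<dots> = (LINT t|lborel. indicator {0..1} t *\<^sub>R G (0 + exp (2 * of_real pi * \<i> * of_real t) *s z)) * of_real (\<phi> (norm z))"
      by (rule integral_mult_left_zero)
    also have "(LINT t|lborel. indicator {0..1} t *\<^sub>R G (0 + exp (2 * of_real pi * \<i> * of_real t) *s z)) = G (0 + 0 *s z)"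
      by (rule circle_mean_lebesgue[where f="\<lambda>\<zeta>. G (0 + \<zeta> *s z)"]) (rule entire_line_holomorphic[OF G])
    finally show "(LINT t|lborel. k t z) = G 0 * of_real (\<phi> (norm z))" by simp
  qed
  finally show ?thesis by (simp add: g_def)
qed

subsection \<open>Mehler's kernel reproduces\<close>

definition bdot :: "complex^'n \<Rightarrow> complex^'n \<Rightarrow> complex" where
  "bdot z w = (\<Sum>j\<in>UNIV. z $ j * w $ j)"

lemma bdot_has_derivative: "((\<lambda>z. bdot z w) has_derivative (\<lambda>v. bdot v w)) (at z)"
  unfolding bdot_def[abs_def]
  by (intro has_derivative_sum has_derivative_mult_left bounded_linear_imp_has_derivative[OF bounded_linear_vec_nth])

lemma bdot_self_has_derivative: "((\<lambda>z. bdot z z) has_derivative (\<lambda>v. 2 * bdot z v)) (at z)"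
proof -
  have "((\<lambda>z. bdot z z) has_derivative (\<lambda>v. \<Sum>j\<in>UNIV. z $ j * v $ j + v $ j * z $ j)) (at z)"
    unfolding bdot_def[abs_def]
    by (intro has_derivative_sum has_derivative_mult bounded_linear_imp_has_derivative[OF bounded_linear_vec_nth])
  then show ?thesis by (simp add: bdot_def sum_distrib_left mult.commute)
qed

lemma bdot_scale: "bdot x (c *s v) = c * bdot x v" "bdot (c *s v) u = c * bdot v u"
  by (simp_all add: bdot_def sum_distrib_left mult_ac)

lemma entire_exp_quadratic:
  fixes w u :: "complex^'n"
  shows "entire (\<lambda>z. exp (a * bdot (z + w) (z + w) + b * bdot z u))"
  unfolding entire_def
proof
  fix z :: "complex^'n"
  have "((\<lambda>z. z + w) has_derivative (\<lambda>v. v)) (at z)" by (auto intro!: derivative_eq_intros)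
  from diff_chain_at[OF this bdot_self_has_derivative[of "z + w"]]
  have "((\<lambda>z. bdot (z + w) (z + w)) has_derivative (\<lambda>v. 2 * bdot (z + w) v)) (at z)"
    by (simp add: o_def)
  then have "((\<lambda>z. a * bdot (z + w) (z + w) + b * bdot z u) has_derivative (\<lambda>v. a * (2 * bdot (z + w) v) + b * bdot v u)) (at z)"
    by (intro has_derivative_add has_derivative_mult_right bdot_has_derivative)
  from diff_chain_at[OF this DERIV_exp[unfolded has_field_derivative_def]]
  have "((\<lambda>z. exp (a * bdot (z + w) (z + w) + b * bdot z u)) has_derivative
     (\<lambda>v. exp (a * bdot (z + w) (z + w) + b * bdot z u) * (a * (2 * bdot (z + w) v) + b * bdot v u))) (at z)"
    by (simp add: o_def)
  then show "\<exists>D. ((\<lambda>z. exp (a * bdot (z + w) (z + w) + b * bdot z u)) has_derivative D) (at z) \<and> (\<forall>c v. D (c *s v) = c * D v)"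
    by (intro exI conjI, assumption) (simp add: bdot_scale algebra_simps)
qed

lemma entire_mult:
  assumes "entire F" "entire G" shows "entire (\<lambda>z. F z * G z)"
  unfolding entire_def
proof
  fix z
  obtain D E where D: "(F has_derivative D) (at z)" "\<And>c v. D (c *s v) = c * D v"
    "(G has_derivative E) (at z)" "\<And>c v. E (c *s v) = c * E v"
    using assms unfolding entire_def by metis
  have "((\<lambda>z. F z * G z) has_derivative (\<lambda>v. F z * E v + D v * G z)) (at z)"
    by (rule has_derivative_mult[OF D(1,3)])
  then show "\<exists>D. ((\<lambda>z. F z * G z) has_derivative D) (at z) \<and> (\<forall>c v. D (c *s v) = c * D v)"
    by (intro exI conjI, assumption) (simp add: D algebra_simps)
qed

lemma entire_translate:
  assumes "entire F" shows "entire (\<lambda>z. F (z + w))"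
  unfolding entire_def
proof
  fix z
  obtain D where D: "(F has_derivative D) (at (z + w))" "\<And>c v. D (c *s v) = c * D v"
    using assms unfolding entire_def by metis
  have "((\<lambda>z. z + w) has_derivative (\<lambda>v. v)) (at z)" by (auto intro!: derivative_eq_intros)
  from diff_chain_at[OF this D(1)] have "((\<lambda>z. F (z + w)) has_derivative D) (at z)"
    by (simp add: o_def)
  then show "\<exists>D. ((\<lambda>z. F (z + w)) has_derivative D) (at z) \<and> (\<forall>c v. D (c *s v) = c * D v)"
    using D(2) by blast
qed

lemma integral_gauss_vec:
  assumes \<sigma>: "\<sigma> > 0"
  shows "(LINT z|(lborel :: (complex^'n::finite) measure). exp (- ((norm z)\<^sup>2 / \<sigma>))) = (pi * \<sigma>) ^ CARD('n)"
proof -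
  have eq: "exp (- ((norm z)\<^sup>2 / \<sigma>)) = (\<Prod>j\<in>UNIV. gauss2 (1 / \<sigma>) (1 / \<sigma>) (z $ j))" for z :: "complex^'n"
  proof -
    have "(norm z)\<^sup>2 = (\<Sum>j\<in>UNIV. (Re (z $ j))\<^sup>2 + (Im (z $ j))\<^sup>2)"
      by (simp add: norm_vec_def L2_set_def sum_nonneg cmod_power2)
    then have "- ((norm z)\<^sup>2 / \<sigma>) = (\<Sum>j\<in>UNIV. - (1 / \<sigma> * (Re (z $ j))\<^sup>2) - 1 / \<sigma> * (Im (z $ j))\<^sup>2)"
      by (simp add: sum_divide_distrib sum_negf[symmetric] add_divide_distrib)
    then show ?thesis by (simp add: gauss2_def exp_sum)
  qed
  have "(LINT z|(lborel :: (complex^'n) measure). exp (- ((norm z)\<^sup>2 / \<sigma>))) = (\<Prod>j\<in>(UNIV::'n set). LINT z|lborel. gauss2 (1 / \<sigma>) (1 / \<sigma>) z)"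
    unfolding eq using integral_vec_prod[of "\<lambda>j::'n. gauss2 (1 / \<sigma>) (1 / \<sigma>)"] integrable_gauss2(1)[of "1 / \<sigma>" "1 / \<sigma>"] \<sigma> by simp
  also have "(LINT z|lborel. gauss2 (1 / \<sigma>) (1 / \<sigma>) z) = pi * \<sigma>"
    using integrable_gauss2(2)[of "1 / \<sigma>" "1 / \<sigma>"] \<sigma> by (simp add: real_sqrt_mult real_sqrt_divide)
  finally show ?thesis by simp
qed

text \<open>The choice \<open>\<rho> = exp (- 4 * t)\<close> makes the quadratic terms of the weight and of the conjugate kernel fit:
all terms that are not holomorphic in \<open>z\<close> combine to \<open>\<bar>z - w\<bar>\<^sup>2\<close>. The remaining exponent is a polynomial
in \<open>z\<close> that vanishes at \<open>w\<close>.\<close>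

lemma mehler_weight:
  assumes t: "t > 0"
  defines "\<sigma> \<equiv> sinh (4 * t)" and "c \<equiv> cosh (4 * t) / sinh (4 * t)"
  shows "cnj (mehler (exp (- 4 * t)) z (cnj w)) * of_real (weight_u t z)
    = of_real (sqrt (2 * pi) * exp (2 * t) / (pi * \<sigma>)) * (exp (of_real (c / 2) * (z\<^sup>2 - w\<^sup>2) - of_real (1 / \<sigma>) * (z - w) * cnj w)
      * of_real (exp (- ((cmod (z - w))\<^sup>2 / \<sigma>))))"
proof -
  define \<rho> where "\<rho> = exp (- 4 * t)"
  define e where "e = exp (4 * t)"
  have e: "e > 1" "\<rho> = 1 / e" using t by (auto simp: e_def \<rho>_def exp_minus inverse_eq_divide)
  have s4: "sinh (4 * t) = (e - 1 / e) / 2" "cosh (4 * t) = (e + 1 / e) / 2"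
  proof -
    have e3: "exp (- (4 * t)) = 1 / e" by (simp add: e_def exp_minus inverse_eq_divide)
    show "sinh (4 * t) = (e - 1 / e) / 2" "cosh (4 * t) = (e + 1 / e) / 2"
      unfolding sinh_def cosh_def e3 e_def[symmetric] by simp_all
  qed
  have ee: "e * e > 1" using e(1) by (simp add: less_1_mult)
  have \<sigma>: "\<sigma> = (e * e - 1) / (2 * e)" unfolding \<sigma>_def s4 using e(1) by (simp add: field_simps)
  have \<sigma>pos: "\<sigma> > 0" unfolding \<sigma> using e(1) ee by simp
  have c: "c = (e * e + 1) / (e * e - 1)"
  proof -
    have "c = ((e * e + 1) / (2 * e)) / ((e * e - 1) / (2 * e))"
      unfolding c_def s4 using e(1) by (simp add: field_simps)
    then show ?thesis using e(1) by simp
  qed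
  have r2: "1 - \<rho>\<^sup>2 = (e * e - 1) / (e * e)" "1 + \<rho>\<^sup>2 = (e * e + 1) / (e * e)"
    using e(1) by (simp_all add: e(2) field_simps power2_eq_square)
  have co1: "(1 + \<rho>\<^sup>2) / (2 * (1 - \<rho>\<^sup>2)) = c / 2" unfolding r2 c using e(1) ee by simp
  have co2: "2 * \<rho> / (1 - \<rho>\<^sup>2) = 1 / \<sigma>" unfolding r2 \<sigma> using e(1) ee by (simp add: e(2))
  have tn: "tanh (2 * t) = c - 1 / \<sigma>" "cosh (2 * t) / sinh (2 * t) = c + 1 / \<sigma>"
  proof -
    define f where "f = exp (2 * t)"
    have f: "f > 1" "e = f * f" "exp (- (2 * t)) = 1 / f" using t
      by (auto simp: f_def e_def exp_minus inverse_eq_divide simp flip: exp_add)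
    have ff: "f * f > 1" using f(1) by (simp add: less_1_mult)
    have s2: "sinh (2 * t) = (f * f - 1) / (2 * f)" "cosh (2 * t) = (f * f + 1) / (2 * f)"
      unfolding sinh_def cosh_def f(3) f_def[symmetric] using f(1) by (simp_all add: field_simps)
    have q: "e * e - 1 = (e - 1) * (e + 1)" by (simp add: algebra_simps)
    have nz: "e - 1 \<noteq> 0" "e + 1 \<noteq> 0" using e(1) by auto
    have "tanh (2 * t) = (e - 1) / (e + 1)" unfolding tanh_def s2 f(2)[symmetric] using f(1) by simp
    also have "\<dots> = (e - 1) * (e - 1) / (e * e - 1)" unfolding q using nz by simp
    also have "\<dots> = c - 1 / \<sigma>" unfolding c \<sigma> using e(1) ee by (simp add: diff_divide_distrib[symmetric] algebra_simps)
    finally show "tanh (2 * t) = c - 1 / \<sigma>" .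
    have "cosh (2 * t) / sinh (2 * t) = (e + 1) / (e - 1)" unfolding s2 f(2)[symmetric] using f(1) by simp
    also have "\<dots> = (e + 1) * (e + 1) / (e * e - 1)" unfolding q using nz by simp
    also have "\<dots> = c + 1 / \<sigma>" unfolding c \<sigma> using e(1) ee by (simp add: add_divide_distrib[symmetric] algebra_simps)
    finally show "cosh (2 * t) / sinh (2 * t) = c + 1 / \<sigma>" .
  qed
  have wu: "weight_u t z = 2 * \<sigma> powr (- (1 / 2)) * exp (c * ((Re z)\<^sup>2 - (Im z)\<^sup>2) - (cmod z)\<^sup>2 / \<sigma>)"
    unfolding weight_u_def tn cmod_power2 \<sigma>_def[symmetric] by (simp add: algebra_simps add_divide_distrib)
  have cr: "of_real (c * ((Re z)\<^sup>2 - (Im z)\<^sup>2) - (cmod z)\<^sup>2 / \<sigma>) = of_real (c / 2) * (z\<^sup>2 + (cnj z)\<^sup>2) - of_real (1 / \<sigma>) * (z * cnj z)"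
  proof -
    have "z\<^sup>2 + (cnj z)\<^sup>2 = of_real (2 * ((Re z)\<^sup>2 - (Im z)\<^sup>2))"
      by (simp add: complex_eq_iff power2_eq_square)
    then show ?thesis by (simp add: complex_norm_square[symmetric] del: of_real_power)
  qed
  have sw: "complex_of_real ((cmod (z - w))\<^sup>2) = z * cnj z - z * cnj w - w * cnj z + w * cnj w"
    unfolding complex_norm_square by (simp add: algebra_simps)
  have mh: "cnj (mehler \<rho> z (cnj w)) = of_real (1 / sqrt (pi * (1 - \<rho>\<^sup>2))) * exp (- (of_real (c / 2) * ((cnj z)\<^sup>2 + w\<^sup>2)) + of_real (1 / \<sigma>) * cnj z * w)"
    unfolding mehler_def co1 co2 by (simp add: exp_cnj del: of_real_divide)
  have "cnj (mehler \<rho> z (cnj w)) * of_real (weight_u t z)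
     = of_real (1 / sqrt (pi * (1 - \<rho>\<^sup>2)) * (2 * \<sigma> powr (- (1 / 2)))) *
       exp ((- (of_real (c / 2) * ((cnj z)\<^sup>2 + w\<^sup>2)) + of_real (1 / \<sigma>) * cnj z * w) + (of_real (c / 2) * (z\<^sup>2 + (cnj z)\<^sup>2) - of_real (1 / \<sigma>) * (z * cnj z)))"
    unfolding mh wu of_real_mult exp_of_real[symmetric] cr exp_add by (simp only: mult_ac)
  also have "(- (of_real (c / 2) * ((cnj z)\<^sup>2 + w\<^sup>2)) + of_real (1 / \<sigma>) * cnj z * w) + (of_real (c / 2) * (z\<^sup>2 + (cnj z)\<^sup>2) - of_real (1 / \<sigma>) * (z * cnj z))
     = (of_real (c / 2) * (z\<^sup>2 - w\<^sup>2) - of_real (1 / \<sigma>) * (z - w) * cnj w) + of_real (- ((cmod (z - w))\<^sup>2 / \<sigma>))"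
  proof -
    have "complex_of_real (- ((cmod (z - w))\<^sup>2 / \<sigma>)) = - (of_real (1 / \<sigma>) * (z * cnj z - z * cnj w - w * cnj z + w * cnj w))"
      unfolding sw[symmetric] by simp
    then show ?thesis by (simp add: algebra_simps del: of_real_divide)
  qed
  also have "1 / sqrt (pi * (1 - \<rho>\<^sup>2)) * (2 * \<sigma> powr (- (1 / 2))) = sqrt (2 * pi) * exp (2 * t) / (pi * \<sigma>)"
  proof -
    have "sqrt (exp (4 * t)) = exp (2 * t)"
      by (rule real_sqrt_unique) (auto simp flip: exp_double)
    then have et: "sqrt e = exp (2 * t)" by (simp add: e_def)
    have "1 - \<rho>\<^sup>2 = 2 * \<sigma> / e" unfolding r2 \<sigma> using e(1) by (simp add: field_simps)
    then have "sqrt (pi * (1 - \<rho>\<^sup>2)) = sqrt (2 * pi) * sqrt \<sigma> / exp (2 * t)"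
      using et by (simp add: real_sqrt_mult real_sqrt_divide mult_ac)
    then have S: "sqrt (pi * (1 - \<rho>\<^sup>2)) = sqrt (2 * pi) * sqrt \<sigma> / exp (2 * t)" .
    have P: "\<sigma> powr (- (1 / 2)) = 1 / sqrt \<sigma>"
      using \<sigma>pos by (simp add: powr_minus powr_half_sqrt inverse_eq_divide)
    have "1 / (A * B / E) * (2 * (1 / B)) = 2 * E / (A * (B * B))" for A B E :: real by (simp add: mult_ac)
    then have "1 / sqrt (pi * (1 - \<rho>\<^sup>2)) * (2 * \<sigma> powr (- (1 / 2))) = 2 * exp (2 * t) / (sqrt (2 * pi) * (sqrt \<sigma> * sqrt \<sigma>))"
      unfolding S P .
    also have "\<dots> = 2 * exp (2 * t) / (sqrt (2 * pi) * \<sigma>)" using \<sigma>pos by simp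
    also have "\<dots> = sqrt (2 * pi) * exp (2 * t) / (pi * \<sigma>)"
    proof -
      have "sqrt (2 * pi) * sqrt (2 * pi) = 2 * pi" by simp
      then have "2 * pi * exp (2 * t) * \<sigma> = sqrt (2 * pi) * sqrt (2 * pi) * exp (2 * t) * \<sigma>" by simp
      then show ?thesis using \<sigma>pos by (simp add: field_simps)
    qed
    finally show ?thesis .
  qed
  finally show ?thesis unfolding exp_add \<rho>_def[symmetric] exp_of_real by (simp only: mult.assoc)
qed

text \<open>By \<open>mehler_weight\<close> the integrand is, after a translation by \<open>w\<close>, an entire function times a radial
Gaussian, and the mean value property evaluates the entire function at the centre.\<close>

lemma mehlerN_reproducing:
  fixes F :: "complex^'n::finite \<Rightarrow> complex"
  assumes t: "t > 0" and F: "entire F"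
    and K: "(\<lambda>z. mehlerN (exp (- 4 * t)) z (cnj_vec w)) \<in> sqi (gauss_measure t)" and FF: "F \<in> sqi (gauss_measure t)"
  shows "ip (gauss_measure t) F (\<lambda>z. mehlerN (exp (- 4 * t)) z (cnj_vec w))
    = of_real (iso_const TYPE('n) * exp (2 * real CARD('n) * t)) * F w"
proof -
  define \<sigma> where "\<sigma> = sinh (4 * t)"
  define c where "c = cosh (4 * t) / sinh (4 * t)"
  have \<sigma>: "\<sigma> > 0" using t by (simp add: \<sigma>_def)
  define K0 where "K0 = (sqrt (2 * pi) * exp (2 * t) / (pi * \<sigma>)) ^ CARD('n)"
  \<comment> \<open>\<open>F\<close> times the holomorphic exponential, centred at \<open>w\<close>; the factor \<open>q\<close> removes the value of the
    exponential at the centre\<close>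
  define h where "h z = F (z + w) * exp (of_real (c / 2) * bdot (z + w) (z + w) + (- of_real (1 / \<sigma>)) * bdot z (cnj_vec w))" for z
  define q where "q = exp (- (of_real (c / 2) * bdot w w))"
  have h: "entire h" unfolding h_def by (intro entire_mult entire_translate entire_exp_quadratic F)
  have pt: "F z * cnj (mehlerN (exp (- 4 * t)) z (cnj_vec w)) * of_real (weight_U t z)
     = (of_real K0 * q) * (h (z - w) * of_real (exp (- ((norm (z - w))\<^sup>2 / \<sigma>))))" for z
  proof -
    have n: "(norm (z - w))\<^sup>2 = (\<Sum>j\<in>UNIV. (cmod (z $ j - w $ j))\<^sup>2)"
      by (simp add: norm_vec_def L2_set_def sum_nonneg)
    have "cnj (mehlerN (exp (- 4 * t)) z (cnj_vec w)) * of_real (weight_U t z)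
       = (\<Prod>j\<in>UNIV. cnj (mehler (exp (- 4 * t)) (z $ j) (cnj (w $ j))) * of_real (weight_u t (z $ j)))"
      by (simp add: mehlerN_def cnj_vec_def weight_U_eq prod.distrib)
    also have "\<dots> = (\<Prod>j\<in>UNIV. of_real (sqrt (2 * pi) * exp (2 * t) / (pi * \<sigma>)) * (exp (of_real (c / 2) * ((z $ j)\<^sup>2 - (w $ j)\<^sup>2) - of_real (1 / \<sigma>) * (z $ j - w $ j) * cnj (w $ j))
      * of_real (exp (- ((cmod (z $ j - w $ j))\<^sup>2 / \<sigma>)))))"
      unfolding mehler_weight[OF t] \<sigma>_def c_def ..
    also have "\<dots> = of_real K0 * (exp (\<Sum>j\<in>UNIV. of_real (c / 2) * ((z $ j)\<^sup>2 - (w $ j)\<^sup>2) - of_real (1 / \<sigma>) * (z $ j - w $ j) * cnj (w $ j))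
      * of_real (exp (\<Sum>j\<in>UNIV. - ((cmod (z $ j - w $ j))\<^sup>2 / \<sigma>))))"
      unfolding prod.distrib by (simp add: K0_def exp_sum del: of_real_divide of_real_mult)
    also have "(\<Sum>j\<in>UNIV. - ((cmod (z $ j - w $ j))\<^sup>2 / \<sigma>)) = - ((norm (z - w))\<^sup>2 / \<sigma>)"
      unfolding n by (simp add: sum_negf sum_divide_distrib)
    also have "(\<Sum>j\<in>UNIV. of_real (c / 2) * ((z $ j)\<^sup>2 - (w $ j)\<^sup>2) - of_real (1 / \<sigma>) * (z $ j - w $ j) * cnj (w $ j))
       = - (of_real (c / 2) * bdot w w) + (of_real (c / 2) * bdot (z - w + w) (z - w + w) + (- of_real (1 / \<sigma>)) * bdot (z - w) (cnj_vec w))"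
      by (simp add: bdot_def cnj_vec_def sum_distrib_left sum_subtractf sum.distrib sum_negf power2_eq_square algebra_simps del: of_real_divide)
    finally show ?thesis unfolding h_def q_def exp_add by (simp add: mult_ac del: of_real_divide)
  qed
  have m[measurable]: "(\<lambda>z. mehlerN (exp (- 4 * t)) z (cnj_vec w)) \<in> borel_measurable borel"
    using sqi_measurable[OF K] by (simp add: measurable_cong_sets[OF sets_gauss_measure refl])
  have Fm[measurable]: "F \<in> borel_measurable borel" by (rule entire_measurable[OF F])
  have hm[measurable]: "h \<in> borel_measurable borel" by (rule entire_measurable[OF h])
  have K0: "K0 \<noteq> 0" "q \<noteq> 0" using \<sigma> by (auto simp: K0_def q_def)
  have FKm: "(\<lambda>z. F z * cnj (mehlerN (exp (- 4 * t)) z (cnj_vec w))) \<in> borel_measurable borel" by measurable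
  have "integrable (gauss_measure t) (\<lambda>z. F z * cnj (mehlerN (exp (- 4 * t)) z (cnj_vec w)))"
    by (rule sqi_prod_integrable[OF FF K])
  then have i0: "integrable lborel (\<lambda>z. (of_real K0 * q) * (h (z - w) * of_real (exp (- ((norm (z - w))\<^sup>2 / \<sigma>)))))"
    unfolding integrable_gauss_measure_iff[OF FKm] pt .
  have i1: "integrable lborel (\<lambda>z. h (z - w) * of_real (exp (- ((norm (z - w))\<^sup>2 / \<sigma>))))"
  proof -
    have inv: "inverse c * (c * x) = x" if "c \<noteq> 0" for c x :: complex
      using that by (simp add: mult.assoc[symmetric])
    have nz: "of_real K0 * q \<noteq> 0" using K0 by simp
    from integrable_mult_right[OF i0, of "inverse (of_real K0 * q)"] show ?thesis unfolding inv[OF nz] .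
  qed
  define g where "g z = h z * of_real (exp (- ((norm z)\<^sup>2 / \<sigma>)))" for z
  have gm[measurable]: "g \<in> borel_measurable borel" unfolding g_def by measurable
  have i2: "integrable lborel g"
  proof -
    have "integrable (distr lborel borel ((+) (- w))) g"
      by (subst integrable_distr_eq) (use i1 in \<open>auto simp: g_def\<close>)
    then show ?thesis by (simp only: lborel_distr_plus)
  qed
  have tr: "(LINT z|lborel. g (z - w)) = (LINT z|lborel. g z)"
    by (subst (2) lborel_distr_plus[of "- w", symmetric], subst integral_distr) auto
  have "ip (gauss_measure t) F (\<lambda>z. mehlerN (exp (- 4 * t)) z (cnj_vec w)) = (LINT z|lborel. (of_real K0 * q) * g (z - w))"
    unfolding ip_def integral_gauss_measure[OF FKm] pt g_def ..
  also have "\<dots> = of_real K0 * q * (LINT z|lborel. g z)" by (simp add: tr)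
  also have "(LINT z|lborel. g z) = h 0 * of_real (LINT z|(lborel :: (complex^'n) measure). exp (- ((norm z)\<^sup>2 / \<sigma>)))"
    unfolding g_def by (rule radial_mean_value[OF h, where \<phi>="\<lambda>x. exp (- (x\<^sup>2 / \<sigma>))"]) (use i2[unfolded g_def[abs_def]] in auto)
  also have "\<dots> = h 0 * of_real ((pi * \<sigma>) ^ CARD('n))" by (simp only: integral_gauss_vec[OF \<sigma>])
  also have "of_real K0 * q * (h 0 * of_real ((pi * \<sigma>) ^ CARD('n))) = of_real (K0 * (pi * \<sigma>) ^ CARD('n)) * (q * h 0)"
    by simp
  also have "q * h 0 = F w"
    by (simp add: q_def h_def bdot_def exp_minus)
  also have "K0 * (pi * \<sigma>) ^ CARD('n) = (sqrt (2 * pi) * exp (2 * t)) ^ CARD('n)"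
    unfolding K0_def power_mult_distrib[symmetric] using \<sigma> by simp
  also have "\<dots> = iso_const TYPE('n) * exp (2 * real CARD('n) * t)"
    unfolding iso_const_def power_mult_distrib by (simp add: exp_of_nat_mult[symmetric] mult_ac)
  finally show ?thesis .
qed

lemma synth_ip:
  fixes b :: "('n::finite \<Rightarrow> nat) \<Rightarrow> complex"
  assumes b: "rapid r b" and r: "r > 0" and G: "G \<in> sqi (gauss_measure r)"
  shows "(\<lambda>k. \<Sum>\<alpha>\<in>level k. cnj (b \<alpha>) * ip (gauss_measure r) G (PhiC \<alpha>)) sums ip (gauss_measure r) G (synth b)"
proof -
  interpret H: orth_family "gauss_measure r" "PhiC :: ('n \<Rightarrow> nat) \<Rightarrow> _" "\<lambda>\<alpha>. iso_const TYPE('n) * exp (2 * eigval TYPE('n) (mdeg \<alpha>) * r)"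
    by (rule orth_family_plane[OF r])
  interpret B: orth_seq "gauss_measure r" "block b"
    unfolding block_def[abs_def] by (rule H.orth_seq_blocks) (auto simp: level_disjoint)
  have nb: "nsq (gauss_measure r) (block b k) = iso_const TYPE('n) * (exp (2 * eigval TYPE('n) k * r) * level_sq b k)" for k
    unfolding block_def[abs_def] H.nsq_comb[OF finite_level] level_sq_def sum_distrib_left
    by (intro sum.cong refl) (simp add: level_def mult_ac)
  have summ: "summable (\<lambda>k. nsq (gauss_measure r) (block b k))"
    unfolding nb using b unfolding rapid_def by (rule summable_mult)
  have meas: "synth b \<in> borel_measurable (gauss_measure r)"
    using entire_measurable[OF entire_synth[OF b r]] by (simp add: measurable_cong_sets[OF sets_gauss_measure refl])
  have lim: "(\<lambda>N. nsq (gauss_measure r) (\<lambda>x. synth b x - (\<Sum>k<N. block b k x))) \<longlonglongrightarrow> 0"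
    by (rule B.nsq_convergence(2)[OF summ meas strict_mono_id]) (simp add: synth_pointwise[OF b r])
  have "(\<lambda>N. ip (gauss_measure r) G (\<lambda>x. \<Sum>k<N. block b k x)) \<longlonglongrightarrow> ip (gauss_measure r) G (synth b)"
    by (rule ip_tendsto_right[OF synth_isometry(1)[OF b r] _ G lim]) (intro sqi_sum B.q_sqi)
  moreover have "ip (gauss_measure r) G (\<lambda>x. \<Sum>k<N. block b k x) = (\<Sum>k<N. \<Sum>\<alpha>\<in>level k. cnj (b \<alpha>) * ip (gauss_measure r) G (PhiC \<alpha>))" for N
    unfolding block_def sum_levels by (rule H.ip_comb_right[OF G])
  ultimately show ?thesis by (simp add: sums_def)
qed

text \<open>Bessel's inequality bounds the coefficients. Expanding Mehler's kernel in the reproducing property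
gives the value of the Hermite series at \<open>w\<close>: the factor \<open>exp (- 4 * t) ^ k\<close> of the kernel turns the
square \<open>W k\<close> of the norm of \<open>PhiC \<alpha>\<close> into a constant independent of the level.\<close>

theorem entire_sqi_expansion:
  fixes F :: "complex^'n::finite \<Rightarrow> complex"
  assumes t: "t > 0" and F: "entire F" and FF: "F \<in> sqi (gauss_measure t)"
  defines "a \<equiv> \<lambda>\<alpha>. ip (gauss_measure t) F (PhiC \<alpha>) / of_real (iso_const TYPE('n) * exp (2 * eigval TYPE('n) (mdeg \<alpha>) * t))"
  shows "rapid t a" "F = synth a"
proof -
  define W where "W k = iso_const TYPE('n) * exp (2 * eigval TYPE('n) k * t)" for k
  have W: "W k > 0" for k by (simp add: W_def iso_const_pos)
  interpret H: orth_family "gauss_measure t" "PhiC :: ('n \<Rightarrow> nat) \<Rightarrow> _" "\<lambda>\<alpha>. W (mdeg \<alpha>)"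
    unfolding W_def by (rule orth_family_plane[OF t])
  have a: "a \<alpha> = ip (gauss_measure t) F (PhiC \<alpha>) / of_real (W (mdeg \<alpha>))" for \<alpha> by (simp add: a_def W_def)
  have lev: "W k * level_sq a k = (\<Sum>\<alpha>\<in>level k. (cmod (ip (gauss_measure t) F (PhiC \<alpha>)))\<^sup>2 / W (mdeg \<alpha>))" for k
    unfolding level_sq_def sum_distrib_left
    by (intro sum.cong refl) (use W[of k] in \<open>auto simp: a level_def norm_divide power_divide power2_eq_square\<close>)
  have "summable (\<lambda>k. W k * level_sq a k)"
  proof (rule summableI_nonneg_bounded)
    show "0 \<le> W k * level_sq a k" for k using W[of k] by (simp add: level_sq_nonneg)
    show "(\<Sum>k<N. W k * level_sq a k) \<le> nsq (gauss_measure t) F" for N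
      unfolding lev sum_levels by (rule H.Bessel[OF FF finite_mdeg_less])
  qed
  then have "summable (\<lambda>k. inverse (iso_const TYPE('n)) * (W k * level_sq a k))" by (rule summable_mult)
  then show rap: "rapid t a"
    using iso_const_pos[where 'n='n] unfolding rapid_def W_def by (simp add: mult.assoc[symmetric])
  show "F = synth a"
  proof
    fix w
    define \<rho> where "\<rho> = exp (- 4 * t)"
    have \<rho>: "0 \<le> \<rho>" "\<rho> < 1" using t by (auto simp: \<rho>_def)
    \<comment> \<open>the Hermite coefficients of Mehler's kernel, as a function of its first argument\<close>
    define b where "b \<alpha> = of_real (\<rho> ^ mdeg \<alpha>) * cnj (PhiC \<alpha> w)" for \<alpha> :: "'n \<Rightarrow> nat"
    have ek: "exp (2 * eigval TYPE('n) k * t) * \<rho> ^ k = exp (2 * real CARD('n) * t)" for k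
      by (simp add: \<rho>_def eigval_def algebra_simps flip: exp_add exp_of_nat_mult)
    have lsb: "exp (2 * eigval TYPE('n) k * t) * level_sq b k = exp (2 * real CARD('n) * t) * (\<rho> ^ k * (\<Sum>\<alpha>\<in>level k. (cmod (PhiC \<alpha> w))\<^sup>2))" for k
    proof -
      have "level_sq b k = \<rho> ^ k * (\<rho> ^ k * (\<Sum>\<alpha>\<in>level k. (cmod (PhiC \<alpha> w))\<^sup>2))"
        unfolding level_sq_def sum_distrib_left b_def using \<rho>(1)
        by (intro sum.cong refl) (auto simp: level_def norm_mult norm_power power2_eq_square)
      then show ?thesis using ek[of k] by (simp add: mult.assoc[symmetric])
    qed
    have rb: "rapid t b" unfolding rapid_def lsb
      by (intro summable_mult sums_summable[OF mehler_diag_sums[OF \<rho>]])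
    have bs: "block b k z = of_real (\<rho> ^ k) * (\<Sum>\<alpha>\<in>level k. PhiC \<alpha> z * PhiC \<alpha> (cnj_vec w))" for k z
      unfolding block_def sum_distrib_left b_def by (intro sum.cong refl) (auto simp: level_def PhiC_cnj)
    have K: "(\<lambda>z. mehlerN \<rho> z (cnj_vec w)) = synth b"
    proof
      fix z show "mehlerN \<rho> z (cnj_vec w) = synth b z"
        using sums_unique[OF mehlerN_sums[OF \<rho>, of z "cnj_vec w"]] by (simp only: synth_def bs)
    qed
    have exp1: "(\<lambda>k. \<Sum>\<alpha>\<in>level k. cnj (b \<alpha>) * ip (gauss_measure t) F (PhiC \<alpha>)) sums ip (gauss_measure t) F (synth b)"
      by (rule synth_ip[OF rb t FF])
    have exp2: "ip (gauss_measure t) F (synth b) = of_real (iso_const TYPE('n) * exp (2 * real CARD('n) * t)) * F w"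
      unfolding K[symmetric] \<rho>_def
      by (rule mehlerN_reproducing[OF t F _ FF]) (use synth_isometry(1)[OF rb t] K in \<open>simp add: \<rho>_def\<close>)
    have exp3: "(\<Sum>\<alpha>\<in>level k. cnj (b \<alpha>) * ip (gauss_measure t) F (PhiC \<alpha>)) = of_real (iso_const TYPE('n) * exp (2 * real CARD('n) * t)) * block a k w" for k
      unfolding block_def sum_distrib_left
    proof (intro sum.cong refl)
      fix \<alpha> :: "'n \<Rightarrow> nat" assume \<alpha>: "\<alpha> \<in> level k"
      have "\<rho> ^ k * W k = iso_const TYPE('n) * exp (2 * real CARD('n) * t)"
        unfolding W_def ek[symmetric, of k] by simp
      then have "complex_of_real (\<rho> ^ k) * of_real (W k) = of_real (iso_const TYPE('n) * exp (2 * real CARD('n) * t))"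
        by (simp only: of_real_mult[symmetric])
      moreover have "ip (gauss_measure t) F (PhiC \<alpha>) = a \<alpha> * of_real (W k)" using W[of k] \<alpha> by (simp add: a level_def)
      moreover have "cnj (b \<alpha>) = of_real (\<rho> ^ k) * PhiC \<alpha> w" using \<alpha> by (simp add: b_def level_def)
      ultimately show "cnj (b \<alpha>) * ip (gauss_measure t) F (PhiC \<alpha>) = of_real (iso_const TYPE('n) * exp (2 * real CARD('n) * t)) * (a \<alpha> * PhiC \<alpha> w)"
        by (metis (no_types, lifting) mult.assoc mult.commute)
    qed
    have s: "(\<lambda>k. of_real (iso_const TYPE('n) * exp (2 * real CARD('n) * t)) * block a k w) sums (of_real (iso_const TYPE('n) * exp (2 * real CARD('n) * t)) * F w)"
      using exp1 unfolding exp2 exp3 .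
    have nz: "complex_of_real (iso_const TYPE('n) * exp (2 * real CARD('n) * t)) \<noteq> 0"
      using iso_const_pos[where 'n='n] by simp
    from s have "(\<lambda>k. block a k w) sums F w" by (subst (asm) sums_mult_iff[OF nz])
    then show "F w = synth a w" by (simp add: synth_def sums_iff)
  qed
qed

section \<open>Completeness of the Hermite functions on real space\<close>

text \<open>The positive and the negative part of \<open>g\<close> are densities of finite measures that agree on boxes, hence
on all Borel sets.\<close>

lemma AE_zero_if_box_integrals_zero:
  fixes g :: "'a::euclidean_space \<Rightarrow> real"
  assumes g: "integrable lborel g" and zero: "\<And>a b. (LINT x|lborel. g x * indicator (box a b) x) = 0"
  shows "AE x in lborel. g x = 0"
proof -
  have [measurable]: "g \<in> borel_measurable borel" using g by auto
  define M1 where "M1 = density lborel (\<lambda>x. ennreal (g x))"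
  define M2 where "M2 = density lborel (\<lambda>x. ennreal (- g x))"
  have fin: "(\<integral>\<^sup>+x. ennreal (g x) * indicator A x \<partial>lborel) \<noteq> \<infinity>" "(\<integral>\<^sup>+x. ennreal (- g x) * indicator A x \<partial>lborel) \<noteq> \<infinity>" for A
  proof -
    have le: "ennreal (g x) * indicator A x \<le> ennreal (norm (g x))" "ennreal (- g x) * indicator A x \<le> ennreal (norm (g x))" for x
      by (auto simp: indicator_def intro!: ennreal_leI)
    have "(\<integral>\<^sup>+x. ennreal (norm (g x)) \<partial>lborel) < \<infinity>" using g by (simp add: integrable_iff_bounded)
    note nf = this
    have b: "(\<integral>\<^sup>+x. ennreal (g x) * indicator A x \<partial>lborel) < \<infinity>" "(\<integral>\<^sup>+x. ennreal (- g x) * indicator A x \<partial>lborel) < \<infinity>"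
      by (rule le_less_trans[OF nn_integral_mono[OF le(1)] nf] le_less_trans[OF nn_integral_mono[OF le(2)] nf])+
    show "(\<integral>\<^sup>+x. ennreal (g x) * indicator A x \<partial>lborel) \<noteq> \<infinity>" "(\<integral>\<^sup>+x. ennreal (- g x) * indicator A x \<partial>lborel) \<noteq> \<infinity>"
      using b by auto
  qed
  have eq: "emeasure M1 (box a b) = emeasure M2 (box a b)" for a b
  proof -
    have i: "integrable lborel (\<lambda>x. g x * indicator (box a b) x)"
      using integrable_mult_indicator[OF _ g, of "box a b"] by (simp add: mult.commute)
    have "0 = enn2real (\<integral>\<^sup>+x. ennreal (g x * indicator (box a b) x) \<partial>lborel) - enn2real (\<integral>\<^sup>+x. ennreal (- (g x * indicator (box a b) x)) \<partial>lborel)"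
      using real_lebesgue_integral_def[OF i] zero by simp
    moreover have "ennreal (g x * indicator (box a b) x) = ennreal (g x) * indicator (box a b) x"
      "ennreal (- (g x * indicator (box a b) x)) = ennreal (- g x) * indicator (box a b) x" for x
      by (auto simp: indicator_def)
    ultimately have "enn2real (\<integral>\<^sup>+x. ennreal (g x) * indicator (box a b) x \<partial>lborel) = enn2real (\<integral>\<^sup>+x. ennreal (- g x) * indicator (box a b) x \<partial>lborel)"
      by simp
    then have "(\<integral>\<^sup>+x. ennreal (g x) * indicator (box a b) x \<partial>lborel) = (\<integral>\<^sup>+x. ennreal (- g x) * indicator (box a b) x \<partial>lborel)"
      using fin(1)[of "box a b"] fin(2)[of "box a b"]
      unfolding infinity_ennreal_def less_top by (metis ennreal_enn2real)
    then show ?thesis unfolding M1_def M2_def by (simp add: emeasure_density)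
  qed
  have "M1 = M2"
  proof (rule measure_eqI_generator_eq)
    let ?E = "range (\<lambda>(a, b). box a b::'a set)"
    show "Int_stable ?E" by (auto simp: Int_stable_def box_Int_box)
    show "?E \<subseteq> Pow UNIV" "sets M1 = sigma_sets UNIV ?E" "sets M2 = sigma_sets UNIV ?E"
      by (simp_all add: borel_eq_box M1_def M2_def)
    let ?A = "\<lambda>n::nat. box (- (real n *\<^sub>R One)) (real n *\<^sub>R One) :: 'a set"
    show "range ?A \<subseteq> ?E" "(\<Union>i. ?A i) = UNIV" unfolding UN_box_eq_UNIV by auto
    show "emeasure M1 (?A i) \<noteq> \<infinity>" for i unfolding M1_def using fin(1) by (simp add: emeasure_density)
    show "emeasure M1 X = emeasure M2 X" if "X \<in> ?E" for X using that eq by auto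
  qed
  then have "AE x in lborel. ennreal (g x) = ennreal (- g x)"
    unfolding M1_def M2_def by (intro sigma_finite_measure.density_unique[OF sigma_finite_lborel]) auto
  then show ?thesis
  proof eventually_elim
    case (elim x)
    show ?case
    proof (rule ccontr)
      assume "g x \<noteq> 0"
      then consider "g x > 0" | "g x < 0" by linarith
      then show False
      proof cases
        case 1 then have "ennreal (- g x) = 0" by (simp add: ennreal_neg)
        then show False using 1 elim by simp
      next
        case 2 then have "ennreal (g x) = 0" by (simp add: ennreal_neg)
        then show False using 2 elim by simp
      qed
    qed
  qed
qed

lemma integral_affine_euclidean:
  fixes f :: "'a::euclidean_space \<Rightarrow> 'b::{banach,second_countable_topology}"
  assumes [measurable]: "f \<in> borel_measurable borel" and c: "c \<noteq> 0"
  shows "(LINT x|lborel. f x) = (\<bar>c\<bar> ^ DIM('a)) *\<^sub>R (LINT x|lborel. f (t + c *\<^sub>R x))"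
  by (subst lborel_affine[OF c, of t]) (simp add: integral_density integral_distr)

lemma gauss_vec_eq: "exp (- (N * (norm (x::real^'n))\<^sup>2)) = (\<Prod>j\<in>UNIV. exp (- (N * (x $ j)\<^sup>2)))"
  by (simp add: norm_vec_def L2_set_def sum_nonneg exp_sum[symmetric] sum_negf[symmetric] sum_distrib_left)

lemma integrable_gauss_real_vec:
  assumes "N > 0"
  shows "integrable lborel (\<lambda>x::real^'n. exp (- (N * (norm x)\<^sup>2)))"
  unfolding gauss_vec_eq using integrable_vec_prod[of "\<lambda>_::'n. \<lambda>x. exp (- (N * x\<^sup>2))"] integrable_gauss[OF assms] by simp

text \<open>Smoothed indicators of boxes, obtained by integrating the Gaussian kernels over the box,
  converge boundedly almost everywhere to the indicator.\<close>

lemma AE_zero_if_gauss_integrals_zero: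
  fixes h :: "real^'n \<Rightarrow> real"
  assumes h: "integrable lborel h"
    and zero: "\<And>N u. N > 0 \<Longrightarrow> (LINT x|lborel. h x * exp (- (N * (norm (x - u))\<^sup>2))) = 0"
  shows "AE x in lborel. h x = 0"
proof (rule AE_zero_if_box_integrals_zero[OF h])
  fix a b :: "real^'n"
  have hm[measurable]: "h \<in> borel_measurable borel" using h by auto
  define B where "B = box a b"
  define w where "w v = exp (- (1 * (norm (v :: real^'n))\<^sup>2))" for v
  have wi: "integrable lborel w" unfolding w_def by (rule integrable_gauss_real_vec) simp
  have wm[measurable]: "w \<in> borel_measurable borel" using wi by auto
  define \<kappa> where "\<kappa> = (LINT v|lborel. w v)"
  have \<kappa>: "\<kappa> > 0"
  proof -
    have "\<kappa> = (\<Prod>j\<in>(UNIV::'n set). LINT x|lborel. exp (- (1 * x\<^sup>2)))"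
      unfolding \<kappa>_def w_def gauss_vec_eq using integral_vec_prod[of "\<lambda>_::'n. \<lambda>x. exp (- (1 * x\<^sup>2))"] integrable_gauss[of 1] by simp
    then show ?thesis using integral_gauss[of 1] by simp
  qed
  \<comment> \<open>up to a constant the convolution of the indicator of \<open>B\<close> with the Gaussian \<open>exp (- N * \<bar>x\<bar>\<^sup>2)\<close> for
    \<open>N = Suc m\<close>, substituted such that the limit can be taken under the integral\<close>
  define E where "E m x = (LINT v|lborel. indicator B (x + (1 / sqrt (real (Suc m))) *\<^sub>R v) * w v)" for m :: nat and x
  have E0: "(LINT x|lborel. h x * E m x) = 0" for m
  proof -
    define N where "N = real (Suc m)"
    define c where "c = 1 / sqrt N"
    have c: "c > 0" "c\<^sup>2 = 1 / N" "N > 0" by (auto simp: c_def N_def power_divide)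
    have E_eq: "(c ^ DIM(real^'n)) * E m x = (LINT u|lborel. indicator B u * exp (- (N * (norm (x - u))\<^sup>2)))" for x
    proof -
      have "(LINT u|lborel. indicator B u * exp (- (N * (norm (x - u))\<^sup>2))) = \<bar>c\<bar> ^ DIM(real^'n) *\<^sub>R (LINT v|lborel. indicator B (x + c *\<^sub>R v) * exp (- (N * (norm (x - (x + c *\<^sub>R v)))\<^sup>2)))"
        by (rule integral_affine_euclidean) (use c in \<open>auto simp: B_def\<close>)
      also have "(\<lambda>v. exp (- (N * (norm (x - (x + c *\<^sub>R v)))\<^sup>2))) = w"
        using c by (auto simp: w_def power_mult_distrib)
      finally show ?thesis using c by (simp add: E_def c_def N_def fun_eq_iff)
    qed
    define k where "k x u = h x * (indicator B u * exp (- (N * (norm (x - u))\<^sup>2)))" for x u :: "real^'n"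
    have km: "case_prod k \<in> borel_measurable (lborel \<Otimes>\<^sub>M lborel)"
    proof -
      have [measurable]: "(\<lambda>p::(real^'n) \<times> (real^'n). fst p) \<in> borel_measurable borel" "(\<lambda>p::(real^'n) \<times> (real^'n). snd p) \<in> borel_measurable borel"
        by (intro borel_measurable_continuous_onI continuous_intros)+
      have "(\<lambda>p. h (fst p) * (indicator B (snd p) * exp (- (N * (norm (fst p - snd p))\<^sup>2)))) \<in> borel_measurable (borel :: ((real^'n) \<times> (real^'n)) measure)"
        unfolding B_def by measurable
      then show ?thesis by (simp add: lborel_prod k_def case_prod_beta')
    qed
    have ib: "integrable lborel (\<lambda>u. indicator B u :: real)"
      by (rule integrable_real_indicator) (auto simp: B_def emeasure_lborel_box_eq)
    have ik: "integrable (lborel \<Otimes>\<^sub>M lborel) (case_prod k)"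
    proof (rule Bochner_Integration.integrable_bound[OF _ km])
      show "integrable (lborel \<Otimes>\<^sub>M lborel) (\<lambda>(x, u). \<bar>h x\<bar> * (indicator B u :: real))"
      proof (rule lborel_pair.Fubini_integrable)
        show "integrable lborel (\<lambda>x. LINT y|lborel. norm (case (x, y) of (x, u) \<Rightarrow> \<bar>h x\<bar> * (indicator B u :: real)))"
          using h by (simp add: abs_mult)
        show "AE x in lborel. integrable lborel (\<lambda>y. case (x, y) of (x, u) \<Rightarrow> \<bar>h x\<bar> * (indicator B u :: real))"
          using ib by simp
        show "(\<lambda>(x, u). \<bar>h x\<bar> * (indicator B u :: real)) \<in> borel_measurable (lborel \<Otimes>\<^sub>M lborel)"
          unfolding B_def by measurable
      qed
      show "AE p in lborel \<Otimes>\<^sub>M lborel. norm (case_prod k p) \<le> norm (case p of (x, u) \<Rightarrow> \<bar>h x\<bar> * (indicator B u :: real))"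
        using c by (intro AE_I2) (auto simp: k_def abs_mult indicator_def intro!: mult_left_le)
    qed
    have "(c ^ DIM(real^'n)) * (LINT x|lborel. h x * E m x) = (LINT x|lborel. h x * ((c ^ DIM(real^'n)) * E m x))"
      by (subst integral_mult_right_zero[symmetric]) (simp add: mult_ac)
    also have "\<dots> = (LINT x|lborel. (LINT u|lborel. k x u))"
      unfolding E_eq k_def by simp
    also have "\<dots> = (LINT u|lborel. (LINT x|lborel. k x u))"
      by (rule lborel_pair.Fubini_integral[OF ik, symmetric])
    also have "\<dots> = (LINT u|lborel. indicator B u * (LINT x|lborel. h x * exp (- (N * (norm (x - u))\<^sup>2))))"
      unfolding k_def by (subst integral_mult_right_zero[symmetric]) (simp add: mult_ac)
    also have "\<dots> = 0" using zero[OF c(3)] by simp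
    finally show ?thesis using c by simp
  qed
  have em[measurable]: "E m \<in> borel_measurable borel" for m
  proof -
    have [measurable]: "(\<lambda>p::(real^'n) \<times> (real^'n). fst p) \<in> borel_measurable borel" "(\<lambda>p::(real^'n) \<times> (real^'n). snd p) \<in> borel_measurable borel"
      by (intro borel_measurable_continuous_onI continuous_intros)+
    have "(\<lambda>p. indicator B (fst p + (1 / sqrt (real (Suc m))) *\<^sub>R snd p) * w (snd p) :: real) \<in> borel_measurable (borel :: ((real^'n) \<times> (real^'n)) measure)"
      unfolding B_def by measurable
    then have "(\<lambda>(x, v). indicator B (x + (1 / sqrt (real (Suc m))) *\<^sub>R v) * w v :: real) \<in> borel_measurable (lborel \<Otimes>\<^sub>M lborel)"
      by (simp add: lborel_prod case_prod_beta')
    then have "E m \<in> borel_measurable lborel" unfolding E_def by (rule lborel.borel_measurable_lebesgue_integral)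
    then show ?thesis by simp
  qed
  have ibd: "norm (indicator B y * w v) \<le> w v" for y v by (auto simp: indicator_def w_def)
  have Ebd: "\<bar>E m x\<bar> \<le> \<kappa>" for m x
  proof -
    define e where "e v = indicator B (x + (1 / sqrt (real (Suc m))) *\<^sub>R v) * w v" for v
    have [measurable]: "e \<in> borel_measurable borel" unfolding e_def B_def by measurable
    have eb: "norm (e v) \<le> w v" for v unfolding e_def by (rule ibd)
    have ei: "integrable lborel e"
      by (rule Bochner_Integration.integrable_bound[OF wi]) (use eb in \<open>auto intro!: AE_I2 order_trans[OF _ abs_ge_self]\<close>)
    have "\<bar>E m x\<bar> \<le> (LINT v|lborel. norm (e v))"
      using integral_norm_bound[of lborel e] by (simp add: E_def e_def[abs_def])
    also have "\<dots> \<le> \<kappa>" unfolding \<kappa>_def using ei wi eb by (intro integral_mono) auto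
    finally show ?thesis .
  qed
  have lim: "(\<lambda>m. E m x) \<longlonglongrightarrow> indicator B x * \<kappa>" if x: "x \<notin> cbox a b - box a b" for x
  proof -
    have conv: "(\<lambda>m. x + (1 / sqrt (real (Suc m))) *\<^sub>R v) \<longlonglongrightarrow> x" for v
    proof -
      have "(\<lambda>m. 1 / sqrt (real (Suc m))) \<longlonglongrightarrow> 0" by real_asymp
      then have "(\<lambda>m. x + (1 / sqrt (real (Suc m))) *\<^sub>R v) \<longlonglongrightarrow> x + 0 *\<^sub>R v" by (intro tendsto_intros)
      then show ?thesis by simp
    qed
    have ev: "\<forall>\<^sub>F m in sequentially. indicator B (x + (1 / sqrt (real (Suc m))) *\<^sub>R v) = (indicator B x :: real)" for v
    proof (cases "x \<in> B")
      case True
      have "\<forall>\<^sub>F m in sequentially. x + (1 / sqrt (real (Suc m))) *\<^sub>R v \<in> B"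
        using conv topological_tendstoD[OF conv, of B] True by (auto simp: B_def)
      then show ?thesis by eventually_elim (use True in simp)
    next
      case False
      then have "x \<in> - cbox a b" using x by (auto simp: B_def)
      then have "\<forall>\<^sub>F m in sequentially. x + (1 / sqrt (real (Suc m))) *\<^sub>R v \<in> - cbox a b"
        by (intro topological_tendstoD[OF conv]) (auto simp: open_Compl)
      then show ?thesis
      proof eventually_elim
        case (elim m)
        then have "x + (1 / sqrt (real (Suc m))) *\<^sub>R v \<notin> B" using box_subset_cbox by (auto simp: B_def)
        then show ?case using False by simp
      qed
    qed
    have "(\<lambda>m. LINT v|lborel. indicator B (x + (1 / sqrt (real (Suc m))) *\<^sub>R v) * w v) \<longlonglongrightarrow> (LINT v|lborel. indicator B x * w v)"
    proof (rule integral_dominated_convergence[where w=w])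
      show "AE v in lborel. (\<lambda>m. indicator B (x + (1 / sqrt (real (Suc m))) *\<^sub>R v) * w v) \<longlonglongrightarrow> indicator B x * w v"
        using ev by (intro AE_I2 tendsto_mult tendsto_const tendsto_eventually) auto
    qed (use wi ibd in \<open>auto simp: B_def\<close>)
    then show ?thesis by (simp add: E_def \<kappa>_def)
  qed
  have "(\<lambda>m. LINT x|lborel. h x * E m x) \<longlonglongrightarrow> (LINT x|lborel. h x * (indicator B x * \<kappa>))"
  proof (rule integral_dominated_convergence[where w="\<lambda>x. \<bar>h x\<bar> * \<kappa>"])
    show "integrable lborel (\<lambda>x. \<bar>h x\<bar> * \<kappa>)" using h by simp
    have "AE x in lborel. x \<notin> cbox a b - box a b"
      using null_sets_cbox_Diff_box by (rule AE_not_in)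
    then show "AE x in lborel. (\<lambda>m. h x * E m x) \<longlonglongrightarrow> h x * (indicator B x * \<kappa>)"
      by eventually_elim (intro tendsto_mult tendsto_const lim)
    show "AE x in lborel. norm (h x * E m x) \<le> \<bar>h x\<bar> * \<kappa>" for m
      by (intro AE_I2) (auto simp: abs_mult intro!: mult_left_mono Ebd)
  qed (auto simp: B_def)
  then have "(\<lambda>m. 0) \<longlonglongrightarrow> (LINT x|lborel. h x * (indicator B x * \<kappa>))" by (simp add: E0)
  then have "(LINT x|lborel. h x * (indicator B x * \<kappa>)) = 0" by (simp add: LIMSEQ_const_iff)
  then have "(LINT x|lborel. (h x * indicator B x) * \<kappa>) = 0" by (simp add: mult.assoc)
  then have "(LINT x|lborel. h x * indicator B x) * \<kappa> = 0" by (simp only: integral_mult_left_zero)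
  then show "(LINT x|lborel. h x * indicator (box a b) x) = 0" using \<kappa> by (simp add: B_def)
qed

definition coef :: "(real^'n \<Rightarrow> complex) \<Rightarrow> ('n::finite \<Rightarrow> nat) \<Rightarrow> complex" where
  "coef f \<alpha> = ip lborel f (hermite_Phi \<alpha>)"

text \<open>As a function of a real vector Mehler's kernel is the limit in mean square of finite combinations of
Hermite functions.\<close>

lemma coef_zero_mehler:
  fixes f :: "real^'n::finite \<Rightarrow> complex"
  assumes f: "f \<in> sqi lborel" and zero: "\<And>\<alpha>. coef f \<alpha> = 0" and \<rho>: "0 \<le> \<rho>" "\<rho> < 1"
  shows "ip lborel f (\<lambda>x. mehlerN \<rho> (complex_vec x) (complex_vec y)) = 0"
proof -
  define c where "c \<alpha> = of_real (\<rho> ^ mdeg \<alpha>) * hermite_Phi \<alpha> y" for \<alpha> :: "'n \<Rightarrow> nat"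
  define q where "q k x = (\<Sum>\<alpha>\<in>level k. c \<alpha> * hermite_Phi \<alpha> x)" for k x
  interpret B: orth_seq lborel q
    unfolding q_def[abs_def] by (rule HR.orth_seq_blocks) (auto simp: level_disjoint)
  have qe: "q k x = of_real (\<rho> ^ k) * (\<Sum>\<alpha>\<in>level k. PhiC \<alpha> (complex_vec x) * PhiC \<alpha> (complex_vec y))" for k x
    unfolding q_def c_def sum_distrib_left by (intro sum.cong refl) (auto simp: level_def hermite_Phi_eq)
  have nq: "nsq lborel (q k) = \<rho> ^ k * (\<rho> ^ k * (\<Sum>\<alpha>\<in>level k. (cmod (PhiC \<alpha> (complex_vec y)))\<^sup>2))" for k
    unfolding q_def[abs_def] HR.nsq_comb[OF finite_level] sum_distrib_left
    by (intro sum.cong refl) (use \<rho> in \<open>auto simp: level_def c_def norm_mult norm_power power2_eq_square hermite_Phi_eq\<close>)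
  have summ: "summable (\<lambda>k. nsq lborel (q k))"
  proof (rule summable_comparison_test_ev[OF _ sums_summable[OF mehler_diag_sums[OF \<rho>, of "complex_vec y"]]])
    show "\<forall>\<^sub>F k in sequentially. norm (nsq lborel (q k)) \<le> \<rho> ^ k * (\<Sum>\<alpha>\<in>level k. (cmod (PhiC \<alpha> (complex_vec y)))\<^sup>2)"
    proof (intro always_eventually allI)
      fix k
      have "\<rho> ^ k * (\<rho> ^ k * (\<Sum>\<alpha>\<in>level k. (cmod (PhiC \<alpha> (complex_vec y)))\<^sup>2)) \<le> 1 * (\<rho> ^ k * (\<Sum>\<alpha>\<in>level k. (cmod (PhiC \<alpha> (complex_vec y)))\<^sup>2))"
        using \<rho> by (intro mult_right_mono) (auto simp: power_le_one sum_nonneg)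
      then show "norm (nsq lborel (q k)) \<le> \<rho> ^ k * (\<Sum>\<alpha>\<in>level k. (cmod (PhiC \<alpha> (complex_vec y)))\<^sup>2)"
        using nsq_nonneg[of lborel "q k"] nq[of k] by simp
    qed
  qed
  have cont: "continuous_on UNIV (\<lambda>x. mehlerN \<rho> (complex_vec x) (complex_vec y))"
    unfolding mehlerN_def mehler_def complex_vec_def by (intro continuous_intros)
  have meas: "(\<lambda>x. mehlerN \<rho> (complex_vec x) (complex_vec y)) \<in> borel_measurable lborel"
    using borel_measurable_continuous_onI[OF cont] by simp
  have pw: "(\<lambda>N. \<Sum>k<N. q k x) \<longlonglongrightarrow> mehlerN \<rho> (complex_vec x) (complex_vec y)" for x
    using mehlerN_sums[OF \<rho>, of "complex_vec x" "complex_vec y"] unfolding sums_def qe .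
  have pw': "AE x in lborel. (\<lambda>i. \<Sum>k<id i. q k x) \<longlonglongrightarrow> mehlerN \<rho> (complex_vec x) (complex_vec y)"
    by (simp add: pw)
  note conv = B.nsq_convergence[OF summ meas strict_mono_id pw']
  have "(\<lambda>N. ip lborel f (\<lambda>x. \<Sum>k<N. q k x)) \<longlonglongrightarrow> ip lborel f (\<lambda>x. mehlerN \<rho> (complex_vec x) (complex_vec y))"
    by (rule ip_tendsto_right[OF conv(1) _ f conv(2)]) (intro sqi_sum B.q_sqi)
  moreover have "ip lborel f (\<lambda>x. \<Sum>k<N. q k x) = 0" for N
    unfolding q_def sum_levels HR.ip_comb_right[OF f] using zero by (simp add: coef_def)
  ultimately show ?thesis by (simp add: LIMSEQ_const_iff)
qed

lemma mehler_real:
  assumes \<rho>: "0 \<le> \<rho>" "\<rho> < 1"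
  shows "mehlerN \<rho> (complex_vec x) (complex_vec (y::real^'n)) = of_real ((1 / sqrt (pi * (1 - \<rho>\<^sup>2))) ^ CARD('n) *
     exp (- ((1 + \<rho>\<^sup>2) / (2 * (1 - \<rho>\<^sup>2)) * ((norm x)\<^sup>2 + (norm y)\<^sup>2)) + 2 * \<rho> / (1 - \<rho>\<^sup>2) * (x \<bullet> y)))"
proof -
  define A where "A = (1 + \<rho>\<^sup>2) / (2 * (1 - \<rho>\<^sup>2))"
  define G where "G = 2 * \<rho> / (1 - \<rho>\<^sup>2)"
  define C where "C = 1 / sqrt (pi * (1 - \<rho>\<^sup>2))"
  have m: "mehler \<rho> (of_real s) (of_real r) = of_real (C * exp (- (A * (s\<^sup>2 + r\<^sup>2)) + G * s * r))" for s r
    unfolding mehler_def A_def[symmetric] G_def[symmetric] C_def[symmetric] by (simp add: exp_of_real[symmetric])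
  have n: "(norm v)\<^sup>2 = (\<Sum>j\<in>UNIV. (v $ j)\<^sup>2)" for v :: "real^'n" by (simp add: norm_vec_def L2_set_def sum_nonneg)
  have "mehlerN \<rho> (complex_vec x) (complex_vec y) = of_real (\<Prod>j\<in>UNIV. C * exp (- (A * ((x $ j)\<^sup>2 + (y $ j)\<^sup>2)) + G * x $ j * y $ j))"
    unfolding mehlerN_def complex_vec_def by (simp add: m)
  also have "(\<Prod>j\<in>UNIV. C * exp (- (A * ((x $ j)\<^sup>2 + (y $ j)\<^sup>2)) + G * x $ j * y $ j)) = C ^ CARD('n) * exp (\<Sum>j\<in>UNIV. - (A * ((x $ j)\<^sup>2 + (y $ j)\<^sup>2)) + G * x $ j * y $ j)"
    by (simp add: prod.distrib exp_sum)
  also have "(\<Sum>j\<in>UNIV. - (A * ((x $ j)\<^sup>2 + (y $ j)\<^sup>2)) + G * x $ j * y $ j) = - (A * ((norm x)\<^sup>2 + (norm y)\<^sup>2)) + G * (x \<bullet> y)"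
    unfolding n inner_vec_def by (simp add: sum.distrib sum_subtractf sum_negf sum_distrib_left algebra_simps)
  finally show ?thesis unfolding A_def G_def C_def .
qed

text \<open>With \<open>\<rho> = sqrt (N / (N + 1))\<close> Mehler's kernel is, as a function of \<open>x\<close>, a multiple of
  \<open>exp (- \<bar>x\<bar>\<^sup>2 / 2) * exp (- N * \<bar>x - u\<bar>\<^sup>2)\<close>, and every centre \<open>u\<close> occurs.\<close>

lemma coef_zero_gauss:
  fixes f :: "real^'n::finite \<Rightarrow> complex"
  assumes f: "f \<in> sqi lborel" and zero: "\<And>\<alpha>. coef f \<alpha> = 0" and N: "N > 0"
  shows "(LINT x|lborel. f x * of_real (exp (- ((norm x)\<^sup>2 / 2)) * exp (- (N * (norm (x - u))\<^sup>2)))) = 0"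
proof -
  define \<rho> where "\<rho> = sqrt (N / (N + 1))"
  have r2: "\<rho>\<^sup>2 = N / (N + 1)" using N by (simp add: \<rho>_def)
  have \<rho>: "0 < \<rho>" "\<rho> < 1" using N by (auto simp: \<rho>_def)
  have d: "1 - \<rho>\<^sup>2 = 1 / (N + 1)" using N by (simp add: r2 field_simps)
  have co1: "(1 + \<rho>\<^sup>2) / (2 * (1 - \<rho>\<^sup>2)) = N + 1 / 2" unfolding d unfolding r2 using N by (simp add: field_simps)
  define G where "G = 2 * \<rho> / (1 - \<rho>\<^sup>2)"
  have G: "G > 0" using \<rho> N by (simp add: G_def d)
  define y where "y = (2 * N / G) *\<^sub>R u"
  define C where "C = (1 / sqrt (pi * (1 - \<rho>\<^sup>2))) ^ CARD('n)"
  have C: "C > 0" using N by (simp add: C_def d)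
  define K where "K = C * exp (N * (norm u)\<^sup>2 - (N + 1 / 2) * (norm y)\<^sup>2)"
  have K: "K > 0" using C by (simp add: K_def)
  have M: "mehlerN \<rho> (complex_vec x) (complex_vec y) = of_real (K * (exp (- ((norm x)\<^sup>2 / 2)) * exp (- (N * (norm (x - u))\<^sup>2))))" for x
  proof -
    have xu: "(norm (x - u))\<^sup>2 = (norm x)\<^sup>2 - 2 * (x \<bullet> u) + (norm u)\<^sup>2"
      by (simp add: power2_norm_eq_inner inner_diff_left inner_diff_right inner_commute)
    have gy: "G * (x \<bullet> y) = 2 * N * (x \<bullet> u)" using G by (simp add: y_def)
    have "- ((N + 1 / 2) * ((norm x)\<^sup>2 + (norm y)\<^sup>2)) + G * (x \<bullet> y)
        = (N * (norm u)\<^sup>2 - (N + 1 / 2) * (norm y)\<^sup>2) + (- ((norm x)\<^sup>2 / 2) + - (N * (norm (x - u))\<^sup>2))"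
      unfolding gy xu by (simp add: algebra_simps)
    then show ?thesis
      unfolding mehler_real[OF less_imp_le[OF \<rho>(1)] \<rho>(2)] co1 G_def[symmetric] C_def[symmetric] K_def by (simp only: exp_add mult.assoc)
  qed
  have "0 = ip lborel f (\<lambda>x. mehlerN \<rho> (complex_vec x) (complex_vec y))"
    by (rule coef_zero_mehler[symmetric]) (use f zero \<rho> in auto)
  also have "\<dots> = (LINT x|lborel. of_real K * (f x * of_real (exp (- ((norm x)\<^sup>2 / 2)) * exp (- (N * (norm (x - u))\<^sup>2)))))"
    unfolding ip_def M by (simp add: mult_ac)
  also have "\<dots> = of_real K * (LINT x|lborel. f x * of_real (exp (- ((norm x)\<^sup>2 / 2)) * exp (- (N * (norm (x - u))\<^sup>2))))"
    by (rule integral_mult_right_zero)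
  finally show ?thesis using K by simp
qed

text \<open>After multiplication by \<open>exp (- \<bar>x\<bar>\<^sup>2 / 2)\<close> the function \<open>f\<close> is integrable and orthogonal to all
translates of all centred Gaussians.\<close>

theorem hermite_complete:
  fixes f :: "real^'n::finite \<Rightarrow> complex"
  assumes f: "f \<in> sqi lborel" and zero: "\<And>\<alpha>. coef f \<alpha> = 0"
  shows "AE x in lborel. f x = 0"
proof -
  have g: "(\<lambda>x::real^'n. complex_of_real (exp (- ((norm x)\<^sup>2 / 2)))) \<in> sqi lborel"
  proof -
    have "(exp (- ((norm x)\<^sup>2 / 2)))\<^sup>2 = exp (- (1 * (norm x)\<^sup>2))" for x :: "real^'n"
      by (simp flip: exp_double)
    then show ?thesis using integrable_gauss_real_vec[of 1, where 'n='n] by (simp add: sqi_def)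
  qed
  define h where "h x = f x * of_real (exp (- ((norm x)\<^sup>2 / 2)))" for x
  have h: "integrable lborel h" using sqi_prod_integrable[OF f g] by (simp add: h_def[abs_def])
  have z: "(LINT x|lborel. h x * of_real (exp (- (N * (norm (x - u))\<^sup>2)))) = 0" if "N > 0" for N u
    using coef_zero_gauss[OF f zero that, of u] by (simp add: h_def mult.assoc)
  have int: "integrable lborel (\<lambda>x. h x * of_real (exp (- (N * (norm (x - u))\<^sup>2))))" if "N > 0" for N u
  proof (rule Bochner_Integration.integrable_bound[OF h])
    have [measurable]: "h \<in> borel_measurable borel" using h by auto
    show "(\<lambda>x. h x * of_real (exp (- (N * (norm (x - u))\<^sup>2)))) \<in> borel_measurable lborel" by measurable
    show "AE x in lborel. norm (h x * of_real (exp (- (N * (norm (x - u))\<^sup>2)))) \<le> norm (h x)"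
      using that by (intro AE_I2) (auto simp: norm_mult intro!: mult_left_le)
  qed
  have "AE x in lborel. Re (h x) = 0"
  proof (rule AE_zero_if_gauss_integrals_zero)
    show "integrable lborel (\<lambda>x. Re (h x))" using h by simp
    show "(LINT x|lborel. Re (h x) * exp (- (N * (norm (x - u))\<^sup>2))) = 0" if "N > 0" for N u
      using integral_Re[OF int[OF that, of u]] z[OF that, of u] by simp
  qed
  moreover have "AE x in lborel. Im (h x) = 0"
  proof (rule AE_zero_if_gauss_integrals_zero)
    show "integrable lborel (\<lambda>x. Im (h x))" using h by simp
    show "(LINT x|lborel. Im (h x) * exp (- (N * (norm (x - u))\<^sup>2))) = 0" if "N > 0" for N u
      using integral_Im[OF int[OF that, of u]] z[OF that, of u] by simp
  qed
  ultimately show ?thesis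
  proof eventually_elim
    case (elim x)
    then have "h x = 0" by (simp add: complex_eq_iff)
    then show ?case by (simp add: h_def)
  qed
qed

section \<open>The heat kernel transform on coefficients\<close>

lemma L2_eq: "L2 = sqi lborel"
  by (simp add: L2_def sqi_def)

lemma L2_inner_eq: "L2_inner f g = ip lborel f g"
  by (simp add: L2_inner_def ip_def)

lemma L2_norm_eq: "L2_norm f = sqrt (nsq lborel f)"
  by (simp add: L2_norm_def nsq_def)

lemma eigenspace_eq:
  "hermite_eigenspace k = {g. \<exists>c. g = (\<lambda>x. \<Sum>\<alpha>\<in>level k. c \<alpha> * hermite_Phi \<alpha> x)}"
  by (simp add: hermite_eigenspace_def level_def mdeg_def)

text \<open>The description of the projection determines the coefficients of its value, by testing it against the
Hermite functions of the level.\<close>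

lemma hermite_proj_eq:
  fixes f :: "real^'n::finite \<Rightarrow> complex"
  assumes f: "f \<in> sqi lborel"
  shows "hermite_proj k f = (\<lambda>x. \<Sum>\<alpha>\<in>level k. coef f \<alpha> * hermite_Phi \<alpha> x)"
  unfolding hermite_proj_def
proof (rule the_equality, intro conjI ballI)
  let ?g = "\<lambda>x. \<Sum>\<alpha>\<in>level k. coef f \<alpha> * hermite_Phi \<alpha> x"
  show "?g \<in> hermite_eigenspace k" unfolding eigenspace_eq by blast
  fix h :: "real^'n \<Rightarrow> complex" assume "h \<in> hermite_eigenspace k"
  then obtain d where h: "h = (\<lambda>x. \<Sum>\<alpha>\<in>level k. d \<alpha> * hermite_Phi \<alpha> x)" unfolding eigenspace_eq by blast
  have "ip lborel (\<lambda>x. f x - ?g x) (hermite_Phi \<alpha>) = 0" if "\<alpha> \<in> level k" for \<alpha>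
    using that f by (simp add: ip_diff_left HR.comb_sqi HR.phi_sqi HR.ip_comb_phi coef_def)
  then show "L2_inner (\<lambda>x. f x - ?g x) h = 0"
    unfolding L2_inner_eq h by (subst HR.ip_comb_right) (auto intro: sqi_diff f HR.comb_sqi)
next
  fix g :: "real^'n \<Rightarrow> complex" assume g: "g \<in> hermite_eigenspace k \<and> (\<forall>h\<in>hermite_eigenspace k. L2_inner (\<lambda>x. f x - g x) h = 0)"
  then obtain c where c: "g = (\<lambda>x. \<Sum>\<alpha>\<in>level k. c \<alpha> * hermite_Phi \<alpha> x)" unfolding eigenspace_eq by blast
  have "c \<alpha> = coef f \<alpha>" if \<alpha>: "\<alpha> \<in> level k" for \<alpha>
  proof -
    have ph: "hermite_Phi \<alpha> = (\<lambda>x. \<Sum>\<beta>\<in>level k. (if \<beta> = \<alpha> then 1 else 0) * hermite_Phi \<beta> x)"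
      using \<alpha> by (simp add: if_distrib[of "\<lambda>y. y * _"] sum.delta' cong: if_cong)
    have "hermite_Phi \<alpha> \<in> hermite_eigenspace k" unfolding eigenspace_eq by (intro CollectI exI) (rule ph)
    then have "ip lborel (\<lambda>x. f x - g x) (hermite_Phi \<alpha>) = 0" using g by (simp add: L2_inner_eq)
    then show ?thesis unfolding c using \<alpha> f by (simp add: ip_diff_left HR.comb_sqi HR.phi_sqi HR.ip_comb_phi coef_def)
  qed
  then show "g = (\<lambda>x. \<Sum>\<alpha>\<in>level k. coef f \<alpha> * hermite_Phi \<alpha> x)" unfolding c by (auto intro!: sum.cong)
qed

lemma L2_norm_proj: "f \<in> sqi lborel \<Longrightarrow> (L2_norm (hermite_proj k f))\<^sup>2 = level_sq (coef f) k"
  by (simp add: hermite_proj_eq L2_norm_eq nsq_nonneg HR.nsq_comb level_sq_def sum_nonneg)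

lemma summable_level_sq_coef:
  assumes "f \<in> sqi lborel"
  shows "summable (level_sq (coef f))"
proof (rule summableI_nonneg_bounded)
  show "0 \<le> level_sq (coef f) k" for k by (rule level_sq_nonneg)
  show "(\<Sum>k<N. level_sq (coef f) k) \<le> nsq lborel f" for N
    using HR.Bessel[OF assms finite_mdeg_less[of N]] by (simp add: level_sq_def sum_levels coef_def)
qed

definition heat_coef :: "real \<Rightarrow> (real^'n \<Rightarrow> complex) \<Rightarrow> ('n::finite \<Rightarrow> nat) \<Rightarrow> complex" where
  "heat_coef t f \<alpha> = of_real (exp (- (eigval TYPE('n) (mdeg \<alpha>) * t))) * coef f \<alpha>"

lemma level_sq_heat_coef:
  fixes f :: "real^'n::finite \<Rightarrow> complex"
  shows "exp (2 * eigval TYPE('n) k * t) * level_sq (heat_coef t f) k = level_sq (coef f) k"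
proof -
  have "exp (2 * x) * (exp (- x))\<^sup>2 = 1" for x :: real by (simp flip: exp_double exp_add)
  then have "exp (2 * (eigval TYPE('n) k * t)) * (exp (- (eigval TYPE('n) k * t)))\<^sup>2 = 1" .
  then show ?thesis
    unfolding level_sq_def sum_distrib_left heat_coef_def
    by (intro sum.cong refl) (simp add: level_def norm_mult power_mult_distrib mult.assoc[symmetric])
qed

lemma rapid_heat_coef: "f \<in> sqi lborel \<Longrightarrow> rapid t (heat_coef t f)"
  unfolding rapid_def level_sq_heat_coef by (rule summable_level_sq_coef)

lemma continuous_AE_eq:
  fixes F G :: "real^'n \<Rightarrow> complex"
  assumes "continuous_on UNIV F" "continuous_on UNIV G" "AE x in lborel. F x = G x"
  shows "F x = G x"
proof -
  have "closed {x. F x = G x}" using assms(1,2) by (rule closed_Collect_eq)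
  then have "x \<in> {x. F x = G x}"
    by (rule mem_closed_if_AE_lebesgue) (use AE_completion[OF assms(3)] in simp)
  then show ?thesis by simp
qed

lemma entire_continuous_real: "entire F \<Longrightarrow> continuous_on UNIV (\<lambda>x. F (complex_vec x))"
  by (rule continuous_on_compose2[OF entire_continuous[of F UNIV] continuous_on_complex_vec]) auto

lemma semigroup_partial_sum:
  fixes f :: "real^'n::finite \<Rightarrow> complex"
  assumes "f \<in> sqi lborel"
  shows "(\<Sum>k<N. complex_of_real (exp (- (real (2 * k + CARD('n)) * t))) * hermite_proj k f x)
    = (\<Sum>k<N. block (heat_coef t f) k (complex_vec x))"
  by (intro sum.cong refl)
     (auto simp: hermite_proj_eq[OF assms] block_def heat_coef_def hermite_Phi_eq sum_distrib_left level_def eigval_def mult.assoc intro!: sum.cong)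

lemma synth_is_semigroup:
  fixes f :: "real^'n::finite \<Rightarrow> complex"
  assumes f: "f \<in> sqi lborel" and t: "t > 0"
  shows "is_hermite_semigroup t f (\<lambda>x. synth (heat_coef t f) (complex_vec x))"
proof -
  define q where "q k x = (\<Sum>\<alpha>\<in>level k. heat_coef t f \<alpha> * hermite_Phi \<alpha> x)" for k x
  have qb: "q k x = block (heat_coef t f) k (complex_vec x)" for k x
    by (simp add: q_def block_def hermite_Phi_eq)
  interpret B: orth_seq lborel q
    unfolding q_def[abs_def] by (rule HR.orth_seq_blocks) (auto simp: level_disjoint)
  have nq: "nsq lborel (q k) = level_sq (heat_coef t f) k" for k
    unfolding q_def[abs_def] by (simp add: HR.nsq_comb level_sq_def)
  have summ: "summable (\<lambda>k. nsq lborel (q k))"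
    unfolding nq
  proof (rule summable_comparison_test_ev[OF _ summable_level_sq_coef[OF f]])
    show "\<forall>\<^sub>F k in sequentially. norm (level_sq (heat_coef t f) k) \<le> level_sq (coef f) k"
    proof (intro always_eventually allI)
      fix k
      have "1 * level_sq (heat_coef t f) k \<le> exp (2 * eigval TYPE('n) k * t) * level_sq (heat_coef t f) k"
        using t by (intro mult_right_mono level_sq_nonneg) (simp add: eigval_def)
      then show "norm (level_sq (heat_coef t f) k) \<le> level_sq (coef f) k"
        by (simp add: level_sq_heat_coef level_sq_nonneg)
    qed
  qed
  have cont: "continuous_on UNIV (\<lambda>x. synth (heat_coef t f) (complex_vec x))"
    by (rule entire_continuous_real[OF entire_synth[OF rapid_heat_coef[OF f] t]])
  have meas: "(\<lambda>x. synth (heat_coef t f) (complex_vec x)) \<in> borel_measurable lborel"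
    using borel_measurable_continuous_onI[OF cont] by simp
  have pw: "AE x in lborel. (\<lambda>i. \<Sum>k<id i. q k x) \<longlonglongrightarrow> synth (heat_coef t f) (complex_vec x)"
    by (simp add: qb synth_pointwise[OF rapid_heat_coef[OF f] t])
  note conv = B.nsq_convergence[OF summ meas strict_mono_id pw]
  have "(\<lambda>N. sqrt (nsq lborel (\<lambda>x. synth (heat_coef t f) (complex_vec x) - (\<Sum>k<N. q k x)))) \<longlonglongrightarrow> sqrt 0"
    by (intro tendsto_real_sqrt conv(2))
  then show ?thesis
    unfolding is_hermite_semigroup_def L2_eq L2_norm_eq semigroup_partial_sum[OF f] qb
    using conv(1) by simp
qed

text \<open>The sum of the Hermite series is entire and represents the semigroup on real vectors. Any other entire
function that does so agrees with it almost everywhere on real space, by continuity on all of real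
space, and therefore everywhere.\<close>

theorem heat_transform_eq:
  fixes f :: "real^'n::finite \<Rightarrow> complex"
  assumes f: "f \<in> sqi lborel" and t: "t > 0"
  shows "heat_transform t f = synth (heat_coef t f)"
  unfolding heat_transform_def
proof (rule the_equality)
  note ent = entire_synth[OF rapid_heat_coef[OF f] t]
  show "entire (synth (heat_coef t f)) \<and> is_hermite_semigroup t f (\<lambda>x. synth (heat_coef t f) (complex_vec x))"
    using ent synth_is_semigroup[OF f t] by blast
  fix F :: "complex^'n \<Rightarrow> complex"
  assume F: "entire F \<and> is_hermite_semigroup t f (\<lambda>x. F (complex_vec x))"
  define S where "S N x = (\<Sum>k<N. complex_of_real (exp (- (real (2 * k + CARD('n)) * t))) * hermite_proj k f x)" for N x
  have S: "S N \<in> sqi lborel" for N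
    unfolding S_def[abs_def] hermite_proj_eq[OF f] by (intro sqi_sum sqi_cmult HR.phi_sqi)
  have lim: "(\<lambda>N. nsq lborel (\<lambda>x. g x - S N x)) \<longlonglongrightarrow> 0" "g \<in> sqi lborel" if "is_hermite_semigroup t f g" for g
  proof -
    from that have "(\<lambda>N. sqrt (nsq lborel (\<lambda>x. g x - S N x))) \<longlonglongrightarrow> 0" and g: "g \<in> sqi lborel"
      unfolding is_hermite_semigroup_def L2_eq L2_norm_eq S_def by auto
    then have "(\<lambda>N. (sqrt (nsq lborel (\<lambda>x. g x - S N x)))\<^sup>2) \<longlonglongrightarrow> 0\<^sup>2" by (intro tendsto_power)
    then show "(\<lambda>N. nsq lborel (\<lambda>x. g x - S N x)) \<longlonglongrightarrow> 0" by (simp add: nsq_nonneg)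
    show "g \<in> sqi lborel" by (rule g)
  qed
  have "AE x in lborel. F (complex_vec x) = synth (heat_coef t f) (complex_vec x)"
    by (rule nsq_limit_unique[where S=S])
       (use lim[OF conjunct2[OF F]] lim[OF synth_is_semigroup[OF f t]] S in auto)
  then have eq: "F (complex_vec x) = synth (heat_coef t f) (complex_vec x)" for x
    by (rule continuous_AE_eq[OF entire_continuous_real[OF conjunct1[OF F]] entire_continuous_real[OF ent]])
  have "F z - synth (heat_coef t f) z = 0" for z
    by (rule entire_zero_on_reals[OF entire_diff[OF conjunct1[OF F] ent]]) (simp add: eq)
  then show "F = synth (heat_coef t f)" by auto
qed

text \<open>The hypothesis says precisely that the family \<open>exp (\<lambda>\<^sub>k * t) * a\<close> is square summable, so that
the Riesz--Fischer theorem provides a function with these coefficients.\<close>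

theorem rapid_is_heat_coef:
  fixes a :: "('n::finite \<Rightarrow> nat) \<Rightarrow> complex"
  assumes a: "rapid t a"
  shows "\<exists>f\<in>sqi lborel. heat_coef t f = a"
proof -
  define c where "c \<alpha> = of_real (exp (eigval TYPE('n) (mdeg \<alpha>) * t)) * a \<alpha>" for \<alpha> :: "'n \<Rightarrow> nat"
  define q where "q k x = (\<Sum>\<alpha>\<in>level k. c \<alpha> * hermite_Phi \<alpha> x)" for k x
  interpret B: orth_seq lborel q
    unfolding q_def[abs_def] by (rule HR.orth_seq_blocks) (auto simp: level_disjoint)
  have nq: "nsq lborel (q k) = exp (2 * eigval TYPE('n) k * t) * level_sq a k" for k
  proof -
    have e: "exp (2 * (eigval TYPE('n) k * t)) = (exp (eigval TYPE('n) k * t))\<^sup>2" by (rule exp_double)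
    have "nsq lborel (q k) = (\<Sum>\<alpha>\<in>level k. (cmod (c \<alpha>))\<^sup>2)"
      unfolding q_def[abs_def] by (simp add: HR.nsq_comb)
    also have "\<dots> = exp (2 * (eigval TYPE('n) k * t)) * level_sq a k"
      unfolding level_sq_def sum_distrib_left e
      by (intro sum.cong refl) (simp add: c_def level_def norm_mult power_mult_distrib)
    finally show ?thesis by (simp add: mult.assoc)
  qed
  have "summable (\<lambda>k. nsq lborel (q k))" unfolding nq using a unfolding rapid_def .
  from B.Riesz_Fischer[OF this] obtain f where f: "f \<in> sqi lborel"
    and lim: "(\<lambda>N. nsq lborel (\<lambda>x. f x - (\<Sum>k<N. q k x))) \<longlonglongrightarrow> 0" by blast
  have "coef f \<alpha> = c \<alpha>" for \<alpha>
  proof -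
    have "(\<lambda>N. ip lborel (\<lambda>x. \<Sum>k<N. q k x) (hermite_Phi \<alpha>)) \<longlonglongrightarrow> coef f \<alpha>"
      unfolding coef_def by (rule ip_tendsto_left[OF f _ HR.phi_sqi lim]) (intro sqi_sum B.q_sqi)
    moreover have "\<forall>\<^sub>F N in sequentially. ip lborel (\<lambda>x. \<Sum>k<N. q k x) (hermite_Phi \<alpha>) = c \<alpha>"
      unfolding eventually_sequentially
    proof (intro exI allI impI)
      fix N assume "Suc (mdeg \<alpha>) \<le> N"
      then show "ip lborel (\<lambda>x. \<Sum>k<N. q k x) (hermite_Phi \<alpha>) = c \<alpha>"
        unfolding q_def sum_levels by (subst HR.ip_comb_phi[OF finite_mdeg_less]) auto
    qed
    ultimately show ?thesis by (rule LIMSEQ_unique[OF _ tendsto_eventually])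
  qed
  then have "heat_coef t f = a"
    by (auto simp: heat_coef_def c_def fun_eq_iff simp flip: of_real_mult exp_add mult.assoc)
  then show ?thesis using f by blast
qed

text \<open>A series determines its coefficients by orthogonality.\<close>

lemma synth_inject:
  fixes a b :: "('n::finite \<Rightarrow> nat) \<Rightarrow> complex"
  assumes "rapid t a" "rapid t b" "t > 0" "synth a = synth b"
  shows "a = b"
proof
  fix \<alpha> :: "'n \<Rightarrow> nat"
  have "complex_of_real (iso_const TYPE('n) * exp (2 * eigval TYPE('n) (mdeg \<alpha>) * t)) \<noteq> 0"
    using iso_const_pos[where 'n='n] by simp
  then show "a \<alpha> = b \<alpha>"
    using synth_isometry(3)[OF assms(1,3), of \<alpha>] synth_isometry(3)[OF assms(2,3), of \<alpha>] assms(4) by simp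
qed

lemma synth_linear:
  assumes "rapid t a" "rapid t b" "t > 0"
  shows "synth (\<lambda>\<alpha>. c * a \<alpha> + d * b \<alpha>) z = c * synth a z + d * synth b z"
proof -
  have "(\<lambda>N. c * (\<Sum>k<N. block a k z) + d * (\<Sum>k<N. block b k z)) \<longlonglongrightarrow> c * synth a z + d * synth b z"
    by (intro tendsto_intros synth_pointwise[OF assms(1,3)] synth_pointwise[OF assms(2,3)])
  moreover have "c * (\<Sum>k<N. block a k z) + d * (\<Sum>k<N. block b k z) = (\<Sum>k<N. block (\<lambda>\<alpha>. c * a \<alpha> + d * b \<alpha>) k z)" for N
    by (simp add: block_def sum_distrib_left sum.distrib distrib_right mult.assoc)
  ultimately have "(\<lambda>k. block (\<lambda>\<alpha>. c * a \<alpha> + d * b \<alpha>) k z) sums (c * synth a z + d * synth b z)"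
    by (simp add: sums_def)
  then show ?thesis by (simp add: synth_def sums_iff)
qed

lemma coef_linear:
  "f \<in> sqi lborel \<Longrightarrow> g \<in> sqi lborel \<Longrightarrow> coef (\<lambda>x. a * f x + b * g x) \<alpha> = a * coef f \<alpha> + b * coef g \<alpha>"
  by (simp add: coef_def ip_add_left ip_cmult_left sqi_cmult HR.phi_sqi)

lemma coef_cong_AE:
  assumes "f \<in> sqi lborel" "g \<in> sqi lborel" "AE x in lborel. f x = g x"
  shows "coef f = coef g"
proof
  fix \<alpha>
  have [measurable]: "f \<in> borel_measurable borel" "g \<in> borel_measurable borel"
    using sqi_measurable[OF assms(1)] sqi_measurable[OF assms(2)] by simp_all
  show "coef f \<alpha> = coef g \<alpha>"
    unfolding coef_def ip_def using assms(3) by (intro integral_cong_AE) auto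
qed

text \<open>Completeness, applied to the difference.\<close>

lemma AE_eq_if_coef_eq:
  assumes f: "f \<in> sqi lborel" and g: "g \<in> sqi lborel" and eq: "coef f = coef g"
  shows "AE x in lborel. f x = g x"
proof -
  have "coef (\<lambda>x. f x - g x) \<alpha> = coef f \<alpha> - coef g \<alpha>" for \<alpha>
    by (simp add: coef_def ip_diff_left HR.phi_sqi f g)
  then have "coef (\<lambda>x. f x - g x) \<alpha> = 0" for \<alpha> by (simp add: eq)
  from hermite_complete[OF sqi_diff[OF f g] this] show ?thesis by simp
qed

section \<open>The fractional weights and the Sobolev norms\<close>

lemma weighted_norm2_gauss:
  fixes F :: "complex^'n \<Rightarrow> complex"
  assumes [measurable]: "F \<in> borel_measurable borel"
  shows "weighted_norm2 (\<lambda>z. ennreal (weight_U r z)) F = (\<integral>\<^sup>+z. ennreal ((cmod (F z))\<^sup>2) \<partial>gauss_measure r)"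
  unfolding weighted_norm2_def gauss_measure_def by (subst nn_integral_density) (auto simp: mult.commute)

lemma weighted_norm2_sqi:
  fixes F :: "complex^'n \<Rightarrow> complex"
  assumes "F \<in> sqi (gauss_measure r)"
  shows "weighted_norm2 (\<lambda>z. ennreal (weight_U r z)) F = ennreal (nsq (gauss_measure r) F)"
proof -
  have m: "F \<in> borel_measurable borel"
    using sqi_measurable[OF assms] by (simp add: measurable_cong_sets[OF sets_gauss_measure refl])
  show ?thesis unfolding weighted_norm2_gauss[OF m] nsq_def
    by (rule nn_integral_eq_integral) (auto intro: sqi_integrable assms)
qed

lemma HL2_iff: "F \<in> HL2 t \<longleftrightarrow> entire F \<and> F \<in> sqi (gauss_measure t)"
proof (cases "entire F")
  case True
  have m[measurable]: "F \<in> borel_measurable borel" by (rule entire_measurable[OF True])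
  have mg: "F \<in> borel_measurable (gauss_measure t)" using m by (simp add: measurable_cong_sets[OF sets_gauss_measure refl])
  have "weighted_norm2 (\<lambda>z. ennreal (weight_U t z)) F < \<infinity> \<longleftrightarrow> F \<in> sqi (gauss_measure t)"
    unfolding weighted_norm2_gauss[OF m] sqi_def using mg by (simp add: integrable_iff_bounded)
  then show ?thesis by (simp add: HL2_def True)
qed (simp add: HL2_def)

lemma weighted_norm2_synth:
  fixes a :: "('n::finite \<Rightarrow> nat) \<Rightarrow> complex"
  assumes a: "rapid r a" and r: "r > 0"
  shows "weighted_norm2 (\<lambda>z. ennreal (weight_U r z)) (synth a)
    = (\<Sum>k. ennreal (iso_const TYPE('n) * (exp (2 * eigval TYPE('n) k * r) * level_sq a k)))"
proof -
  note s = synth_isometry(2)[OF a r]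
  have nn: "0 \<le> iso_const TYPE('n) * (exp (2 * eigval TYPE('n) k * r) * level_sq a k)" for k
    using iso_const_pos[where 'n='n] level_sq_nonneg[of a k] by simp
  show ?thesis
    unfolding weighted_norm2_sqi[OF synth_isometry(1)[OF a r]] sums_unique[OF s]
    by (rule suminf_ennreal2[symmetric]) (use nn sums_summable[OF s] in auto)
qed

lemma weight_U_measurable_pair:
  "(\<lambda>p. weight_U (fst p) (snd p)) \<in> borel_measurable (borel :: (real \<times> (complex^'n)) measure)"
proof -
  have [measurable]: "(\<lambda>x::real. sinh x) \<in> borel_measurable borel" "(\<lambda>x::real. cosh x) \<in> borel_measurable borel"
    by (intro borel_measurable_continuous_onI continuous_intros)+
  have [measurable]: "(\<lambda>p::real \<times> (complex^'n). fst p) \<in> borel_measurable borel"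
    "(\<lambda>p::real \<times> (complex^'n). norm (im_vec (snd p))) \<in> borel_measurable borel"
    "(\<lambda>p::real \<times> (complex^'n). norm (re_vec (snd p))) \<in> borel_measurable borel"
    unfolding im_vec_def re_vec_def by (intro borel_measurable_continuous_onI continuous_intros)+
  show ?thesis unfolding weight_U_def tanh_def by measurable
qed

text \<open>Tonelli's theorem turns the norm with respect to a fractional weight into a fractional
  integral of the norms with respect to the weights at earlier times.\<close>

lemma weighted_norm2_frac:
  fixes G :: "complex^'n \<Rightarrow> complex"
  assumes [measurable]: "G \<in> borel_measurable borel"
  shows "weighted_norm2 (weight_U_frac t \<gamma>) G = ennreal (1 / Gamma (2 * \<gamma>)) *
    (\<integral>\<^sup>+r. ennreal ((t - r) powr (2 * \<gamma> - 1)) * indicator {0<..<t} r * weighted_norm2 (\<lambda>z. ennreal (weight_U r z)) G \<partial>lborel)"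
proof -
  define k where "k r z = ennreal ((cmod (G z))\<^sup>2) * (ennreal ((t - r) powr (2 * \<gamma> - 1) * weight_U r z) * indicator {0<..<t} r)" for r :: real and z
  have km: "case_prod k \<in> borel_measurable (lborel \<Otimes>\<^sub>M lborel)"
  proof -
    note [measurable] = weight_U_measurable_pair
    have [measurable]: "(\<lambda>p::real \<times> (complex^'n). fst p) \<in> borel_measurable borel" "(\<lambda>p::real \<times> (complex^'n). snd p) \<in> borel_measurable borel"
      by (intro borel_measurable_continuous_onI continuous_intros)+
    have "(\<lambda>p::real \<times> (complex^'n). ennreal ((cmod (G (snd p)))\<^sup>2) * (ennreal ((t - fst p) powr (2 * \<gamma> - 1) * weight_U (fst p) (snd p)) * indicator {0<..<t} (fst p))) \<in> borel_measurable borel"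
      by measurable
    then show ?thesis by (simp add: lborel_prod k_def case_prod_beta')
  qed
  have km': "case_prod (\<lambda>z r. k r z) \<in> borel_measurable (lborel \<Otimes>\<^sub>M lborel)"
    using measurable_compose[OF measurable_pair_swap' km] by (simp add: case_prod_beta')
  have m1: "(\<lambda>r. ennreal ((t - r) powr (2 * \<gamma> - 1) * weight_U r z) * indicator {0<..<t} r) \<in> borel_measurable lborel" for z :: "complex^'n"
  proof -
    have "(\<lambda>r::real. (r, z)) \<in> borel_measurable borel" by (intro borel_measurable_continuous_onI continuous_intros)
    from measurable_compose[OF this weight_U_measurable_pair] have [measurable]: "(\<lambda>r. weight_U r z) \<in> borel_measurable borel" by simp
    show ?thesis by measurable
  qed
  have "weighted_norm2 (weight_U_frac t \<gamma>) G = (\<integral>\<^sup>+z. ennreal (1 / Gamma (2 * \<gamma>)) * (\<integral>\<^sup>+r. k r z \<partial>lborel) \<partial>lborel)"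
    unfolding weighted_norm2_def weight_U_frac_def
  proof (intro nn_integral_cong)
    fix z :: "complex^'n"
    have "(\<integral>\<^sup>+r. k r z \<partial>lborel) = ennreal ((cmod (G z))\<^sup>2) * (\<integral>\<^sup>+r. ennreal ((t - r) powr (2 * \<gamma> - 1) * weight_U r z) * indicator {0<..<t} r \<partial>lborel)"
      unfolding k_def by (rule nn_integral_cmult[OF m1])
    then show "ennreal ((cmod (G z))\<^sup>2) * (ennreal (1 / Gamma (2 * \<gamma>)) * (\<integral>\<^sup>+r\<in>{0<..<t}. ennreal ((t - r) powr (2 * \<gamma> - 1) * weight_U r z) \<partial>lborel))
      = ennreal (1 / Gamma (2 * \<gamma>)) * (\<integral>\<^sup>+r. k r z \<partial>lborel)" by (simp add: mult.left_commute)
  qed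
  also have "\<dots> = ennreal (1 / Gamma (2 * \<gamma>)) * (\<integral>\<^sup>+z. (\<integral>\<^sup>+r. k r z \<partial>lborel) \<partial>lborel)"
    by (rule nn_integral_cmult) (use lborel.borel_measurable_nn_integral[OF km'] in simp)
  also have "(\<integral>\<^sup>+z. (\<integral>\<^sup>+r. k r z \<partial>lborel) \<partial>lborel) = (\<integral>\<^sup>+r. (\<integral>\<^sup>+z. k r z \<partial>lborel) \<partial>lborel)"
    by (rule lborel_pair.Fubini'[OF km])
  also have "\<dots> = (\<integral>\<^sup>+r. ennreal ((t - r) powr (2 * \<gamma> - 1)) * indicator {0<..<t} r * weighted_norm2 (\<lambda>z. ennreal (weight_U r z)) G \<partial>lborel)"
  proof (intro nn_integral_cong)
    fix r :: real
    have "(\<integral>\<^sup>+z. k r z \<partial>lborel) = (\<integral>\<^sup>+z. (ennreal ((t - r) powr (2 * \<gamma> - 1)) * indicator {0<..<t} r) * (ennreal ((cmod (G z))\<^sup>2) * ennreal (weight_U r z)) \<partial>lborel)"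
      unfolding k_def by (intro nn_integral_cong) (simp add: ennreal_mult weight_U_nonneg mult_ac)
    also have "\<dots> = (ennreal ((t - r) powr (2 * \<gamma> - 1)) * indicator {0<..<t} r) * weighted_norm2 (\<lambda>z. ennreal (weight_U r z)) G"
      unfolding weighted_norm2_def by (rule nn_integral_cmult) measurable
    finally show "(\<integral>\<^sup>+z. k r z \<partial>lborel) = ennreal ((t - r) powr (2 * \<gamma> - 1)) * indicator {0<..<t} r * weighted_norm2 (\<lambda>z. ennreal (weight_U r z)) G" .
  qed
  finally show ?thesis .
qed

subsection \<open>Truncated Gamma integrals\<close>

definition trunc_gamma :: "real \<Rightarrow> real \<Rightarrow> ennreal" where
  "trunc_gamma p T = (\<integral>\<^sup>+v. ennreal (v powr (p - 1) * exp (- v)) * indicator {0<..<T} v \<partial>lborel)"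

lemma trunc_gamma_mono: "T \<le> T' \<Longrightarrow> trunc_gamma p T \<le> trunc_gamma p T'"
  unfolding trunc_gamma_def by (intro nn_integral_mono mult_left_mono) (auto simp: indicator_def)

lemma trunc_gamma_le: "p > 0 \<Longrightarrow> trunc_gamma p T \<le> ennreal (Gamma p)"
  unfolding trunc_gamma_def Gamma_conv_nn_integral_real
  by (intro nn_integral_mono) (auto simp: indicator_def exp_minus field_simps)

lemma trunc_gamma_pos:
  assumes "T > 0" shows "trunc_gamma p T > 0"
proof (rule ccontr)
  assume "\<not> trunc_gamma p T > 0"
  then have "trunc_gamma p T = 0" by (simp add: zero_less_iff_neq_zero)
  then have "AE v in lborel. ennreal (v powr (p - 1) * exp (- v)) * indicator {0<..<T} v = 0"
    unfolding trunc_gamma_def by (subst (asm) nn_integral_0_iff_AE) auto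
  then have "AE v in lborel. v \<notin> {0<..<T}"
    by eventually_elim (auto simp: indicator_def split: if_splits)
  then have "emeasure lborel {0<..<T} = 0"
    by (subst (asm) AE_iff_measurable[of "{0<..<T}"]) auto
  then show False using assms by simp
qed

text \<open>The substitution \<open>v = q * (t - r)\<close>.\<close>

lemma trunc_gamma_scale:
  assumes q: "q > 0"
  shows "(\<integral>\<^sup>+r. ennreal ((t - r) powr (p - 1) * exp (- (q * (t - r)))) * indicator {0<..<t} r \<partial>lborel)
    = ennreal (q powr (- p)) * trunc_gamma p (q * t)"
proof -
  have "(\<integral>\<^sup>+r. ennreal ((t - r) powr (p - 1) * exp (- (q * (t - r)))) * indicator {0<..<t} r \<partial>lborel)
    = ennreal \<bar>- 1 / q\<bar> * (\<integral>\<^sup>+v. ennreal ((t - (t + (- 1 / q) * v)) powr (p - 1) * exp (- (q * (t - (t + (- 1 / q) * v))))) * indicator {0<..<t} (t + (- 1 / q) * v) \<partial>lborel)"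
    using q by (intro nn_integral_real_affine) auto
  also have "\<dots> = (\<integral>\<^sup>+v. ennreal \<bar>- 1 / q\<bar> * (ennreal ((t - (t + (- 1 / q) * v)) powr (p - 1) * exp (- (q * (t - (t + (- 1 / q) * v))))) * indicator {0<..<t} (t + (- 1 / q) * v)) \<partial>lborel)"
    by (rule nn_integral_cmult[symmetric]) measurable
  also have "\<dots> = (\<integral>\<^sup>+v. ennreal (q powr (- p)) * (ennreal (v powr (p - 1) * exp (- v)) * indicator {0<..<q * t} v) \<partial>lborel)"
  proof (intro nn_integral_cong)
    fix v :: real
    have ind: "t + (- 1 / q) * v \<in> {0<..<t} \<longleftrightarrow> v \<in> {0<..<q * t}" using q by (auto simp: field_simps)
    show "ennreal \<bar>- 1 / q\<bar> * (ennreal ((t - (t + (- 1 / q) * v)) powr (p - 1) * exp (- (q * (t - (t + (- 1 / q) * v))))) * indicator {0<..<t} (t + (- 1 / q) * v))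
      = ennreal (q powr (- p)) * (ennreal (v powr (p - 1) * exp (- v)) * indicator {0<..<q * t} v)"
    proof (cases "v \<in> {0<..<q * t}")
      case True
      have d: "t - (t + (- 1 / q) * v) = v / q" "q * (v / q) = v" "\<bar>- 1 / q\<bar> = 1 / q" using q by auto
      have "1 / q * ((v / q) powr (p - 1)) = q powr (- p) * v powr (p - 1)"
      proof -
        have "(v / q) powr (p - 1) = v powr (p - 1) * (q powr (- (p - 1)))"
          using True q unfolding powr_minus by (simp add: powr_divide divide_inverse[of "v powr (p - 1)"])
        moreover have "q powr (- p) = 1 / q * q powr (- (p - 1))"
        proof -
          have "q powr (- p) = q powr (-1 + - (p - 1))" by (rule arg_cong[of _ _ "(powr) q"]) simp
          also have "\<dots> = 1 / q * q powr (- (p - 1))" unfolding powr_add using q by (simp only: powr_neg_one)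
          finally show ?thesis .
        qed
        ultimately show ?thesis by (simp only: mult_ac)
      qed
      then have "(1 / q) * ((v / q) powr (p - 1) * exp (- v)) = q powr (- p) * (v powr (p - 1) * exp (- v))"
        by (simp only: mult.assoc[symmetric])
      then show ?thesis using ind True q unfolding d
        by (simp only: indicator_def if_True mult_1_right flip: ennreal_mult'' ) (simp flip: ennreal_mult)
    next
      case False
      then have "indicator {0<..<t} (t + (- 1 / q) * v) = (0 :: ennreal)" "indicator {0<..<q * t} v = (0 :: ennreal)"
        unfolding indicator_def using ind by (simp_all only: if_False of_bool_def)
      then show ?thesis by (simp only: mult_zero_right)
    qed
  qed
  also have "\<dots> = ennreal (q powr (- p)) * trunc_gamma p (q * t)"
    unfolding trunc_gamma_def by (rule nn_integral_cmult) measurable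
  finally show ?thesis .
qed

subsection \<open>The top order term is equivalent to the Hermite--Sobolev norm\<close>

lemma sob_order_gt: "0 \<le> s \<Longrightarrow> real (sob_order s) - s / 2 > 0"
  unfolding sob_order_def by (simp add: of_nat_nat)

text \<open>At the time \<open>r < t\<close> the level \<open>k\<close> of the \<open>m\<close>-fold Hermite operator carries the factor
\<open>\<lambda>\<^sub>k ^ (2 * m) * exp (2 * \<lambda>\<^sub>k * r)\<close>. Integrating over \<open>r\<close> against \<open>(t - r) powr (p - 1)\<close> leaves the power
\<open>2 * m - p = s\<close> of the eigenvalue. All terms are nonnegative, so sum and integral may be interchanged
without any assumption of finiteness.\<close>

lemma hol_sobolev_top_series:
  fixes a :: "('n::finite \<Rightarrow> nat) \<Rightarrow> complex"
  assumes t: "t > 0" and s: "s \<ge> 0" and a: "rapid t a"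
  defines "p \<equiv> 2 * (real (sob_order s) - s / 2)"
  shows "hol_sobolev_top s t (synth a) = ennreal (1 / Gamma p) *
    (\<Sum>k. ennreal (iso_const TYPE('n) * 2 powr (- p) * (eigval TYPE('n) k powr s * (exp (2 * eigval TYPE('n) k * t) * level_sq a k)))
       * trunc_gamma p (2 * eigval TYPE('n) k * t))"
proof -
  define m where "m = sob_order s"
  have p: "p > 0" using sob_order_gt[OF s] by (simp add: p_def)
  define l where "l k = eigval TYPE('n) k" for k
  have l: "l k \<ge> 1" for k by (simp add: l_def eigval_ge_1)
  define c where "c = iso_const TYPE('n)"
  have c: "c > 0" by (simp add: c_def iso_const_pos)
  define b where "b k = exp (2 * l k * t) * level_sq a k" for k
  have b: "b k \<ge> 0" for k by (simp add: b_def level_sq_nonneg)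
  define G where "G = synth (scale_eig m a)"
  have G: "(hermite_op_C ^^ m) (synth a) = G" unfolding G_def by (rule hermite_op_C_power_synth[OF a t])
  have "rapid (t / 2) (scale_eig m a)" by (rule rapid_scale[OF a]) (use t in simp)
  then have "entire G" unfolding G_def by (rule entire_synth) (use t in simp)
  then have Gm: "G \<in> borel_measurable borel" by (rule entire_measurable)
  have inner: "ennreal ((t - r) powr (p - 1)) * indicator {0<..<t} r * weighted_norm2 (\<lambda>z. ennreal (weight_U r z)) G
     = (\<Sum>k. ennreal (c * l k ^ (2 * m) * b k) * (ennreal ((t - r) powr (p - 1) * exp (- (2 * l k * (t - r)))) * indicator {0<..<t} r))" for r
  proof (cases "r \<in> {0<..<t}")
    case True
    then have r: "0 < r" "r < t" by auto
    have "weighted_norm2 (\<lambda>z. ennreal (weight_U r z)) G = (\<Sum>k. ennreal (c * (exp (2 * l k * r) * level_sq (scale_eig m a) k)))"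
      unfolding G_def c_def l_def by (rule weighted_norm2_synth[OF rapid_scale[OF a r(2)] r(1)])
    also have "\<dots> = (\<Sum>k. ennreal (c * l k ^ (2 * m) * b k) * ennreal (exp (- (2 * l k * (t - r)))))"
    proof (intro suminf_cong)
      fix k
      have "exp (2 * l k * r) = exp (2 * l k * t) * exp (- (2 * l k * (t - r)))" by (simp add: algebra_simps flip: exp_add)
      then have "c * (exp (2 * l k * r) * level_sq (scale_eig m a) k) = (c * l k ^ (2 * m) * b k) * exp (- (2 * l k * (t - r)))"
        by (simp add: level_sq_scale l_def[symmetric] b_def mult_ac)
      then show "ennreal (c * (exp (2 * l k * r) * level_sq (scale_eig m a) k)) = ennreal (c * l k ^ (2 * m) * b k) * ennreal (exp (- (2 * l k * (t - r))))"
        using c b[of k] l[of k] by (simp flip: ennreal_mult)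
    qed
    finally have "ennreal ((t - r) powr (p - 1)) * weighted_norm2 (\<lambda>z. ennreal (weight_U r z)) G
      = (\<Sum>k. ennreal ((t - r) powr (p - 1)) * (ennreal (c * l k ^ (2 * m) * b k) * ennreal (exp (- (2 * l k * (t - r))))))"
      by simp
    also have "\<dots> = (\<Sum>k. ennreal (c * l k ^ (2 * m) * b k) * ennreal ((t - r) powr (p - 1) * exp (- (2 * l k * (t - r)))))"
      by (intro suminf_cong) (simp add: ennreal_mult mult_ac)
    finally show ?thesis using True by simp
  qed simp
  have "hol_sobolev_top s t (synth a) = weighted_norm2 (weight_U_frac t (real m - s / 2)) G"
    unfolding hol_sobolev_top_def m_def[symmetric] G ..
  also have "\<dots> = ennreal (1 / Gamma p) * (\<integral>\<^sup>+r. ennreal ((t - r) powr (p - 1)) * indicator {0<..<t} r * weighted_norm2 (\<lambda>z. ennreal (weight_U r z)) G \<partial>lborel)"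
    unfolding p_def m_def[symmetric] by (rule weighted_norm2_frac[OF Gm])
  also have "(\<integral>\<^sup>+r. ennreal ((t - r) powr (p - 1)) * indicator {0<..<t} r * weighted_norm2 (\<lambda>z. ennreal (weight_U r z)) G \<partial>lborel)
     = (\<Sum>k. \<integral>\<^sup>+r. ennreal (c * l k ^ (2 * m) * b k) * (ennreal ((t - r) powr (p - 1) * exp (- (2 * l k * (t - r)))) * indicator {0<..<t} r) \<partial>lborel)"
    unfolding inner by (rule nn_integral_suminf) measurable
  also have "\<dots> = (\<Sum>k. ennreal (c * 2 powr (- p) * (l k powr s * b k)) * trunc_gamma p (2 * l k * t))"
  proof (intro suminf_cong)
    fix k
    have lk: "l k > 0" using l[of k] by linarith
    have "(\<integral>\<^sup>+r. ennreal (c * l k ^ (2 * m) * b k) * (ennreal ((t - r) powr (p - 1) * exp (- (2 * l k * (t - r)))) * indicator {0<..<t} r) \<partial>lborel)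
      = ennreal (c * l k ^ (2 * m) * b k) * (ennreal ((2 * l k) powr (- p)) * trunc_gamma p (2 * l k * t))"
      by (subst nn_integral_cmult, measurable) (subst trunc_gamma_scale, use lk in auto)
    also have "\<dots> = ennreal (c * l k ^ (2 * m) * b k * (2 * l k) powr (- p)) * trunc_gamma p (2 * l k * t)"
      using c b[of k] lk by (simp add: ennreal_mult mult.assoc)
    also have "c * l k ^ (2 * m) * b k * (2 * l k) powr (- p) = c * 2 powr (- p) * (l k powr s * b k)"
    proof -
      have "l k ^ (2 * m) * l k powr (- p) = l k powr (real (2 * m) + - p)"
        using lk by (simp only: powr_add powr_realpow)
      also have "real (2 * m) + - p = s" by (simp add: p_def m_def)
      finally show ?thesis using lk by (simp add: powr_mult mult_ac)
    qed
    finally show "(\<integral>\<^sup>+r. ennreal (c * l k ^ (2 * m) * b k) * (ennreal ((t - r) powr (p - 1) * exp (- (2 * l k * (t - r)))) * indicator {0<..<t} r) \<partial>lborel)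
      = ennreal (c * 2 powr (- p) * (l k powr s * b k)) * trunc_gamma p (2 * l k * t)" .
  qed
  finally show ?thesis unfolding c_def l_def b_def .
qed

text \<open>The terms of the series for the square of the Hermite--Sobolev norm.\<close>

definition sob_series :: "real \<Rightarrow> (real^'n \<Rightarrow> complex) \<Rightarrow> nat \<Rightarrow> real" where
  "sob_series s f k = eigval TYPE('n) k powr s * level_sq (coef f) k"

lemma sob_series_nonneg: "0 \<le> sob_series s f k"
  by (simp add: sob_series_def level_sq_nonneg)

lemma hermite_sobolev_iff: "f \<in> hermite_sobolev s \<longleftrightarrow> f \<in> sqi lborel \<and> summable (sob_series s f)"
  by (auto simp: hermite_sobolev_def L2_eq L2_norm_proj sob_series_def[abs_def] eigval_def)

lemma hermite_sobolev_norm_eq: "f \<in> sqi lborel \<Longrightarrow> hermite_sobolev_norm s f = sqrt (\<Sum>k. sob_series s f k)"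
  by (simp add: hermite_sobolev_norm_def L2_norm_proj sob_series_def[abs_def] eigval_def)

lemma ennreal_scaled_suminf:
  assumes "0 \<le> g" "0 \<le> c" "0 \<le> i" "\<And>k. 0 \<le> x k"
  shows "ennreal g * (\<Sum>k. ennreal (c * x k) * ennreal i) = ennreal (g * c * i) * (\<Sum>k. ennreal (x k))"
proof -
  have "(\<Sum>k. ennreal (c * x k) * ennreal i) = (\<Sum>k. ennreal (c * i) * ennreal (x k))"
    using assms by (intro suminf_cong) (simp add: mult_ac flip: ennreal_mult)
  also have "\<dots> = ennreal (c * i) * (\<Sum>k. ennreal (x k))" by simp
  also have "ennreal g * \<dots> = ennreal (g * c * i) * (\<Sum>k. ennreal (x k))"
    using assms by (simp add: ennreal_mult mult.assoc)
  finally show ?thesis .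
qed

text \<open>The truncation points \<open>2 * \<lambda>\<^sub>k * t\<close> are at least \<open>2 * t\<close>, so that all truncated Gamma integrals lie
between the one truncated at \<open>2 * t\<close>, which is positive, and the full one.\<close>

lemma hol_sobolev_top_bounds:
  fixes t s :: real
  assumes t: "t > 0" and s: "s \<ge> 0"
  obtains K L where "K > 0" "L \<ge> 0"
    "\<forall>f\<in>(sqi lborel :: (real^'n::finite \<Rightarrow> complex) set). ennreal K * (\<Sum>k. ennreal (sob_series s f k)) \<le> hol_sobolev_top s t (heat_transform t f)"
    "\<forall>f\<in>(sqi lborel :: (real^'n::finite \<Rightarrow> complex) set). hol_sobolev_top s t (heat_transform t f) \<le> ennreal L * (\<Sum>k. ennreal (sob_series s f k))"
proof -
  define p where "p = 2 * (real (sob_order s) - s / 2)"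
  have p: "p > 0" using sob_order_gt[OF s] by (simp add: p_def)
  have Gp: "Gamma p > 0" using p by (rule Gamma_real_pos)
  define g where "g = 1 / Gamma p"
  have g: "g > 0" using Gp by (simp add: g_def)
  define c where "c = iso_const TYPE('n) * 2 powr (- p)"
  have c: "c > 0" by (simp add: c_def iso_const_pos)
  define I where "I = enn2real (trunc_gamma p (2 * t))"
  have fin: "trunc_gamma p (2 * t) < \<top>" by (rule le_less_trans[OF trunc_gamma_le[OF p]]) simp
  have I: "ennreal I = trunc_gamma p (2 * t)" unfolding I_def by (rule ennreal_enn2real[OF fin])
  have Ipos: "I > 0" unfolding I_def using trunc_gamma_pos[of "2 * t" p] t fin by (simp add: enn2real_positive_iff)
  have top: "hol_sobolev_top s t (heat_transform t f) = ennreal g *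
      (\<Sum>k. ennreal (c * sob_series s f k) * trunc_gamma p (2 * eigval TYPE('n) k * t))"
    if f: "f \<in> sqi lborel" for f :: "real^'n \<Rightarrow> complex"
    unfolding heat_transform_eq[OF f t] hol_sobolev_top_series[OF t s rapid_heat_coef[OF f]] level_sq_heat_coef sob_series_def c_def p_def g_def ..
  have le: "2 * t \<le> 2 * eigval TYPE('n) k * t" for k using eigval_ge_1[of k, where 'n='n] t by simp
  show thesis
  proof (rule that[of "g * c * I" "g * c * Gamma p"]; (intro ballI)?)
    show "0 < g * c * I" using g c Ipos by simp
    show "0 \<le> g * c * Gamma p" using g c Gp by simp
    fix f :: "real^'n \<Rightarrow> complex" assume f: "f \<in> sqi lborel"
    have "ennreal (g * c * I) * (\<Sum>k. ennreal (sob_series s f k)) = ennreal g * (\<Sum>k. ennreal (c * sob_series s f k) * ennreal I)"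
      by (rule ennreal_scaled_suminf[symmetric]) (use g c Ipos sob_series_nonneg in auto)
    also have "\<dots> \<le> hol_sobolev_top s t (heat_transform t f)"
      unfolding top[OF f] I by (intro mult_left_mono suminf_le trunc_gamma_mono le) auto
    finally show "ennreal (g * c * I) * (\<Sum>k. ennreal (sob_series s f k)) \<le> hol_sobolev_top s t (heat_transform t f)" .
    have "hol_sobolev_top s t (heat_transform t f) \<le> ennreal g * (\<Sum>k. ennreal (c * sob_series s f k) * ennreal (Gamma p))"
      unfolding top[OF f] by (intro mult_left_mono suminf_le trunc_gamma_le p) auto
    also have "\<dots> = ennreal (g * c * Gamma p) * (\<Sum>k. ennreal (sob_series s f k))"
      by (rule ennreal_scaled_suminf) (use g c Gp sob_series_nonneg in auto)
    finally show "hol_sobolev_top s t (heat_transform t f) \<le> ennreal (g * c * Gamma p) * (\<Sum>k. ennreal (sob_series s f k))" .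
  qed
qed

lemma heat_transform_in_HL2:
  assumes f: "f \<in> sqi lborel" and t: "t > 0"
  shows "heat_transform t f \<in> HL2 t"
  unfolding HL2_iff heat_transform_eq[OF f t]
  by (intro conjI entire_synth[OF rapid_heat_coef[OF f] t] synth_isometry(1)[OF rapid_heat_coef[OF f] t])

lemma HL2_is_heat_transform:
  fixes F :: "complex^'n::finite \<Rightarrow> complex"
  assumes F: "F \<in> HL2 t" and t: "t > 0"
  shows "\<exists>f\<in>sqi lborel. heat_transform t f = F"
proof -
  have FF: "entire F" "F \<in> sqi (gauss_measure t)" using F unfolding HL2_iff by auto
  define a where "a = (\<lambda>\<alpha>. ip (gauss_measure t) F (PhiC \<alpha>) / of_real (iso_const TYPE('n) * exp (2 * eigval TYPE('n) (mdeg \<alpha>) * t)))"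
  have a: "rapid t a" "F = synth a" unfolding a_def by (rule entire_sqi_expansion[OF t FF])+
  obtain f where f: "f \<in> sqi lborel" "heat_coef t f = a" using rapid_is_heat_coef[OF a(1)] by blast
  then show ?thesis using heat_transform_eq[OF f(1) t] a(2) by auto
qed

lemma weighted_norm2_heat_transform:
  fixes f :: "real^'n::finite \<Rightarrow> complex"
  assumes f: "f \<in> sqi lborel" and t: "t > 0"
  shows "weighted_norm2 (\<lambda>z. ennreal (weight_U t z)) (heat_transform t f) = ennreal (iso_const TYPE('n)) * (\<Sum>k. ennreal (level_sq (coef f) k))"
proof -
  have "weighted_norm2 (\<lambda>z. ennreal (weight_U t z)) (heat_transform t f) = (\<Sum>k. ennreal (iso_const TYPE('n) * level_sq (coef f) k))"
    unfolding heat_transform_eq[OF f t] weighted_norm2_synth[OF rapid_heat_coef[OF f] t] level_sq_heat_coef ..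
  also have "\<dots> = (\<Sum>k. ennreal (iso_const TYPE('n)) * ennreal (level_sq (coef f) k))"
    using iso_const_pos[where 'n='n] by (intro suminf_cong) (simp add: ennreal_mult level_sq_nonneg)
  finally show ?thesis by simp
qed

section \<open>The isomorphism\<close>

theorem theorem1p7:
  fixes t s :: real
  assumes "t > 0" and "s \<ge> 0"
  shows
    "(\<forall>f\<in>(hermite_sobolev s :: (real^'n \<Rightarrow> complex) set).
        \<forall>g\<in>hermite_sobolev s. \<forall>a b.
          heat_transform t (\<lambda>x. a * f x + b * g x)
            = (\<lambda>z. a * heat_transform t f z + b * heat_transform t g z))
   \<and> (\<forall>f\<in>(hermite_sobolev s :: (real^'n \<Rightarrow> complex) set). \<forall>g\<in>hermite_sobolev s.
          heat_transform t f = heat_transform t g \<longleftrightarrow> (AE x in lborel. f x = g x))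
   \<and> heat_transform t ` (hermite_sobolev s :: (real^'n \<Rightarrow> complex) set) = hol_sobolev s t
   \<and> (\<exists>C. \<forall>f\<in>(hermite_sobolev s :: (real^'n \<Rightarrow> complex) set).
          hol_sobolev_norm s t (heat_transform t f) \<le> C * hermite_sobolev_norm s f)
   \<and> (\<exists>C. \<forall>f\<in>(hermite_sobolev s :: (real^'n \<Rightarrow> complex) set).
          hermite_sobolev_norm s f \<le> C * hol_sobolev_norm s t (heat_transform t f))"
proof (intro conjI ballI allI)
  note t = assms(1) and s = assms(2)
  obtain K L where K: "K > 0" and L: "L \<ge> 0"
    and lowup: "\<forall>f\<in>(sqi lborel :: (real^'n \<Rightarrow> complex) set). ennreal K * (\<Sum>k. ennreal (sob_series s f k)) \<le> hol_sobolev_top s t (heat_transform t f)"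
      "\<forall>f\<in>(sqi lborel :: (real^'n \<Rightarrow> complex) set). hol_sobolev_top s t (heat_transform t f) \<le> ennreal L * (\<Sum>k. ennreal (sob_series s f k))"
    by (rule hol_sobolev_top_bounds[OF t s])
  note low = bspec[OF lowup(1)] and up = bspec[OF lowup(2)]
  have top_finite: "hol_sobolev_top s t (heat_transform t f) < \<infinity> \<longleftrightarrow> summable (sob_series s f)"
    if f: "f \<in> sqi lborel" for f :: "real^'n \<Rightarrow> complex"
  proof
    assume fin: "hol_sobolev_top s t (heat_transform t f) < \<infinity>"
    have "(\<Sum>k. ennreal (sob_series s f k)) \<noteq> \<top>"
    proof
      assume "(\<Sum>k. ennreal (sob_series s f k)) = \<top>"
      then have "\<top> \<le> hol_sobolev_top s t (heat_transform t f)" using low[OF f] K by (simp add: ennreal_mult_top)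
      then show False using fin by (simp add: top_unique)
    qed
    then show "summable (sob_series s f)" by (intro summable_suminf_not_top sob_series_nonneg)
  next
    assume "summable (sob_series s f)"
    then have "(\<Sum>k. ennreal (sob_series s f k)) = ennreal (\<Sum>k. sob_series s f k)"
      by (intro suminf_ennreal2 sob_series_nonneg)
    then have "ennreal L * (\<Sum>k. ennreal (sob_series s f k)) < \<infinity>" by (simp add: ennreal_mult_less_top)
    then show "hol_sobolev_top s t (heat_transform t f) < \<infinity>" using up[OF f] by (rule le_less_trans[rotated])
  qed
  show "heat_transform t (\<lambda>x. a * f x + b * g x) = (\<lambda>z. a * heat_transform t f z + b * heat_transform t g z)"
    if "f \<in> hermite_sobolev s" "g \<in> hermite_sobolev s" for f g :: "real^'n \<Rightarrow> complex" and a b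
  proof -
    have f: "f \<in> sqi lborel" and g: "g \<in> sqi lborel" using that by (auto simp: hermite_sobolev_iff)
    have fg: "(\<lambda>x. a * f x + b * g x) \<in> sqi lborel" by (intro sqi_add sqi_cmult f g)
    have hc: "heat_coef t (\<lambda>x. a * f x + b * g x) = (\<lambda>\<alpha>. a * heat_coef t f \<alpha> + b * heat_coef t g \<alpha>)"
      by (simp add: heat_coef_def coef_linear[OF f g] fun_eq_iff algebra_simps)
    show ?thesis
      unfolding heat_transform_eq[OF f t] heat_transform_eq[OF g t] heat_transform_eq[OF fg t] hc
      by (rule ext) (rule synth_linear[OF rapid_heat_coef[OF f] rapid_heat_coef[OF g] t])
  qed
  show "heat_transform t f = heat_transform t g \<longleftrightarrow> (AE x in lborel. f x = g x)"
    if "f \<in> hermite_sobolev s" "g \<in> hermite_sobolev s" for f g :: "real^'n \<Rightarrow> complex"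
  proof
    have f: "f \<in> sqi lborel" and g: "g \<in> sqi lborel" using that by (auto simp: hermite_sobolev_iff)
    {
      assume "heat_transform t f = heat_transform t g"
      then have "heat_coef t f = heat_coef t g"
        unfolding heat_transform_eq[OF f t] heat_transform_eq[OF g t]
        by (rule synth_inject[OF rapid_heat_coef[OF f] rapid_heat_coef[OF g] t])
      then have "coef f = coef g" by (simp add: heat_coef_def fun_eq_iff)
      then show "AE x in lborel. f x = g x" by (rule AE_eq_if_coef_eq[OF f g])
    next
      assume "AE x in lborel. f x = g x"
      then have "coef f = coef g" by (rule coef_cong_AE[OF f g])
      then have "heat_coef t f = heat_coef t g" by (simp add: heat_coef_def fun_eq_iff)
      then show "heat_transform t f = heat_transform t g"
        unfolding heat_transform_eq[OF f t] heat_transform_eq[OF g t] by simp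
    }
  qed
  show "heat_transform t ` (hermite_sobolev s :: (real^'n \<Rightarrow> complex) set) = hol_sobolev s t"
  proof (intro equalityI subsetI)
    fix F :: "complex^'n \<Rightarrow> complex" assume "F \<in> heat_transform t ` hermite_sobolev s"
    then obtain f where f: "f \<in> sqi lborel" "summable (sob_series s f)" "F = heat_transform t f"
      by (auto simp: hermite_sobolev_iff)
    then show "F \<in> hol_sobolev s t"
      using heat_transform_in_HL2[OF f(1) t] top_finite[OF f(1)] by (simp add: hol_sobolev_def)
  next
    fix F :: "complex^'n \<Rightarrow> complex" assume "F \<in> hol_sobolev s t"
    then have F: "F \<in> HL2 t" "hol_sobolev_top s t F < \<infinity>" by (auto simp: hol_sobolev_def)
    obtain f where f: "f \<in> sqi lborel" "heat_transform t f = F" using HL2_is_heat_transform[OF F(1) t] by blast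
    then have "f \<in> hermite_sobolev s" using top_finite[OF f(1)] F(2) by (simp add: hermite_sobolev_iff)
    then show "F \<in> heat_transform t ` hermite_sobolev s" using f(2) by blast
  qed
  define c where "c = iso_const TYPE('n)"
  have c: "c > 0" by (simp add: c_def iso_const_pos)
  define \<Sigma> where "\<Sigma> f = (\<Sum>k. sob_series s f k)" for f :: "real^'n \<Rightarrow> complex"
  have main: "hermite_sobolev_norm s f = sqrt (\<Sigma> f)" "0 \<le> \<Sigma> f"
    "K * \<Sigma> f \<le> (hol_sobolev_norm s t (heat_transform t f))\<^sup>2" "(hol_sobolev_norm s t (heat_transform t f))\<^sup>2 \<le> (c + L) * \<Sigma> f"
    "0 \<le> hol_sobolev_norm s t (heat_transform t f)"
    if "f \<in> hermite_sobolev s" for f :: "real^'n \<Rightarrow> complex"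
  proof -
    have f: "f \<in> sqi lborel" and sm: "summable (sob_series s f)" using that by (auto simp: hermite_sobolev_iff)
    show "hermite_sobolev_norm s f = sqrt (\<Sigma> f)" unfolding \<Sigma>_def by (rule hermite_sobolev_norm_eq[OF f])
    show \<Sigma>0: "0 \<le> \<Sigma> f" unfolding \<Sigma>_def by (intro suminf_nonneg sm sob_series_nonneg)
    have ES: "(\<Sum>k. ennreal (sob_series s f k)) = ennreal (\<Sigma> f)"
      unfolding \<Sigma>_def by (intro suminf_ennreal2 sob_series_nonneg sm)
    define N where "N = weighted_norm2 (\<lambda>z. ennreal (weight_U t z)) (heat_transform t f) + hol_sobolev_top s t (heat_transform t f)"
    have hn: "hol_sobolev_norm s t (heat_transform t f) = sqrt (enn2real N)" unfolding hol_sobolev_norm_def N_def ..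
    show "0 \<le> hol_sobolev_norm s t (heat_transform t f)" unfolding hn by simp
    have "ennreal (K * \<Sigma> f) = ennreal K * (\<Sum>k. ennreal (sob_series s f k))"
      using K \<Sigma>0 by (simp add: ES ennreal_mult)
    also have "\<dots> \<le> hol_sobolev_top s t (heat_transform t f)" by (rule low[OF f])
    also have "\<dots> \<le> N" unfolding N_def by simp
    finally have l: "ennreal (K * \<Sigma> f) \<le> N" .
    have "weighted_norm2 (\<lambda>z. ennreal (weight_U t z)) (heat_transform t f) \<le> ennreal c * (\<Sum>k. ennreal (sob_series s f k))"
      unfolding weighted_norm2_heat_transform[OF f t] c_def
    proof (intro mult_left_mono suminf_le ennreal_leI)
      fix k
      have "1 \<le> eigval TYPE('n) k powr s" using eigval_ge_1[of k, where 'n='n] s by (rule ge_one_powr_ge_zero)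
      then have "1 * level_sq (coef f) k \<le> eigval TYPE('n) k powr s * level_sq (coef f) k"
        by (intro mult_right_mono level_sq_nonneg)
      then show "level_sq (coef f) k \<le> sob_series s f k" by (simp add: sob_series_def)
    qed auto
    then have "N \<le> ennreal c * (\<Sum>k. ennreal (sob_series s f k)) + ennreal L * (\<Sum>k. ennreal (sob_series s f k))"
      unfolding N_def by (intro add_mono up[OF f])
    also have "\<dots> = ennreal ((c + L) * \<Sigma> f)"
      using c L \<Sigma>0 unfolding ES by (simp add: distrib_right flip: ennreal_mult ennreal_plus)
    finally have u: "N \<le> ennreal ((c + L) * \<Sigma> f)" .
    have Nf: "N < \<top>" by (rule le_less_trans[OF u]) simp
    have Ne: "ennreal (enn2real N) = N" by (rule ennreal_enn2real[OF Nf])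
    have h2: "(hol_sobolev_norm s t (heat_transform t f))\<^sup>2 = enn2real N" unfolding hn by simp
    have "ennreal (K * \<Sigma> f) \<le> ennreal (enn2real N)" "ennreal (enn2real N) \<le> ennreal ((c + L) * \<Sigma> f)"
      unfolding Ne by (fact l, fact u)
    then show "K * \<Sigma> f \<le> (hol_sobolev_norm s t (heat_transform t f))\<^sup>2"
      "(hol_sobolev_norm s t (heat_transform t f))\<^sup>2 \<le> (c + L) * \<Sigma> f"
      using c L \<Sigma>0 unfolding h2 by (simp_all add: ennreal_le_iff)
  qed
  show "\<exists>C. \<forall>f\<in>(hermite_sobolev s :: (real^'n \<Rightarrow> complex) set). hol_sobolev_norm s t (heat_transform t f) \<le> C * hermite_sobolev_norm s f"
  proof (intro exI[of _ "sqrt (c + L)"] ballI)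
    fix f :: "real^'n \<Rightarrow> complex" assume f: "f \<in> hermite_sobolev s"
    have "hol_sobolev_norm s t (heat_transform t f) \<le> sqrt ((c + L) * \<Sigma> f)"
      using main(4)[OF f] by (rule real_le_rsqrt)
    then show "hol_sobolev_norm s t (heat_transform t f) \<le> sqrt (c + L) * hermite_sobolev_norm s f"
      by (simp add: main(1)[OF f] real_sqrt_mult)
  qed
  show "\<exists>C. \<forall>f\<in>(hermite_sobolev s :: (real^'n \<Rightarrow> complex) set). hermite_sobolev_norm s f \<le> C * hol_sobolev_norm s t (heat_transform t f)"
  proof (intro exI[of _ "1 / sqrt K"] ballI)
    fix f :: "real^'n \<Rightarrow> complex" assume f: "f \<in> hermite_sobolev s"
    have "sqrt (K * \<Sigma> f) \<le> hol_sobolev_norm s t (heat_transform t f)"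
      by (rule real_le_lsqrt[OF main(5)[OF f] main(3)[OF f]])
    then show "hermite_sobolev_norm s f \<le> 1 / sqrt K * hol_sobolev_norm s t (heat_transform t f)"
      using K by (simp add: main(1)[OF f] real_sqrt_mult field_simps)
  qed
qed

end
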